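(* Let $d\ge1$, $p\ge2$ be integers with $d(p-1)<2p$. Let $W^1,\dots,W^p$ be independent standard Brownian motions in $\mathbb{R}^d$, with intersection measure $\ell_t^{\otimes p}$ and smoothed intersection measure $\ell_{t,\epsilon}^{\otimes p}$. Then for any bounded measurable function $f$ on $\mathbb{R}^d$, $$\limsup_{\epsilon\to0}\limsup_{t\to\infty}\frac1t\log\mathbb{E}\exp\big|\langle f,\ell_t^{\otimes p}-\ell_{t,\epsilon}^{\otimes p}\rangle\big|^{1/p}=0.$$
   Context: $p_\epsilon(x)=(2\pi\epsilon)^{-d/2}e^{-|x|^2/2\epsilon}$. The smoothed intersection measure is $$\ell_{t,\epsilon}^{\otimes p}(A)=\int_A\int_{[0,t]^p}\prod_{j=1}^pp_\epsilon(W^j(s_j)-y)\,ds_1\cdots ds_p\,dy.$$ The intersection measure is formally $\ell_t^{\otimes p}(A)=\int_A\int_{[0,t]^p}\prod_{j=1}^p\delta(W^j(s_j)-y)\,ds_1\cdots ds_p\,dy$. Rigorously, it is the a.s. unique random finite Borel measure on $\mathbb{R}^d$ such that $\langle f,\ell_{t,\epsilon}^{\otimes p}\rangle\to\langle f,\ell_t^{\otimes p}\rangle$ in $L^m(\mathbb{P})$ for all $m\ge1$ as $\epsilon\to0$, for every bounded continuous $f$. Its existence for $d(p-1)<2p$ is known. $\langle f,\mu\rangle=\int f\,d\mu$, and $\exp|\cdot|^{1/p}$ means $\exp(|\cdot|^{1/p})$. *)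

theory Defs
  imports "HOL-Probability.Probability"
begin

definition heat_kernel :: "real \<Rightarrow> real ^ 'd \<Rightarrow> real" where
  "heat_kernel \<epsilon> x =
     (2 * pi * \<epsilon>) powr (- (real CARD('d) / 2)) * exp (- (norm x)\<^sup>2 / (2 * \<epsilon>))"

text \<open>
  Standard means started at the origin with unit covariance: \<^term>\<open>heat_kernel (t - s)\<close> is the
  density of a centred Gaussian vector with covariance \<open>(t - s) I\<close>. The starting point and the
  path continuity are only required almost surely.
\<close>

definition standard_brownian_motion :: "'w measure \<Rightarrow> (real \<Rightarrow> 'w \<Rightarrow> real ^ 'd) \<Rightarrow> bool" where
  "standard_brownian_motion M W \<longleftrightarrow>
     prob_space M \<and>
     (\<forall>t\<ge>0. W t \<in> borel_measurable M) \<and>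
     (AE \<omega> in M. W 0 \<omega> = 0) \<and>
     (\<forall>(n::nat) (\<tau> :: nat \<Rightarrow> real). 0 \<le> \<tau> 0 \<and> (\<forall>i<n. \<tau> i \<le> \<tau> (Suc i)) \<longrightarrow>
        prob_space.indep_vars M (\<lambda>_. borel) (\<lambda>i \<omega>. W (\<tau> (Suc i)) \<omega> - W (\<tau> i) \<omega>) {..<n}) \<and>
     (\<forall>s t. 0 \<le> s \<and> s < t \<longrightarrow>
        distributed M lborel (\<lambda>\<omega>. W t \<omega> - W s \<omega>) (\<lambda>x. ennreal (heat_kernel (t - s) x))) \<and>
     (AE \<omega> in M. continuous_on {0..} (\<lambda>t. W t \<omega>))"

text \<open>
  The motions are indexed by \<open>j \<in> {1..p}\<close>. Each one is a random element of the product space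
  over the time set \<open>{0..}\<close>, so that whole processes are independent.
\<close>

definition independent_brownian_motions ::
    "'w measure \<Rightarrow> nat \<Rightarrow> (nat \<Rightarrow> real \<Rightarrow> 'w \<Rightarrow> real ^ 'd) \<Rightarrow> bool" where
  "independent_brownian_motions M p W \<longleftrightarrow>
     (\<forall>j\<in>{1..p}. standard_brownian_motion M (W j)) \<and>
     prob_space.indep_vars M (\<lambda>_. \<Pi>\<^sub>M t\<in>{0..}. borel) (\<lambda>j \<omega>. \<lambda>t\<in>{0..}. W j t \<omega>) {1..p}"

definition smoothed_intersection_measure ::
    "nat \<Rightarrow> (nat \<Rightarrow> real \<Rightarrow> 'w \<Rightarrow> real ^ 'd) \<Rightarrow> real \<Rightarrow> real \<Rightarrow> 'w \<Rightarrow> (real ^ 'd) measure" where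
  "smoothed_intersection_measure p W t \<epsilon> \<omega> =
     density lborel (\<lambda>y. \<integral>\<^sup>+s\<in>(\<Pi>\<^sub>E j\<in>{1..p}. {0..t}).
       ennreal (\<Prod>j\<in>{1..p}. heat_kernel \<epsilon> (W j (s j) \<omega> - y)) \<partial>(\<Pi>\<^sub>M j\<in>{1..p}. lborel))"

text \<open>
  The pairing of \<open>f\<close> with the signed measure \<open>\<mu> - \<nu>\<close>; both measures are finite and \<open>f\<close> is
  bounded wherever this is used.
\<close>

definition pairing_diff :: "('b \<Rightarrow> real) \<Rightarrow> 'b measure \<Rightarrow> 'b measure \<Rightarrow> real" where
  "pairing_diff f \<mu> \<nu> = (\<integral>x. f x \<partial>\<mu>) - (\<integral>x. f x \<partial>\<nu>)"

definition random_finite_borel_measure ::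
    "'w measure \<Rightarrow> ('w \<Rightarrow> ('b::topological_space) measure) \<Rightarrow> bool" where
  "random_finite_borel_measure M L \<longleftrightarrow>
     (\<forall>\<omega>\<in>space M. sets (L \<omega>) = sets borel \<and> finite_measure (L \<omega>)) \<and>
     (\<forall>A\<in>sets borel. (\<lambda>\<omega>. emeasure (L \<omega>) A) \<in> borel_measurable M)"

text \<open>
  \<open>L\<close> is a version of the intersection measure at time \<open>t\<close>, which is determined almost surely by
  these conditions. The moments are taken in \<^typ>\<open>ennreal\<close>, so that convergence in \<open>L\<^sup>m\<close> cannot hold
  by the default value of a divergent Bochner integral.
\<close>

definition is_intersection_measure ::
    "'w measure \<Rightarrow> nat \<Rightarrow> (nat \<Rightarrow> real \<Rightarrow> 'w \<Rightarrow> real ^ 'd) \<Rightarrow> real \<Rightarrow>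
     ('w \<Rightarrow> (real ^ 'd) measure) \<Rightarrow> bool" where
  "is_intersection_measure M p W t L \<longleftrightarrow>
     random_finite_borel_measure M L \<and>
     (\<forall>f :: real ^ 'd \<Rightarrow> real. continuous_on UNIV f \<and> bounded (range f) \<longrightarrow>
       (\<forall>m::real. m \<ge> 1 \<longrightarrow>
         ((\<lambda>\<epsilon>. \<integral>\<^sup>+\<omega>. ennreal (\<bar>pairing_diff f (smoothed_intersection_measure p W t \<epsilon> \<omega>) (L \<omega>)\<bar>
              powr m) \<partial>M) \<longlongrightarrow> 0) (at_right 0)))"

definition ereal_ln :: "ennreal \<Rightarrow> ereal" where
  "ereal_ln x = (if x = 0 then -\<infinity> else if x = \<top> then \<infinity> else ereal (ln (enn2real x)))"

end

theory Submission
  imports Defs "HOL-Combinatorics.Multiset_Permutations"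
begin

text \<open>
  Write \<open>q\<close> for a heat kernel \<open>p\<^sub>e\<close> or a difference \<open>p\<^sub>e\<^sub>' - p\<^sub>e\<close> with \<open>e' \<le> e\<close>. Telescoping the product
  over the \<open>p\<close> motions, independence and Hoelder's inequality bound the even moments of
  \<open>\<langle>f, \<ell>\<^sub>e\<^sub>' - \<ell>\<^sub>e\<rangle>\<close> by products of \<open>L\<^sup>p\<close> norms of the functions
  \<open>y \<mapsto> E (\<Prod>i. \<integral>\<^sub>0\<^sup>t q (W s - y i) ds)\<close>, one factor having \<open>q\<close> equal to a difference. Such an expectation is a
  sum, over the orders in which the points are visited, of iterated integrals of transition
  densities. Grouping the times in consecutive pairs, a Jensen inequality weighted by
  \<open>exp (- lam * time)\<close> gives the bound \<open>(2n)! \<kappa>\<^sup>n exp (lam * t)\<close> for the norm of order \<open>2n\<close>, for every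
  \<open>lam > 0\<close> and uniformly in \<open>t\<close>; the time singularities are integrable exactly because
  \<open>d (p - 1) < 2 p\<close>. For the difference factor, one averaging per pair makes \<open>\<kappa>\<close> tend to \<open>0\<close> with \<open>e\<close>.
  Letting \<open>e'\<close> tend to \<open>0\<close> and then approximating \<open>f\<close> by continuous functions, the moment of order \<open>2n\<close>
  of \<open>\<langle>f, \<ell> - \<ell>\<^sub>e\<rangle>\<close> is at most \<open>((2n)!)\<^sup>p \<rho>\<^sub>e\<^sup>n exp (p * lam * t)\<close> with \<open>\<rho>\<^sub>e\<close> small. Summing the
  exponential series shows that the growth rate is at most \<open>p * lam\<close>, and \<open>lam\<close> is arbitrary.
\<close>

section \<open>Inequalities\<close>

text \<open>A difference \<open>q\<close> of two heat kernels can have mass close to 2 however small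
  \<open>e\<close> is; it is small only against slowly varying functions. In the iterated integral
  every visited position is shared by two transition densities, so cancellation at one visit
  competes with cancellation at the next. Hence only the first visit of each pair is integrated with
  its sign; the second enters through \<open>\<bar>q\<bar>\<close> and its mass. This gives n small
  factors out of 2n, which is enough. All bounds are uniform in \<open>e'\<close>, so
  \<open>e'\<close> may tend to 0 at fixed \<open>t\<close> and \<open>n\<close>.

  The other constraint is the time singularity. For integers, \<open>d * (p - 1) < 2 * p\<close>
  leaves a gap of at least \<open>1 / (2 * p)\<close> below the critical exponent 1. The continuity
  modulus of the Gaussian densities may use up only part of that gap, hence its exponent 1/4.

  The factor (2n)! per motion gives at most (2pn)! in total, which is what the root of order
  \<open>p\<close> inside the exponential compensates.\<close>

text \<open>Convexity of the \<open>p\<close>-th power: its graph lies above the tangent at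
  \<open>a\<close>. This is Bernoulli's inequality for \<open>g / a\<close>, scaled by
  \<open>a ^ p\<close>, in a form without division that carries over to extended values.\<close>

lemma Bernoulli_tangent:
  fixes g a :: real
  assumes "p \<ge> 1" "0 \<le> g" "0 < a"
  shows "real p * a ^ (p - 1) * g \<le> g ^ p + real (p - 1) * a ^ p"
proof -
  have "1 + real p * (g / a - 1) \<le> (1 + (g / a - 1)) ^ p"
    using assms by (intro Bernoulli_inequality) auto
  then have "a ^ p * (1 + real p * (g / a - 1)) \<le> a ^ p * (g / a) ^ p"
    using assms by (intro mult_left_mono) auto
  also have "a ^ p * (g / a) ^ p = g ^ p"
    using assms by (simp add: power_divide)
  finally have *: "a ^ p * (1 + real p * (g / a - 1)) \<le> g ^ p" .
  have "a ^ p * (1 + real p * (g / a - 1)) = real p * a ^ (p - 1) * g - real (p - 1) * a ^ p"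
  proof (cases p)
    case (Suc n)
    then show ?thesis using assms by (simp add: field_simps)
  qed (use assms in simp)
  with * show ?thesis by simp
qed

text \<open>Jensen's inequality for the finite measure with density \<open>f\<close>: integrate the tangent-line
  bound of the \<open>p\<close>-th power, taken at the mean value of \<open>g\<close>.\<close>

lemma nn_integral_mult_power_le:
  fixes f g :: "'a \<Rightarrow> ennreal"
  assumes [measurable]: "f \<in> borel_measurable M" "g \<in> borel_measurable M"
    and p: "p \<ge> 1" and m: "0 < m" and fm: "(\<integral>\<^sup>+x. f x \<partial>M) \<le> ennreal m"
  shows "(\<integral>\<^sup>+x. f x * g x \<partial>M) ^ p \<le> ennreal m ^ (p - 1) * (\<integral>\<^sup>+x. f x * g x ^ p \<partial>M)"
proof -
  define I where "I = (\<integral>\<^sup>+x. f x * g x \<partial>M)"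
  define J where "J = (\<integral>\<^sup>+x. f x * g x ^ p \<partial>M)"
  have tangent: "ennreal (real p * a ^ (p - 1)) * I \<le> J + ennreal (real (p - 1) * a ^ p * m)"
    if a: "0 < a" for a
  proof -
    have pt: "ennreal (real p * a ^ (p - 1)) * g x \<le> g x ^ p + ennreal (real (p - 1) * a ^ p)" for x
    proof (cases "g x")
      case (real r)
      then show ?thesis
        using Bernoulli_tangent[OF p _ a, of r] a
        by (auto simp: ennreal_power ennreal_mult' [symmetric] ennreal_plus[symmetric] simp del: ennreal_plus)
    next
      case top
      then show ?thesis using p by (cases p) (auto simp: ennreal_top_mult)
    qed
    have "ennreal (real p * a ^ (p - 1)) * I = (\<integral>\<^sup>+x. f x * (ennreal (real p * a ^ (p - 1)) * g x) \<partial>M)"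
      unfolding I_def by (subst nn_integral_cmult[symmetric]) (auto simp: ac_simps)
    also have "\<dots> \<le> (\<integral>\<^sup>+x. f x * (g x ^ p + ennreal (real (p - 1) * a ^ p)) \<partial>M)"
      by (intro nn_integral_mono mult_left_mono pt) auto
    also have "\<dots> = J + (\<integral>\<^sup>+x. f x \<partial>M) * ennreal (real (p - 1) * a ^ p)"
      unfolding J_def by (simp add: distrib_left nn_integral_add nn_integral_multc)
    also have "\<dots> \<le> J + ennreal m * ennreal (real (p - 1) * a ^ p)"
      by (intro add_left_mono mult_right_mono fm) auto
    also have "\<dots> = J + ennreal (real (p - 1) * a ^ p * m)"
      using m a by (simp add: ennreal_mult'[symmetric] mult_ac)
    finally show ?thesis .
  qed
  show ?thesis
  proof (cases "J = \<top>")
    case True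
    then show ?thesis using m unfolding J_def[symmetric] by (simp add: ennreal_power ennreal_mult_top)
  next
    case False
    then obtain j where j: "J = ennreal j" "0 \<le> j" by (cases J) auto
    \<comment> \<open>The tangent at 1 shows that \<open>I\<close> is finite because
      \<open>J\<close> is, so that a mean value can be formed.\<close>
    have "ennreal (real p) * I \<le> ennreal (j + real (p - 1) * m)"
      using tangent[of 1] j m by (simp add: ennreal_plus)
    moreover have "ennreal (real p) * \<top> = \<top>" using p by (simp add: ennreal_mult_top)
    ultimately obtain i where i: "I = ennreal i" "0 \<le> i"
      by (cases I) (auto simp: top_unique)
    show ?thesis
    proof (cases "i = 0")
      case True
      then show ?thesis using i p unfolding I_def[symmetric] by (simp add: power_0_left)
    next
      case False
      with i have i0: "0 < i" by simp
      define a where "a = i / m"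
      have a: "0 < a" using i0 m by (simp add: a_def)
      have "ennreal (real p * a ^ (p - 1) * i) \<le> ennreal (j + real (p - 1) * a ^ p * m)"
        using tangent[OF a] i j m a by (simp add: ennreal_mult'[symmetric] ennreal_plus[symmetric] del: ennreal_plus)
      then have *: "real p * a ^ (p - 1) * i \<le> j + real (p - 1) * a ^ p * m"
        using j a m by (subst (asm) ennreal_le_iff) auto
      have e: "a ^ p * m = a ^ (p - 1) * i"
        using p m by (cases p) (auto simp: a_def)
      have "real p * (a ^ (p - 1) * i) \<le> j + real (p - 1) * (a ^ (p - 1) * i)"
        using * e by (simp add: mult.assoc)
      moreover have "real (p - 1) = real p - 1" using p by simp
      ultimately have "a ^ (p - 1) * i \<le> j" by (simp add: algebra_simps)
      then have "m ^ (p - 1) * (a ^ (p - 1) * i) \<le> m ^ (p - 1) * j"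
        using m by (intro mult_left_mono) auto
      also have "m ^ (p - 1) * (a ^ (p - 1) * i) = i ^ p"
        using p m by (cases p) (auto simp: a_def power_divide)
      finally have "ennreal (i ^ p) \<le> ennreal (m ^ (p - 1) * j)" by (simp add: ennreal_leI)
      then show ?thesis
        using i j m unfolding I_def[symmetric] J_def[symmetric]
        by (simp add: ennreal_power ennreal_mult)
    qed
  qed
qed

text \<open>The preceding Jensen inequality for the counting measure on \<open>I\<close>, whose mass
  is \<open>card I\<close>.\<close>

lemma sum_power_le_card_power:
  fixes x :: "'a \<Rightarrow> real"
  assumes "finite I" "p \<ge> 1" "\<And>i. i \<in> I \<Longrightarrow> 0 \<le> x i"
  shows "(\<Sum>i\<in>I. x i) ^ p \<le> real (card I) ^ (p - 1) * (\<Sum>i\<in>I. x i ^ p)"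
proof (cases "I = {}")
  case False
  have "(\<integral>\<^sup>+i. 1 * ennreal (x i) \<partial>count_space I) ^ p
     \<le> ennreal (real (card I)) ^ (p - 1) * (\<integral>\<^sup>+i. 1 * ennreal (x i) ^ p \<partial>count_space I)"
    using assms False
    by (intro nn_integral_mult_power_le)
      (auto simp: card_gt_0_iff ennreal_of_nat_eq_real_of_nat)
  then have "ennreal ((\<Sum>i\<in>I. x i) ^ p) \<le> ennreal (real (card I) ^ (p - 1) * (\<Sum>i\<in>I. x i ^ p))"
    using assms by (simp add: nn_integral_count_space_finite ennreal_power sum_nonneg ennreal_mult)
  then show ?thesis
    using assms by (subst (asm) ennreal_le_iff) (auto intro!: mult_nonneg_nonneg sum_nonneg)
qed (use assms in \<open>auto simp: power_0_left\<close>)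

text \<open>The arithmetic-geometric mean inequality for the powers \<open>x i ^ card S\<close>, so
  that no roots remain.\<close>

lemma prod_le_sum_power_div:
  fixes x :: "'a \<Rightarrow> real"
  assumes "finite S" "S \<noteq> {}" "\<And>i. i \<in> S \<Longrightarrow> 0 \<le> x i"
  shows "(\<Prod>i\<in>S. x i) \<le> (\<Sum>i\<in>S. x i ^ card S / card S)"
proof -
  have c: "card S > 0" using assms by (simp add: card_gt_0_iff)
  have "(\<Prod>i\<in>S. x i ^ card S) powr (1 / card S) \<le> (\<Sum>i\<in>S. x i ^ card S / card S)"
    using assms by (intro arith_geom_mean) auto
  also have "(\<Prod>i\<in>S. x i ^ card S) = (\<Prod>i\<in>S. x i) ^ card S"
    by (simp add: prod_power_distrib)
  also have "((\<Prod>i\<in>S. x i) ^ card S) powr (1 / card S) = (\<Prod>i\<in>S. x i)"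
  proof (cases "(\<Prod>i\<in>S. x i) = 0")
    case False
    then have "0 < (\<Prod>i\<in>S. x i)" using assms by (intro prod_pos) (auto simp: less_le)
    then show ?thesis using c by (simp add: powr_realpow[symmetric] powr_powr)
  qed (use c in auto)
  finally show ?thesis .
qed

text \<open>Hoelder's inequality with all exponents equal to \<open>card S\<close>. After division
  of each factor by its bound \<open>B i\<close>, the arithmetic-geometric mean inequality leaves
  \<open>card S\<close> summands, each with integral at most \<open>1 / card S\<close>. Given bounds
  thus take the place of norms.\<close>

lemma nn_integral_prod_Hoelder:
  fixes h :: "'i \<Rightarrow> 'a \<Rightarrow> real"
  assumes S: "finite S" "S \<noteq> {}"
    and meas[measurable]: "\<And>i. i \<in> S \<Longrightarrow> h i \<in> borel_measurable M"
    and nn: "\<And>i x. i \<in> S \<Longrightarrow> 0 \<le> h i x"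
    and B: "\<And>i. i \<in> S \<Longrightarrow> 0 < B i"
    and le: "\<And>i. i \<in> S \<Longrightarrow> (\<integral>\<^sup>+x. ennreal (h i x ^ card S) \<partial>M) \<le> ennreal (B i ^ card S)"
  shows "(\<integral>\<^sup>+x. ennreal (\<Prod>i\<in>S. h i x) \<partial>M) \<le> ennreal (\<Prod>i\<in>S. B i)"
proof -
  have c: "card S > 0" using S by (simp add: card_gt_0_iff)
  have P: "0 < (\<Prod>i\<in>S. B i)" using B by (intro prod_pos) auto
  have "(\<integral>\<^sup>+x. ennreal (\<Prod>i\<in>S. h i x) \<partial>M)
      \<le> (\<integral>\<^sup>+x. (\<Sum>i\<in>S. ennreal ((\<Prod>i\<in>S. B i) / (card S * B i ^ card S)) * ennreal (h i x ^ card S)) \<partial>M)"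
  proof (intro nn_integral_mono)
    fix x
    have "(\<Prod>i\<in>S. h i x) = (\<Prod>i\<in>S. B i) * (\<Prod>i\<in>S. h i x / B i)"
      using P by (simp add: prod_dividef)
    also have "\<dots> \<le> (\<Prod>i\<in>S. B i) * (\<Sum>i\<in>S. (h i x / B i) ^ card S / card S)"
      using S nn B P by (intro mult_left_mono prod_le_sum_power_div) (auto intro!: divide_nonneg_pos)
    also have "\<dots> = (\<Sum>i\<in>S. (\<Prod>i\<in>S. B i) / (card S * B i ^ card S) * (h i x ^ card S))"
      by (simp add: sum_distrib_left power_divide field_simps)
    finally have "ennreal (\<Prod>i\<in>S. h i x)
      \<le> ennreal (\<Sum>i\<in>S. (\<Prod>i\<in>S. B i) / (card S * B i ^ card S) * (h i x ^ card S))"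
      by (rule ennreal_leI)
    also have "\<dots> = (\<Sum>i\<in>S. ennreal ((\<Prod>i\<in>S. B i) / (card S * B i ^ card S)) * ennreal (h i x ^ card S))"
      using P nn B S c
      by (subst sum_ennreal[symmetric])
        (auto intro!: sum.cong mult_nonneg_nonneg divide_nonneg_pos simp: ennreal_mult[symmetric] less_imp_le)
    finally show "ennreal (\<Prod>i\<in>S. h i x) \<le> \<dots>" .
  qed
  also have "\<dots> = (\<Sum>i\<in>S. ennreal ((\<Prod>i\<in>S. B i) / (card S * B i ^ card S)) * (\<integral>\<^sup>+x. ennreal (h i x ^ card S) \<partial>M))"
    by (subst nn_integral_sum) (auto intro!: sum.cong nn_integral_cmult)
  also have "\<dots> \<le> (\<Sum>i\<in>S. ennreal ((\<Prod>i\<in>S. B i) / (card S * B i ^ card S)) * ennreal (B i ^ card S))"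
    by (intro sum_mono mult_left_mono le) auto
  also have "\<dots> = (\<Sum>i\<in>S. ennreal ((\<Prod>i\<in>S. B i) / card S))"
  proof (intro sum.cong refl)
    fix i assume i: "i \<in> S"
    have "ennreal ((\<Prod>i\<in>S. B i) / (card S * B i ^ card S)) * ennreal (B i ^ card S)
        = ennreal ((\<Prod>i\<in>S. B i) / (card S * B i ^ card S) * B i ^ card S)"
      using P B[OF i] by (intro ennreal_mult[symmetric]) (auto intro!: divide_nonneg_nonneg)
    also have "(\<Prod>i\<in>S. B i) / (card S * B i ^ card S) * B i ^ card S = (\<Prod>i\<in>S. B i) / card S"
      using B[OF i] c by (simp add: field_simps)
    finally show "ennreal ((\<Prod>i\<in>S. B i) / (card S * B i ^ card S)) * ennreal (B i ^ card S)
        = ennreal ((\<Prod>i\<in>S. B i) / card S)" .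
  qed
  also have "\<dots> = ennreal (\<Prod>i\<in>S. B i)"
    using P c by (simp add: ennreal_of_nat_eq_real_of_nat ennreal_mult[symmetric])
  finally show ?thesis .
qed

text \<open>A single term of the exponential series, with index a multiple of \<open>N\<close>,
  dominates \<open>exp x\<close> up to a rescaling by 6. For \<open>x \<ge> N\<close>, rounding
  \<open>x / N\<close> upwards gives \<open>m = N * n\<close> with \<open>x \<le> m < 2 * x\<close>,
  and then \<open>exp x \<le> 3 ^ m \<le> (6 * x / m) ^ m\<close>. The restriction to multiples is
  imposed by the moments, which are available for even orders only.\<close>

lemma exp_le_sum_lacunary:
  fixes x :: real
  assumes x: "0 \<le> x" and N: "N \<ge> 1"
  shows "\<exists>n. exp x \<le> exp (real N) * ((6 * x) ^ (N * n) / fact (N * n))"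
proof (cases "x < real N")
  case True
  then show ?thesis by (intro exI[of _ 0]) simp
next
  case False
  define n where "n = nat \<lceil>x / real N\<rceil>"
  define m where "m = N * n"
  have N0: "0 < real N" using N by simp
  have "x / real N \<le> real n" "real n < x / real N + 1"
    using x N unfolding n_def by (auto simp: le_nat_iff) linarith+
  then have m1: "x \<le> real m" and m2: "real m < x + real N"
    using N0 unfolding m_def by (auto simp: field_simps)
  have m3: "real m < 2 * x" using m2 False by simp
  have mpos: "0 < real m" using m1 False N0 by linarith
  have "exp x \<le> exp (real m)" using m1 by simp
  also have "\<dots> = exp 1 ^ m" by (simp add: exp_of_nat_mult[symmetric])
  also have "\<dots> \<le> 3 ^ m" by (intro power_mono exp_le) auto
  also have "\<dots> \<le> (6 * x / real m) ^ m"
    using m3 mpos by (intro power_mono) (auto simp: field_simps)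
  also have "\<dots> = (6 * x) ^ m / real (m ^ m)" by (simp add: power_divide)
  also have "\<dots> \<le> (6 * x) ^ m / fact m"
  proof (rule divide_left_mono)
    have "fact m \<le> m ^ m" using fact_le_power[of m, where 'a = nat] by simp
    then show "(fact m :: real) \<le> real (m ^ m)"
      by (metis of_nat_fact of_nat_le_iff)
  qed (use x mpos in auto)
  also have "\<dots> \<le> exp (real N) * ((6 * x) ^ m / fact m)"
    using x mult_right_mono[of 1 "exp (real N)" "(6 * x) ^ m / fact m"] by simp
  finally show ?thesis unfolding m_def by blast
qed

lemma power_add_le_two_power:
  fixes a b :: real
  shows "\<bar>a + b\<bar> ^ k \<le> 2 ^ k * (\<bar>a\<bar> ^ k + \<bar>b\<bar> ^ k)"
proof -
  have "\<bar>a + b\<bar> ^ k \<le> (2 * max \<bar>a\<bar> \<bar>b\<bar>) ^ k" by (intro power_mono) auto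
  also have "\<dots> = 2 ^ k * (max \<bar>a\<bar> \<bar>b\<bar>) ^ k" by (rule power_mult_distrib)
  also have "\<dots> \<le> 2 ^ k * (\<bar>a\<bar> ^ k + \<bar>b\<bar> ^ k)"
    by (intro mult_left_mono) (auto simp: max_def)
  finally show ?thesis .
qed

text \<open>A multinomial coefficient is at least 1. In this way the factorials contributed by the
  \<open>p\<close> motions are absorbed by the denominators of the exponential series.\<close>

lemma fact_power_le_fact_mult: "(fact k :: real) ^ p \<le> fact (p * k)"
proof (induction p)
  case (Suc p)
  have "(fact k :: nat) * fact (p * k) \<le> fact (k + p * k)"
    by (rule dvd_imp_le[OF fact_fact_dvd_fact]) simp
  then have "(fact k :: real) * fact (p * k) \<le> fact (k + p * k)"
    by (metis of_nat_fact of_nat_le_iff of_nat_mult)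
  with Suc show ?case
    by (smt (verit) fact_ge_zero mult_Suc mult_left_mono power_Suc)
qed simp

section \<open>The heat kernel\<close>

lemma nn_integral_lborel_shift:
  fixes f :: "'a::euclidean_space \<Rightarrow> ennreal"
  assumes [measurable]: "f \<in> borel_measurable borel"
  shows "(\<integral>\<^sup>+x. f (x + c) \<partial>lborel) = (\<integral>\<^sup>+x. f x \<partial>lborel)"
proof -
  have "(\<integral>\<^sup>+x. f x \<partial>lborel) = (\<integral>\<^sup>+x. f x \<partial>distr lborel borel ((+) c))"
    by (simp add: lborel_distr_plus)
  also have "\<dots> = (\<integral>\<^sup>+x. f (c + x) \<partial>lborel)"
    by (subst nn_integral_distr) auto
  finally show ?thesis by (simp add: add.commute)
qed

lemma nn_integral_lborel_diff:
  fixes f :: "'a::euclidean_space \<Rightarrow> ennreal"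
  assumes [measurable]: "f \<in> borel_measurable borel"
  shows "(\<integral>\<^sup>+x. f (x - c) \<partial>lborel) = (\<integral>\<^sup>+x. f x \<partial>lborel)"
  using nn_integral_lborel_shift[OF assms, of "- c"] by simp

lemma nn_integral_lborel_reflect:
  fixes f :: "'a::euclidean_space \<Rightarrow> ennreal"
  assumes [measurable]: "f \<in> borel_measurable borel"
  shows "(\<integral>\<^sup>+x. f (c - x) \<partial>lborel) = (\<integral>\<^sup>+x. f x \<partial>lborel)"
proof -
  have "(lborel :: 'a measure) = distr lborel borel (\<lambda>x. c + (- 1) *\<^sub>R x)"
    using lborel_affine[of "- 1" c] by (simp add: density_1)
  then have "(\<integral>\<^sup>+x. f x \<partial>lborel) = (\<integral>\<^sup>+x. f x \<partial>distr lborel borel (\<lambda>x. c + (- 1) *\<^sub>R x))"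
    by simp
  also have "\<dots> = (\<integral>\<^sup>+x. f (c - x) \<partial>lborel)"
    by (subst nn_integral_distr) auto
  finally show ?thesis ..
qed

lemma heat_kernel_nonneg [simp]: "0 \<le> heat_kernel r x"
  by (simp add: heat_kernel_def)

lemma borel_measurable_heat_kernel [measurable]:
  fixes x :: "'a \<Rightarrow> real ^ 'd"
  assumes [measurable]: "r \<in> borel_measurable M" "x \<in> borel_measurable M"
  shows "(\<lambda>w. heat_kernel (r w) (x w)) \<in> borel_measurable M"
  unfolding heat_kernel_def by measurable

lemma continuous_on_heat_kernel [continuous_intros]:
  fixes f :: "'a::topological_space \<Rightarrow> real ^ 'd"
  assumes "continuous_on S f" "r > 0"
  shows "continuous_on S (\<lambda>x. heat_kernel r (f x))"
  unfolding heat_kernel_def using assms by (intro continuous_intros) auto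

lemma heat_kernel_le:
  assumes "r > 0"
  shows "heat_kernel r (x :: real ^ 'd) \<le> (2 * pi * r) powr (- (real CARD('d) / 2))"
proof -
  have "exp (- (norm x)\<^sup>2 / (2 * r)) \<le> 1" using assms by simp
  then show ?thesis unfolding heat_kernel_def
    by (metis mult.right_neutral mult_left_mono powr_ge_zero)
qed

lemma heat_kernel_eq_prod:
  fixes x :: "real ^ 'd"
  assumes r: "r > 0"
  shows "heat_kernel r x = (\<Prod>b\<in>Basis. normal_density 0 (sqrt r) (x \<bullet> b))"
proof -
  have "(\<Prod>b\<in>Basis. normal_density 0 (sqrt r) (x \<bullet> b))
      = (\<Prod>b\<in>(Basis :: (real ^ 'd) set). 1 / sqrt (2 * pi * r)) * (\<Prod>b\<in>Basis. exp (- (x \<bullet> b)\<^sup>2 / (2 * r)))"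
    using r unfolding normal_density_def prod.distrib[symmetric] by (intro prod.cong) auto
  also have "(\<Prod>b\<in>Basis. exp (- (x \<bullet> b)\<^sup>2 / (2 * r))) = exp (\<Sum>b\<in>Basis. - (x \<bullet> b)\<^sup>2 / (2 * r))"
    by (simp add: exp_sum)
  also have "(\<Sum>b\<in>Basis. - (x \<bullet> b)\<^sup>2 / (2 * r)) = - (norm x)\<^sup>2 / (2 * r)"
  proof -
    have "(norm x)\<^sup>2 = (\<Sum>b\<in>Basis. (x \<bullet> b)\<^sup>2)"
      by (subst power2_norm_eq_inner, subst euclidean_inner) (simp add: power2_eq_square)
    then show ?thesis by (simp add: sum_negf sum_divide_distrib)
  qed
  also have "(\<Prod>b\<in>(Basis :: (real ^ 'd) set). 1 / sqrt (2 * pi * r)) = (1 / sqrt (2 * pi * r)) ^ CARD('d)"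
    by (simp add: prod_constant)
  also have "1 / sqrt (2 * pi * r) = (2 * pi * r) powr (- (1 / 2))"
    using r by (subst powr_minus_divide, subst powr_half_sqrt) auto
  also have "\<dots> ^ CARD('d) = (2 * pi * r) powr (- (real CARD('d) / 2))"
    using r by (subst powr_power) auto
  finally show ?thesis by (simp add: heat_kernel_def)
qed

lemma nn_integral_heat_kernel [simp]:
  assumes r: "r > 0"
  shows "(\<integral>\<^sup>+x. ennreal (heat_kernel r (x :: real ^ 'd)) \<partial>lborel) = 1"
proof -
  have "(\<integral>\<^sup>+x. ennreal (heat_kernel r (x :: real ^ 'd)) \<partial>lborel)
      = (\<integral>\<^sup>+x. (\<Prod>b\<in>Basis. ennreal (normal_density 0 (sqrt r) (x \<bullet> b))) \<partial>(lborel :: (real ^ 'd) measure))"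
    using r by (simp add: heat_kernel_eq_prod prod_ennreal)
  also have "\<dots> = (\<Prod>b\<in>(Basis :: (real ^ 'd) set). (\<integral>\<^sup>+x. ennreal (normal_density 0 (sqrt r) x) \<partial>lborel))"
    by (subst nn_integral_lborel_prod[symmetric]) auto
  also have "(\<integral>\<^sup>+x. ennreal (normal_density 0 (sqrt r) x) \<partial>lborel) = 1"
    using r by (subst nn_integral_eq_integral) auto
  finally show ?thesis by simp
qed

lemma nn_integral_heat_kernel_shift [simp]:
  fixes c :: "real ^ 'd"
  assumes "r > 0"
  shows "(\<integral>\<^sup>+x. ennreal (heat_kernel r (x - c)) \<partial>lborel) = 1"
    and "(\<integral>\<^sup>+x. ennreal (heat_kernel r (c - x)) \<partial>lborel) = 1"
    and "(\<integral>\<^sup>+x. ennreal (heat_kernel r (x + c)) \<partial>lborel) = 1"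
  using assms nn_integral_lborel_diff[of "\<lambda>x. ennreal (heat_kernel r x)" c]
    nn_integral_lborel_reflect[of "\<lambda>x. ennreal (heat_kernel r x)" c]
    nn_integral_lborel_shift[of "\<lambda>x. ennreal (heat_kernel r x)" c]
  by simp_all

lemma has_bochner_integral_heat_kernel:
  fixes c :: "real ^ 'd"
  assumes "r > 0"
  shows "has_bochner_integral lborel (\<lambda>x. heat_kernel r (x - c)) 1"
  using assms by (intro has_bochner_integral_nn_integral) auto

section \<open>Translation of Gaussian densities in total variation\<close>

text \<open>The parallelogram identity around the midpoint. The geometric mean of a Gaussian density
  and its translate is a Gaussian density in \<open>x\<close> times a factor depending on
  \<open>\<xi>\<close> only, so that the affinity can be integrated exactly.\<close>

lemma heat_kernel_mult_eq_square:
  fixes x \<xi> :: "real ^ 'd"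
  assumes r: "r > 0"
  shows "heat_kernel r (x + \<xi>) * heat_kernel r x
    = (heat_kernel r (x + (1 / 2) *\<^sub>R \<xi>) * exp (- (norm \<xi>)\<^sup>2 / (8 * r)))\<^sup>2"
proof -
  have e: "(norm (x + \<xi>))\<^sup>2 + (norm x)\<^sup>2 = 2 * (norm (x + (1 / 2) *\<^sub>R \<xi>))\<^sup>2 + (norm \<xi>)\<^sup>2 / 2"
    by (simp add: power2_norm_eq_inner inner_add_left inner_add_right inner_commute field_simps)
  have "exp (- (norm (x + \<xi>))\<^sup>2 / (2 * r)) * exp (- (norm x)\<^sup>2 / (2 * r))
      = exp (- ((norm (x + \<xi>))\<^sup>2 + (norm x)\<^sup>2) / (2 * r))"
    by (simp add: exp_add[symmetric] add_divide_distrib diff_divide_distrib)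
  also have "- ((norm (x + \<xi>))\<^sup>2 + (norm x)\<^sup>2) / (2 * r)
      = 2 * (- (norm (x + (1 / 2) *\<^sub>R \<xi>))\<^sup>2 / (2 * r) + - (norm \<xi>)\<^sup>2 / (8 * r))"
    unfolding e using r by (simp add: field_simps)
  also have "exp \<dots> = (exp (- (norm (x + (1 / 2) *\<^sub>R \<xi>))\<^sup>2 / (2 * r)) * exp (- (norm \<xi>)\<^sup>2 / (8 * r)))\<^sup>2"
    by (simp only: exp_double exp_add)
  finally show ?thesis
    unfolding heat_kernel_def by (simp add: power2_eq_square mult_ac)
qed

lemma nn_integral_heat_kernel_mult_exp:
  assumes e: "e > 0" and r: "r > 0"
  shows "(\<integral>\<^sup>+\<xi>. ennreal (heat_kernel e (\<xi> :: real ^ 'd) * exp (- (norm \<xi>)\<^sup>2 / (8 * r))) \<partial>lborel)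
    = ennreal ((1 + e / (4 * r)) powr (- (real CARD('d) / 2)))"
proof -
  \<comment> \<open>Inverse variances add under multiplication:
    \<open>1 / e' = 1 / e + 1 / (4 * r)\<close>.\<close>
  define e' where "e' = e / (1 + e / (4 * r))"
  have z: "0 < 1 + e / (4 * r)" using e r by (simp add: add_pos_pos)
  then have e': "e' > 0" using e by (simp add: e'_def)
  have "heat_kernel e \<xi> * exp (- (norm \<xi>)\<^sup>2 / (8 * r))
      = (1 + e / (4 * r)) powr (- (real CARD('d) / 2)) * heat_kernel e' \<xi>" for \<xi> :: "real ^ 'd"
  proof -
    have "exp (- (norm \<xi>)\<^sup>2 / (2 * e)) * exp (- (norm \<xi>)\<^sup>2 / (8 * r)) = exp (- (norm \<xi>)\<^sup>2 / (2 * e'))"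
      unfolding exp_add[symmetric] e'_def using e r z by (simp add: field_simps)
    moreover have "(2 * pi * e) = (1 + e / (4 * r)) * (2 * pi * e')"
      using z by (simp add: e'_def)
    then have "(2 * pi * e) powr (- (real CARD('d) / 2))
      = (1 + e / (4 * r)) powr (- (real CARD('d) / 2)) * (2 * pi * e') powr (- (real CARD('d) / 2))"
      using z e' by (simp only: powr_mult)
    ultimately show ?thesis by (simp add: heat_kernel_def)
  qed
  then have "(\<integral>\<^sup>+\<xi>. ennreal (heat_kernel e (\<xi> :: real ^ 'd) * exp (- (norm \<xi>)\<^sup>2 / (8 * r))) \<partial>lborel)
    = (\<integral>\<^sup>+\<xi>. ennreal ((1 + e / (4 * r)) powr (- (real CARD('d) / 2))) * ennreal (heat_kernel e' (\<xi> :: real ^ 'd)) \<partial>lborel)"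
    by (simp add: ennreal_mult)
  also have "\<dots> = ennreal ((1 + e / (4 * r)) powr (- (real CARD('d) / 2)))"
    using e' by (subst nn_integral_cmult) auto
  finally show ?thesis .
qed

text \<open>The total variation distance is controlled by the Hellinger affinity, which is explicit for
  Gaussians; the parameter \<open>c\<close> comes from the weighted arithmetic-geometric mean inequality.\<close>

lemma abs_diff_add_sqrt_le:
  fixes a b c :: real
  assumes "0 \<le> a" "0 \<le> b" "0 < c"
  shows "\<bar>a - b\<bar> + sqrt (a * b) / c \<le> (1 / (2 * c) + c) * (a + b)"
proof -
  define u v where "u = sqrt a" and "v = sqrt b"
  have uv: "a = u\<^sup>2" "b = v\<^sup>2" "sqrt (a * b) = u * v" "0 \<le> u" "0 \<le> v"
    using assms by (simp_all add: u_def v_def real_sqrt_mult)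
  have "\<bar>a - b\<bar> = \<bar>u - v\<bar> * (u + v)"
  proof -
    have "a - b = (u - v) * (u + v)" using uv by (simp add: power2_eq_square algebra_simps)
    then show ?thesis using uv by (simp add: abs_mult)
  qed
  moreover have "2 * c * (\<bar>u - v\<bar> * (u + v)) \<le> (u - v)\<^sup>2 + (c * (u + v))\<^sup>2"
  proof -
    have "2 * c * (\<bar>u - v\<bar> * (u + v)) = 2 * \<bar>u - v\<bar> * (c * (u + v))" by simp
    also have "\<dots> \<le> \<bar>u - v\<bar>\<^sup>2 + (c * (u + v))\<^sup>2" by (rule sum_squares_bound)
    finally show ?thesis by simp
  qed
  moreover have "(u + v)\<^sup>2 \<le> 2 * (u\<^sup>2 + v\<^sup>2)"
    using sum_squares_bound[of u v] by (simp add: power2_sum)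
  then have "(c * (u + v))\<^sup>2 \<le> c\<^sup>2 * (2 * (u\<^sup>2 + v\<^sup>2))"
    by (simp add: power_mult_distrib mult_left_mono)
  ultimately have "2 * c * \<bar>a - b\<bar> + 2 * (u * v) \<le> (a + b) + 2 * c\<^sup>2 * (a + b)"
    unfolding uv(1,2) by (simp add: power2_diff algebra_simps)
  then have "(2 * c * \<bar>a - b\<bar> + 2 * (u * v)) / (2 * c) \<le> ((a + b) + 2 * c\<^sup>2 * (a + b)) / (2 * c)"
    using assms by (intro divide_right_mono) auto
  then show ?thesis
    using assms uv by (simp add: field_simps power2_eq_square)
qed

text \<open>Mean \<open>L\<^sup>1\<close> distance between the Gaussian density of variance
  \<open>r\<close> and its translate by a random Gaussian vector of variance \<open>e\<close>. The
  dimension occurs only in the type, hence the argument of type \<open>itself\<close>.\<close>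

definition heat_shift :: "'d::finite itself \<Rightarrow> real \<Rightarrow> real \<Rightarrow> ennreal" where
  "heat_shift _ e r = (\<integral>\<^sup>+\<xi>. \<integral>\<^sup>+x. ennreal (heat_kernel e (\<xi> :: real ^ 'd) *
      \<bar>heat_kernel r (x + \<xi>) - heat_kernel r x\<bar>) \<partial>lborel \<partial>lborel)"

text \<open>Integrating \<open>abs_diff_add_sqrt_le\<close> gives
  \<open>(1 - \<rho>) / c + 2 * c\<close> with the affinity \<open>\<rho>\<close>. Since
  \<open>1 - \<rho>\<close> is at most \<open>min 1 x\<close>, hence at most \<open>sqrt x\<close>,
  the choice \<open>c = x powr (1/4)\<close> balances the two terms. An exponent 1/2 in the result
  would make the time singularity non-integrable when \<open>d * (p - 1) = 2 * p - 1\<close>, for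
  example for \<open>d = 3\<close> and \<open>p = 2\<close>.\<close>

lemma heat_shift_le:
  assumes e: "e > 0" and r: "r > 0"
  shows "heat_shift TYPE('d::finite) e r \<le> ennreal (3 * (real CARD('d) * e / (8 * r)) powr (1/4))"
proof -
  define x where "x = real CARD('d) * e / (8 * r)"
  have x: "x > 0" using e r by (simp add: x_def)
  define c where "c = x powr (1/4)"
  have c: "c > 0" using x by (simp add: c_def)
  define \<rho> where "\<rho> = (1 + e / (4 * r)) powr (- (real CARD('d) / 2))"
  let ?p = "heat_kernel r :: real ^ 'd \<Rightarrow> real"
  let ?q = "heat_kernel e :: real ^ 'd \<Rightarrow> real"
  have aff: "(\<integral>\<^sup>+\<xi>. \<integral>\<^sup>+x. ennreal (?q \<xi> * sqrt (?p (x + \<xi>) * ?p x)) \<partial>lborel \<partial>lborel) = ennreal \<rho>"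
  proof -
    have "(\<integral>\<^sup>+x. ennreal (?q \<xi> * sqrt (?p (x + \<xi>) * ?p x)) \<partial>lborel)
        = ennreal (?q \<xi> * exp (- (norm \<xi>)\<^sup>2 / (8 * r)))" for \<xi>
    proof -
      have "(\<integral>\<^sup>+x. ennreal (?q \<xi> * sqrt (?p (x + \<xi>) * ?p x)) \<partial>lborel)
        = (\<integral>\<^sup>+x. ennreal (?q \<xi> * exp (- (norm \<xi>)\<^sup>2 / (8 * r))) * ennreal (?p (x + (1 / 2) *\<^sub>R \<xi>)) \<partial>lborel)"
      proof (intro nn_integral_cong)
        fix x
        have "sqrt (?p (x + \<xi>) * ?p x) = ?p (x + (1 / 2) *\<^sub>R \<xi>) * exp (- (norm \<xi>)\<^sup>2 / (8 * r))"
          by (subst heat_kernel_mult_eq_square[OF r]) simp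
        then show "ennreal (?q \<xi> * sqrt (?p (x + \<xi>) * ?p x))
          = ennreal (?q \<xi> * exp (- (norm \<xi>)\<^sup>2 / (8 * r))) * ennreal (?p (x + (1 / 2) *\<^sub>R \<xi>))"
          by (simp add: ennreal_mult[symmetric] mult_ac)
      qed
      also have "\<dots> = ennreal (?q \<xi> * exp (- (norm \<xi>)\<^sup>2 / (8 * r)))"
        using r by (subst nn_integral_cmult) auto
      finally show ?thesis .
    qed
    then show ?thesis
      using nn_integral_heat_kernel_mult_exp[OF e r] by (simp add: \<rho>_def)
  qed
  have tot: "(\<integral>\<^sup>+\<xi>. \<integral>\<^sup>+x. ennreal (?q \<xi> * (?p (x + \<xi>) + ?p x)) \<partial>lborel \<partial>lborel) = 2"
  proof -
    have "(\<integral>\<^sup>+x. ennreal (?q \<xi> * (?p (x + \<xi>) + ?p x)) \<partial>lborel) = ennreal (?q \<xi>) * 2" for \<xi>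
    proof -
      have "(\<integral>\<^sup>+x. ennreal (?q \<xi> * (?p (x + \<xi>) + ?p x)) \<partial>lborel)
         = (\<integral>\<^sup>+x. ennreal (?q \<xi>) * (ennreal (?p (x + \<xi>)) + ennreal (?p x)) \<partial>lborel)"
        by (simp add: ennreal_mult[symmetric] ennreal_plus[symmetric] del: ennreal_plus)
      also have "\<dots> = ennreal (?q \<xi>) * 2"
        using r by (simp add: nn_integral_cmult nn_integral_add)
      finally show ?thesis .
    qed
    then show ?thesis using e by (simp add: nn_integral_multc)
  qed
  have "heat_shift TYPE('d) e r + ennreal (1 / c) * ennreal \<rho>
      = (\<integral>\<^sup>+\<xi>. \<integral>\<^sup>+x. ennreal (?q \<xi> * \<bar>?p (x + \<xi>) - ?p x\<bar>) + ennreal (1 / c) * ennreal (?q \<xi> * sqrt (?p (x + \<xi>) * ?p x)) \<partial>lborel \<partial>lborel)"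
    unfolding heat_shift_def aff[symmetric]
    by (simp add: nn_integral_cmult nn_integral_add)
  also have "\<dots> \<le> (\<integral>\<^sup>+\<xi>. \<integral>\<^sup>+x. ennreal (1 / (2 * c) + c) * ennreal (?q \<xi> * (?p (x + \<xi>) + ?p x)) \<partial>lborel \<partial>lborel)"
  proof (intro nn_integral_mono)
    fix \<xi> x :: "real ^ 'd"
    have "?q \<xi> * (\<bar>?p (x + \<xi>) - ?p x\<bar> + sqrt (?p (x + \<xi>) * ?p x) / c)
        \<le> ?q \<xi> * ((1 / (2 * c) + c) * (?p (x + \<xi>) + ?p x))"
      using c by (intro mult_left_mono abs_diff_add_sqrt_le) auto
    then show "ennreal (?q \<xi> * \<bar>?p (x + \<xi>) - ?p x\<bar>) + ennreal (1 / c) * ennreal (?q \<xi> * sqrt (?p (x + \<xi>) * ?p x))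
       \<le> ennreal (1 / (2 * c) + c) * ennreal (?q \<xi> * (?p (x + \<xi>) + ?p x))"
      using c by (simp add: ennreal_mult[symmetric] ennreal_plus[symmetric] algebra_simps del: ennreal_plus)
  qed
  also have "\<dots> = ennreal (1 / (2 * c) + c) * 2"
    using tot by (simp add: nn_integral_cmult)
  also have "\<dots> = ennreal (1 / c + 2 * c)"
    using c by (simp add: ennreal_mult'[symmetric] ennreal_numeral[symmetric] field_simps del: ennreal_numeral)
  finally have main: "heat_shift TYPE('d) e r + ennreal (\<rho> / c) \<le> ennreal (1 / c + 2 * c)"
    using c by (simp add: ennreal_mult'[symmetric])
  have \<rho>0: "0 \<le> \<rho>" by (simp add: \<rho>_def)
  have \<rho>1: "1 - \<rho> \<le> 1" using \<rho>0 by simp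
  have \<rho>2: "1 - \<rho> \<le> x"
  proof -
    define z where "z = e / (4 * r)"
    have z: "z > 0" using e r by (simp add: z_def)
    have "1 - x \<le> exp (- x)" using exp_ge_add_one_self[of "- x"] by simp
    also have "x = (real CARD('d) / 2) * z" by (simp add: x_def z_def)
    also have "exp (- (real CARD('d) / 2 * z)) \<le> exp (- (real CARD('d) / 2) * ln (1 + z))"
      using z ln_add_one_self_le_self[of z] by (simp add: mult_left_mono)
    also have "\<dots> = \<rho>" using z by (simp add: \<rho>_def powr_def z_def)
    finally show ?thesis by (simp add: x_def z_def)
  qed
  have "1 - \<rho> \<le> x powr (1/2)"
  proof (cases "x \<le> 1")
    case True
    then have "x powr 1 \<le> x powr (1/2)" using x by (intro powr_mono') auto
    with \<rho>2 x show ?thesis by simp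
  next
    case False
    then show ?thesis using \<rho>1 ge_one_powr_ge_zero[of x "1/2"] by simp
  qed
  also have "x powr (1/2) = c * c" by (simp add: c_def powr_add[symmetric])
  finally have "(1 - \<rho>) / c \<le> c" using c by (simp add: field_simps)
  then have "1 / c + 2 * c \<le> 3 * c + \<rho> / c" by (simp add: diff_divide_distrib)
  then have "ennreal (1 / c + 2 * c) \<le> ennreal (3 * c + \<rho> / c)" by (rule ennreal_leI)
  from order_trans[OF main this]
  have "heat_shift TYPE('d) e r + ennreal (\<rho> / c) \<le> ennreal (3 * c) + ennreal (\<rho> / c)"
    using c \<rho>0 by (simp add: ennreal_plus)
  then have "heat_shift TYPE('d) e r \<le> ennreal (3 * c)"
    using ennreal_add_left_cancel_le[of "ennreal (\<rho> / c)" "heat_shift TYPE('d) e r" "ennreal (3 * c)"]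
    by (simp only: add.commute[of _ "ennreal (\<rho> / c)"]) simp
  then show ?thesis
    unfolding c_def x_def .
qed

section \<open>Two consecutive time steps\<close>

text \<open>Averaging a difference \<open>q\<close> of two heat kernels against the first of two consecutive
  transition densities is what makes the moments small.\<close>

definition pair_kernel ::
    "(real ^ 'd \<Rightarrow> real) \<Rightarrow> real \<Rightarrow> real \<Rightarrow> real ^ 'd \<Rightarrow> real ^ 'd \<Rightarrow> real ^ 'd \<Rightarrow> real" where
  "pair_kernel q r r' x y v =
     (\<integral>u. heat_kernel r (u - x) * heat_kernel r' (v - u) * q (u - y) \<partial>lborel)"

lemma borel_measurable_pair_kernel [measurable]:
  fixes q :: "real ^ 'd \<Rightarrow> real"
  assumes [measurable]: "q \<in> borel_measurable borel"
    "r \<in> borel_measurable M" "r' \<in> borel_measurable M"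
    "x \<in> borel_measurable M" "y \<in> borel_measurable M" "v \<in> borel_measurable M"
  shows "(\<lambda>w. pair_kernel q (r w) (r' w) (x w) (y w) (v w)) \<in> borel_measurable M"
  unfolding pair_kernel_def by measurable

lemma heat_kernel_mult_le:
  assumes "r > 0" "r' > 0"
  shows "heat_kernel r (x :: real ^ 'd) * heat_kernel r' (y :: real ^ 'd)
    \<le> (2 * pi * r) powr (- (real CARD('d) / 2)) * (2 * pi * r') powr (- (real CARD('d) / 2))"
  using assms by (intro mult_mono heat_kernel_le) auto

lemma ennreal_abs_integral_le:
  fixes f :: "'a \<Rightarrow> real"
  assumes "f \<in> borel_measurable M"
  shows "ennreal \<bar>integral\<^sup>L M f\<bar> \<le> (\<integral>\<^sup>+x. ennreal \<bar>f x\<bar> \<partial>M)"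
proof (cases "integrable M f")
  case True
  then show ?thesis using integral_norm_bound_ennreal[OF True] by simp
qed (simp add: not_integrable_integral_eq)

text \<open>The transition densities are bounded by their suprema and \<open>q\<close> by its mass.
  As the supremum of \<open>q\<close> does not occur, the bound survives the removal of the
  smoothing.\<close>

lemma abs_pair_kernel_le:
  fixes q :: "real ^ 'd \<Rightarrow> real"
  assumes r: "r > 0" "r' > 0" and [measurable]: "q \<in> borel_measurable borel"
    and q: "(\<integral>\<^sup>+x. ennreal \<bar>q x\<bar> \<partial>lborel) \<le> 2"
  shows "\<bar>pair_kernel q r r' x y v\<bar>
    \<le> 2 * ((2 * pi * r) powr (- (real CARD('d) / 2)) * (2 * pi * r') powr (- (real CARD('d) / 2)))"
    (is "_ \<le> 2 * ?M")
proof -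
  have "ennreal \<bar>pair_kernel q r r' x y v\<bar>
      \<le> (\<integral>\<^sup>+u. ennreal \<bar>heat_kernel r (u - x) * heat_kernel r' (v - u) * q (u - y)\<bar> \<partial>lborel)"
    unfolding pair_kernel_def by (rule ennreal_abs_integral_le) measurable
  also have "\<dots> \<le> (\<integral>\<^sup>+u. ennreal ?M * ennreal \<bar>q (u - y)\<bar> \<partial>lborel)"
    using heat_kernel_mult_le[OF r]
    by (intro nn_integral_mono) (auto simp: abs_mult ennreal_mult[symmetric] intro!: ennreal_leI mult_right_mono)
  also have "\<dots> = ennreal ?M * (\<integral>\<^sup>+x. ennreal \<bar>q x\<bar> \<partial>lborel)"
    using nn_integral_lborel_diff[of "\<lambda>x. ennreal \<bar>q x\<bar>" y] by (simp add: nn_integral_cmult)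
  also have "\<dots> \<le> ennreal ?M * 2"
    by (intro mult_left_mono q) auto
  also have "\<dots> = ennreal (2 * ?M)"
    by (simp add: ennreal_mult' ennreal_numeral[symmetric] mult.commute del: ennreal_numeral)
  finally show ?thesis
    by (subst (asm) ennreal_le_iff) auto
qed

text \<open>Interpolation: \<open>p - 1\<close> factors are bounded by the supremum and one is left
  to the \<open>L\<^sup>1\<close> norm. The former produces the time singularity, the latter the
  smallness.\<close>

lemma nn_integral_pair_kernel_power_le:
  fixes q :: "real ^ 'd \<Rightarrow> real"
  assumes r: "r > 0" "r' > 0" and [measurable]: "q \<in> borel_measurable borel"
    and q: "(\<integral>\<^sup>+x. ennreal \<bar>q x\<bar> \<partial>lborel) \<le> 2" and p: "p \<ge> 1"
  shows "(\<integral>\<^sup>+y. \<integral>\<^sup>+v. ennreal (\<bar>pair_kernel q r r' x y v\<bar> ^ p) \<partial>lborel \<partial>lborel)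
    \<le> ennreal ((2 * ((2 * pi * r) powr (- (real CARD('d) / 2)) * (2 * pi * r') powr (- (real CARD('d) / 2)))) ^ (p - 1))
       * (\<integral>\<^sup>+y. \<integral>\<^sup>+v. ennreal \<bar>pair_kernel q r r' x y v\<bar> \<partial>lborel \<partial>lborel)"
    (is "_ \<le> ennreal (?M ^ (p - 1)) * _")
proof -
  have "(\<integral>\<^sup>+y. \<integral>\<^sup>+v. ennreal (\<bar>pair_kernel q r r' x y v\<bar> ^ p) \<partial>lborel \<partial>lborel)
      \<le> (\<integral>\<^sup>+y. \<integral>\<^sup>+v. ennreal (?M ^ (p - 1)) * ennreal \<bar>pair_kernel q r r' x y v\<bar> \<partial>lborel \<partial>lborel)"
  proof (intro nn_integral_mono)
    fix y v :: "real ^ 'd"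
    have "\<bar>pair_kernel q r r' x y v\<bar> ^ p = \<bar>pair_kernel q r r' x y v\<bar> ^ (p - 1) * \<bar>pair_kernel q r r' x y v\<bar>"
      using p by (cases p) auto
    also have "\<dots> \<le> ?M ^ (p - 1) * \<bar>pair_kernel q r r' x y v\<bar>"
      using abs_pair_kernel_le[OF r _ q] by (intro mult_right_mono power_mono) auto
    finally show "ennreal (\<bar>pair_kernel q r r' x y v\<bar> ^ p) \<le> ennreal (?M ^ (p - 1)) * ennreal \<bar>pair_kernel q r r' x y v\<bar>"
      by (simp add: ennreal_mult[symmetric] ennreal_leI)
  qed
  also have "\<dots> = ennreal (?M ^ (p - 1)) * (\<integral>\<^sup>+y. \<integral>\<^sup>+v. ennreal \<bar>pair_kernel q r r' x y v\<bar> \<partial>lborel \<partial>lborel)"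
    by (simp add: nn_integral_cmult)
  finally show ?thesis .
qed

text \<open>Integrating over \<open>v\<close> and then over \<open>y\<close> removes the second
  density and leaves the mass of \<open>q\<close>; the first density then integrates to 1.\<close>

lemma nn_integral_abs_pair_kernel_le:
  fixes q :: "real ^ 'd \<Rightarrow> real"
  assumes r: "r > 0" "r' > 0" and [measurable]: "q \<in> borel_measurable borel"
  shows "(\<integral>\<^sup>+y. \<integral>\<^sup>+v. ennreal \<bar>pair_kernel q r r' x y v\<bar> \<partial>lborel \<partial>lborel) \<le> (\<integral>\<^sup>+x. ennreal \<bar>q x\<bar> \<partial>lborel)"
proof -
  have "(\<integral>\<^sup>+y. \<integral>\<^sup>+v. ennreal \<bar>pair_kernel q r r' x y v\<bar> \<partial>lborel \<partial>lborel)
    \<le> (\<integral>\<^sup>+y. \<integral>\<^sup>+v. \<integral>\<^sup>+u. ennreal (heat_kernel r (u - x)) * (ennreal (heat_kernel r' (v - u)) * ennreal \<bar>q (u - y)\<bar>) \<partial>lborel \<partial>lborel \<partial>lborel)"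
    unfolding pair_kernel_def
    by (intro nn_integral_mono order_trans[OF ennreal_abs_integral_le])
      (auto simp: abs_mult ennreal_mult[symmetric] mult.assoc)
  also have "\<dots> = (\<integral>\<^sup>+y. \<integral>\<^sup>+u. \<integral>\<^sup>+v. ennreal (heat_kernel r (u - x)) * (ennreal (heat_kernel r' (v - u)) * ennreal \<bar>q (u - y)\<bar>) \<partial>lborel \<partial>lborel \<partial>lborel)"
    by (intro nn_integral_cong lborel_pair.Fubini') simp
  also have "\<dots> = (\<integral>\<^sup>+y. \<integral>\<^sup>+u. ennreal (heat_kernel r (u - x)) * ennreal \<bar>q (u - y)\<bar> \<partial>lborel \<partial>lborel)"
    using r by (simp add: nn_integral_cmult nn_integral_multc)
  also have "\<dots> = (\<integral>\<^sup>+u. \<integral>\<^sup>+y. ennreal (heat_kernel r (u - x)) * ennreal \<bar>q (u - y)\<bar> \<partial>lborel \<partial>lborel)"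
    by (intro lborel_pair.Fubini') simp
  also have "\<dots> = (\<integral>\<^sup>+x. ennreal \<bar>q x\<bar> \<partial>lborel)"
    using r nn_integral_lborel_reflect[of "\<lambda>x. ennreal \<bar>q x\<bar>"]
    by (simp add: nn_integral_cmult nn_integral_multc)
  finally show ?thesis .
qed

text \<open>The splitting \<open>a * b - a' * b' = (a - a') * b + a' * (b - b')\<close>. In each
  summand the density that is not differenced integrates to 1, which leaves one translation error
  for \<open>r\<close> and one for \<open>r'\<close>.\<close>

lemma nn_integral_heat_kernel_mult_diff_le:
  fixes x :: "real ^ 'd"
  assumes r: "r > 0" "r' > 0" and e: "e > 0"
  shows "(\<integral>\<^sup>+y. \<integral>\<^sup>+v. \<integral>\<^sup>+\<xi>. ennreal (heat_kernel e \<xi> *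
      \<bar>heat_kernel r (\<xi> + y - x) * heat_kernel r' (v - (\<xi> + y)) - heat_kernel r (y - x) * heat_kernel r' (v - y)\<bar>)
      \<partial>lborel \<partial>lborel \<partial>lborel) \<le> heat_shift TYPE('d) e r + heat_shift TYPE('d) e r'"
proof -
  let ?p = "heat_kernel r :: real ^ 'd \<Rightarrow> real" and ?p' = "heat_kernel r' :: real ^ 'd \<Rightarrow> real"
  let ?q = "heat_kernel e :: real ^ 'd \<Rightarrow> real"
  let ?F = "\<lambda>\<xi> y v. ennreal (?q \<xi> * \<bar>?p (\<xi> + y - x) - ?p (y - x)\<bar>) * ennreal (?p' (v - (\<xi> + y)))"
  let ?G = "\<lambda>\<xi> y v. ennreal (?p (y - x)) * ennreal (?q \<xi> * \<bar>?p' (v - (\<xi> + y)) - ?p' (v - y)\<bar>)"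
  have "(\<integral>\<^sup>+y. \<integral>\<^sup>+v. \<integral>\<^sup>+\<xi>. ennreal (?q \<xi> *
      \<bar>?p (\<xi> + y - x) * ?p' (v - (\<xi> + y)) - ?p (y - x) * ?p' (v - y)\<bar>) \<partial>lborel \<partial>lborel \<partial>lborel)
    \<le> (\<integral>\<^sup>+y. \<integral>\<^sup>+v. \<integral>\<^sup>+\<xi>. ?F \<xi> y v + ?G \<xi> y v \<partial>lborel \<partial>lborel \<partial>lborel)"
  proof (intro nn_integral_mono)
    fix y v \<xi> :: "real ^ 'd"
    have eq: "?p (\<xi> + y - x) * ?p' (v - (\<xi> + y)) - ?p (y - x) * ?p' (v - y)
      = (?p (\<xi> + y - x) - ?p (y - x)) * ?p' (v - (\<xi> + y)) + ?p (y - x) * (?p' (v - (\<xi> + y)) - ?p' (v - y))"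
      by (simp add: algebra_simps)
    have "\<bar>?p (\<xi> + y - x) * ?p' (v - (\<xi> + y)) - ?p (y - x) * ?p' (v - y)\<bar>
       \<le> \<bar>?p (\<xi> + y - x) - ?p (y - x)\<bar> * ?p' (v - (\<xi> + y)) + ?p (y - x) * \<bar>?p' (v - (\<xi> + y)) - ?p' (v - y)\<bar>"
      unfolding eq by (rule order_trans[OF abs_triangle_ineq]) (simp add: abs_mult)
    then have "?q \<xi> * \<bar>?p (\<xi> + y - x) * ?p' (v - (\<xi> + y)) - ?p (y - x) * ?p' (v - y)\<bar>
       \<le> ?q \<xi> * (\<bar>?p (\<xi> + y - x) - ?p (y - x)\<bar> * ?p' (v - (\<xi> + y)) + ?p (y - x) * \<bar>?p' (v - (\<xi> + y)) - ?p' (v - y)\<bar>)"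
      by (rule mult_left_mono) simp
    then show "ennreal (?q \<xi> * \<bar>?p (\<xi> + y - x) * ?p' (v - (\<xi> + y)) - ?p (y - x) * ?p' (v - y)\<bar>)
       \<le> ?F \<xi> y v + ?G \<xi> y v"
      by (simp add: ennreal_mult[symmetric] ennreal_plus[symmetric] distrib_left mult_ac ennreal_leI del: ennreal_plus)
  qed
  also have "\<dots> = (\<integral>\<^sup>+y. \<integral>\<^sup>+v. \<integral>\<^sup>+\<xi>. ?F \<xi> y v \<partial>lborel \<partial>lborel \<partial>lborel) + (\<integral>\<^sup>+y. \<integral>\<^sup>+v. \<integral>\<^sup>+\<xi>. ?G \<xi> y v \<partial>lborel \<partial>lborel \<partial>lborel)"
    by (simp add: nn_integral_add)
  also have "(\<integral>\<^sup>+y. \<integral>\<^sup>+v. \<integral>\<^sup>+\<xi>. ?F \<xi> y v \<partial>lborel \<partial>lborel \<partial>lborel) = heat_shift TYPE('d) e r"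
  proof -
    have "(\<integral>\<^sup>+y. \<integral>\<^sup>+v. \<integral>\<^sup>+\<xi>. ?F \<xi> y v \<partial>lborel \<partial>lborel \<partial>lborel) = (\<integral>\<^sup>+y. \<integral>\<^sup>+\<xi>. \<integral>\<^sup>+v. ?F \<xi> y v \<partial>lborel \<partial>lborel \<partial>lborel)"
      by (intro nn_integral_cong lborel_pair.Fubini') simp
    also have "\<dots> = (\<integral>\<^sup>+y. \<integral>\<^sup>+\<xi>. ennreal (?q \<xi> * \<bar>?p (\<xi> + y - x) - ?p (y - x)\<bar>) \<partial>lborel \<partial>lborel)"
      using r by (simp add: nn_integral_cmult)
    also have "\<dots> = (\<integral>\<^sup>+\<xi>. \<integral>\<^sup>+y. ennreal (?q \<xi> * \<bar>?p (\<xi> + y - x) - ?p (y - x)\<bar>) \<partial>lborel \<partial>lborel)"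
      by (intro lborel_pair.Fubini') simp
    also have "\<dots> = heat_shift TYPE('d) e r"
      unfolding heat_shift_def
    proof (rule nn_integral_cong)
      fix \<xi> :: "real ^ 'd"
      show "(\<integral>\<^sup>+y. ennreal (?q \<xi> * \<bar>?p (\<xi> + y - x) - ?p (y - x)\<bar>) \<partial>lborel)
          = (\<integral>\<^sup>+y. ennreal (?q \<xi> * \<bar>?p (y + \<xi>) - ?p y\<bar>) \<partial>lborel)"
        using nn_integral_lborel_diff[of "\<lambda>y. ennreal (?q \<xi> * \<bar>?p (y + \<xi>) - ?p y\<bar>)" x]
        by (simp add: algebra_simps)
    qed
    finally show ?thesis .
  qed
  also have "(\<integral>\<^sup>+y. \<integral>\<^sup>+v. \<integral>\<^sup>+\<xi>. ?G \<xi> y v \<partial>lborel \<partial>lborel \<partial>lborel) = heat_shift TYPE('d) e r'"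
  proof -
    have "(\<integral>\<^sup>+v. \<integral>\<^sup>+\<xi>. ?G \<xi> y v \<partial>lborel \<partial>lborel) = ennreal (?p (y - x)) * heat_shift TYPE('d) e r'" for y
    proof -
      have "(\<integral>\<^sup>+v. \<integral>\<^sup>+\<xi>. ?G \<xi> y v \<partial>lborel \<partial>lborel)
        = ennreal (?p (y - x)) * (\<integral>\<^sup>+v. \<integral>\<^sup>+\<xi>. ennreal (?q \<xi> * \<bar>?p' (v - (\<xi> + y)) - ?p' (v - y)\<bar>) \<partial>lborel \<partial>lborel)"
        by (simp add: nn_integral_cmult)
      also have "(\<integral>\<^sup>+v. \<integral>\<^sup>+\<xi>. ennreal (?q \<xi> * \<bar>?p' (v - (\<xi> + y)) - ?p' (v - y)\<bar>) \<partial>lborel \<partial>lborel)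
        = (\<integral>\<^sup>+\<xi>. \<integral>\<^sup>+v. ennreal (?q \<xi> * \<bar>?p' (v - (\<xi> + y)) - ?p' (v - y)\<bar>) \<partial>lborel \<partial>lborel)"
        by (intro lborel_pair.Fubini') simp
      also have "\<dots> = heat_shift TYPE('d) e r'"
        unfolding heat_shift_def
      proof (rule nn_integral_cong)
        fix \<xi> :: "real ^ 'd"
        show "(\<integral>\<^sup>+v. ennreal (?q \<xi> * \<bar>?p' (v - (\<xi> + y)) - ?p' (v - y)\<bar>) \<partial>lborel)
            = (\<integral>\<^sup>+v. ennreal (?q \<xi> * \<bar>?p' (v + \<xi>) - ?p' v\<bar>) \<partial>lborel)"
          using nn_integral_lborel_diff[of "\<lambda>v. ennreal (?q \<xi> * \<bar>?p' (v + \<xi>) - ?p' v\<bar>)" "\<xi> + y"]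
          by (simp add: algebra_simps abs_minus_commute)
      qed
      finally show ?thesis .
    qed
    then show ?thesis using r by (simp add: nn_integral_multc)
  qed
  finally show ?thesis .
qed

text \<open>The difference of the kernels has integral 0, so the product of densities at
  \<open>u = y\<close> may be subtracted. Only then is the difference bounded by the sum of the two
  kernels, and each of them shifts the densities by a centred Gaussian vector.\<close>

lemma nn_integral_abs_pair_kernel_diff_le:
  fixes x :: "real ^ 'd"
  assumes r: "r > 0" "r' > 0" and e: "e > 0" "e' > 0"
  shows "(\<integral>\<^sup>+y. \<integral>\<^sup>+v. ennreal \<bar>pair_kernel (\<lambda>z. heat_kernel e' z - heat_kernel e z) r r' x y v\<bar> \<partial>lborel \<partial>lborel)
    \<le> (heat_shift TYPE('d) e' r + heat_shift TYPE('d) e' r') + (heat_shift TYPE('d) e r + heat_shift TYPE('d) e r')"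
proof -
  let ?h = "\<lambda>v u. heat_kernel r (u - x) * heat_kernel r' (v - u)"
  let ?q = "\<lambda>z. heat_kernel e' z - heat_kernel e (z :: real ^ 'd)"
  let ?D = "\<lambda>e y v \<xi>. ennreal (heat_kernel e \<xi> * \<bar>heat_kernel r (\<xi> + y - x) * heat_kernel r' (v - (\<xi> + y))
      - heat_kernel r (y - x) * heat_kernel r' (v - y)\<bar>)"
  have pt: "ennreal \<bar>pair_kernel ?q r r' x y v\<bar> \<le> (\<integral>\<^sup>+\<xi>. ?D e' y v \<xi> \<partial>lborel) + (\<integral>\<^sup>+\<xi>. ?D e y v \<xi> \<partial>lborel)" for y v
  proof -
    have int: "integrable lborel (\<lambda>u. ?q (u - y))"
      using has_bochner_integral_heat_kernel[OF e(1), of y] has_bochner_integral_heat_kernel[OF e(2), of y]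
      by (auto simp: has_bochner_integral_iff)
    have z: "(\<integral>u. ?q (u - y) \<partial>lborel) = 0"
      using has_bochner_integral_heat_kernel[OF e(1), of y] has_bochner_integral_heat_kernel[OF e(2), of y]
      by (simp add: has_bochner_integral_iff)
    have int2: "integrable lborel (\<lambda>u. ?h v u * ?q (u - y))"
    proof (rule Bochner_Integration.integrable_bound)
      show "integrable lborel (\<lambda>u. ((2 * pi * r) powr (- (real CARD('d) / 2)) * (2 * pi * r') powr (- (real CARD('d) / 2))) * ?q (u - y))"
        using int by simp
      show "AE u in lborel. norm (?h v u * ?q (u - y)) \<le> norm (((2 * pi * r) powr (- (real CARD('d) / 2)) * (2 * pi * r') powr (- (real CARD('d) / 2))) * ?q (u - y))"
        using heat_kernel_mult_le[OF r] by (intro AE_I2) (auto simp: abs_mult intro!: mult_right_mono)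
    qed measurable
    have "pair_kernel ?q r r' x y v = (\<integral>u. ?h v u * ?q (u - y) \<partial>lborel) - (\<integral>u. ?h v y * ?q (u - y) \<partial>lborel)"
      using z by (simp add: pair_kernel_def)
    also have "\<dots> = (\<integral>u. (?h v u - ?h v y) * ?q (u - y) \<partial>lborel)"
      using int int2 by (subst Bochner_Integration.integral_diff[symmetric]) (auto simp: left_diff_distrib)
    finally have "ennreal \<bar>pair_kernel ?q r r' x y v\<bar> \<le> (\<integral>\<^sup>+u. ennreal \<bar>(?h v u - ?h v y) * ?q (u - y)\<bar> \<partial>lborel)"
      using ennreal_abs_integral_le[of "\<lambda>u. (?h v u - ?h v y) * ?q (u - y)" lborel] by simp
    also have "\<dots> = (\<integral>\<^sup>+u. ennreal \<bar>(?h v (u + y) - ?h v y) * ?q u\<bar> \<partial>lborel)"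
      using nn_integral_lborel_diff[of "\<lambda>u. ennreal \<bar>(?h v (u + y) - ?h v y) * ?q u\<bar>" y] by simp
    also have "\<dots> \<le> (\<integral>\<^sup>+\<xi>. ?D e' y v \<xi> + ?D e y v \<xi> \<partial>lborel)"
    proof (intro nn_integral_mono)
      fix u
      have "\<bar>?q u\<bar> \<le> heat_kernel e' u + heat_kernel e u"
        using heat_kernel_nonneg[of e u] heat_kernel_nonneg[of e' u] by linarith
      then have "\<bar>?h v (u + y) - ?h v y\<bar> * \<bar>?q u\<bar> \<le> \<bar>?h v (u + y) - ?h v y\<bar> * (heat_kernel e' u + heat_kernel e u)"
        by (rule mult_left_mono) simp
      then show "ennreal \<bar>(?h v (u + y) - ?h v y) * ?q u\<bar> \<le> ?D e' y v u + ?D e y v u"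
        unfolding abs_mult
        by (simp add: ennreal_plus[symmetric] distrib_left distrib_right mult_ac ennreal_leI del: ennreal_plus)
    qed
    also have "\<dots> = (\<integral>\<^sup>+\<xi>. ?D e' y v \<xi> \<partial>lborel) + (\<integral>\<^sup>+\<xi>. ?D e y v \<xi> \<partial>lborel)"
      by (rule nn_integral_add) auto
    finally show ?thesis .
  qed
  have "(\<integral>\<^sup>+y. \<integral>\<^sup>+v. ennreal \<bar>pair_kernel ?q r r' x y v\<bar> \<partial>lborel \<partial>lborel)
      \<le> (\<integral>\<^sup>+y. \<integral>\<^sup>+v. (\<integral>\<^sup>+\<xi>. ?D e' y v \<xi> \<partial>lborel) + (\<integral>\<^sup>+\<xi>. ?D e y v \<xi> \<partial>lborel) \<partial>lborel \<partial>lborel)"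
    by (intro nn_integral_mono pt)
  also have "\<dots> = (\<integral>\<^sup>+y. \<integral>\<^sup>+v. \<integral>\<^sup>+\<xi>. ?D e' y v \<xi> \<partial>lborel \<partial>lborel \<partial>lborel) + (\<integral>\<^sup>+y. \<integral>\<^sup>+v. \<integral>\<^sup>+\<xi>. ?D e y v \<xi> \<partial>lborel \<partial>lborel \<partial>lborel)"
    by (simp add: nn_integral_add)
  also have "\<dots> \<le> (heat_shift TYPE('d) e' r + heat_shift TYPE('d) e' r') + (heat_shift TYPE('d) e r + heat_shift TYPE('d) e r')"
    using r e by (intro add_mono nn_integral_heat_kernel_mult_diff_le) auto
  finally show ?thesis .
qed

text \<open>The \<open>p\<close>-th power of the weight dominates the \<open>L\<^sup>p\<close> norm of the pair kernel; the factor
  \<open>1 + r powr (-1/4)\<close> pays for the continuity modulus of the heat kernel.\<close>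

definition time_weight :: "nat \<Rightarrow> nat \<Rightarrow> real \<Rightarrow> real" where
  "time_weight d p r =
     ((2 * pi * r) powr (- (real d * real (p - 1) / 2)) * (1 + r powr (- (1/4)))) powr (1 / real p)"

lemma borel_measurable_time_weight [measurable]: "time_weight d p \<in> borel_measurable borel"
  unfolding time_weight_def by measurable

lemma time_weight_pos: "r > 0 \<Longrightarrow> 0 < time_weight d p r"
proof -
  assume r: "r > 0"
  have "0 < 1 + r powr (- (1/4))" by (simp add: add_pos_nonneg)
  with r show "0 < time_weight d p r"
    unfolding time_weight_def by (subst powr_gt_zero) (simp add: less_imp_neq[symmetric])
qed

lemma time_weight_nonneg: "0 \<le> time_weight d p r"
  unfolding time_weight_def by simp

lemma time_weight_power:
  assumes "r > 0" "p \<ge> 1"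
  shows "time_weight d p r ^ p = (2 * pi * r) powr (- (real d * real (p - 1) / 2)) * (1 + r powr (- (1/4)))"
proof -
  have "0 < (2 * pi * r) powr (- (real d * real (p - 1) / 2)) * (1 + r powr (- (1/4)))"
    using assms by (intro mult_pos_pos add_pos_nonneg) auto
  then show ?thesis
    unfolding time_weight_def using assms by (subst powr_power) (auto simp: less_le)
qed

section \<open>Integrability of the time weight\<close>

lemma powr_powr_neg_le_one: "1 \<le> x \<Longrightarrow> 0 \<le> a \<Longrightarrow> x powr (- a) \<le> (1::real)"
  by (simp add: powr_minus_divide ge_one_powr_ge_zero)

text \<open>Compared after taking \<open>p\<close>-th powers. For \<open>r \<le> 1\<close> the
  factor \<open>1 + r powr (-1/4)\<close> is at most twice its second summand; for larger
  \<open>r\<close> both powers of \<open>r\<close> are at most 1. The powers of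
  \<open>2 * pi\<close> only help.\<close>

lemma time_weight_le:
  assumes r: "r > 0" and p: "p \<ge> 1"
  shows "time_weight d p r \<le> 2 * (if r \<le> 1 then r powr (- (real d * real (p - 1) / (2 * real p) + 1 / (4 * real p))) else 1)"
proof (rule power_le_imp_le_base)
  let ?A = "real d * real (p - 1) / 2"
  have A: "0 \<le> ?A" by simp
  have two: "(2::real) \<le> 2 ^ p" using p self_le_power[of "2::real" p] by simp
  have piA: "(2 * pi) powr (- ?A) \<le> 1"
    using A pi_gt3 by (intro powr_powr_neg_le_one) auto
  have "time_weight d p r ^ p = (2 * pi) powr (- ?A) * (r powr (- ?A) * (1 + r powr (- (1/4))))"
    using r p by (simp add: time_weight_power powr_mult)
  also have "\<dots> \<le> 1 * (r powr (- ?A) * (1 + r powr (- (1/4))))"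
    using piA by (intro mult_right_mono) auto
  finally have 1: "time_weight d p r ^ p \<le> r powr (- ?A) * (1 + r powr (- (1/4)))" by simp
  show "time_weight d p r ^ Suc (p - 1)
     \<le> (2 * (if r \<le> 1 then r powr (- (real d * real (p - 1) / (2 * real p) + 1 / (4 * real p))) else 1)) ^ Suc (p - 1)"
  proof (cases "r \<le> 1")
    case True
    have "1 powr (- (1/4)) \<le> r powr (- (1/4))"
      using r True by (intro powr_mono2') auto
    then have "r powr (- ?A) * (1 + r powr (- (1/4))) \<le> r powr (- ?A) * (2 * r powr (- (1/4)))"
      by (intro mult_left_mono) auto
    also have "\<dots> = 2 * r powr (- ?A - 1/4)"
      by (simp add: powr_add[symmetric])
    also have "r powr (- ?A - 1/4) = (r powr (- (real d * real (p - 1) / (2 * real p) + 1 / (4 * real p)))) ^ p"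
    proof -
      have "real p * - (real d * D / (2 * real p) + 1 / (4 * real p)) = - (real d * D / 2) - 1 / 4" for D
        using p by (simp add: field_simps)
      then show ?thesis using r by (subst powr_power) (simp_all only: less_imp_neq[symmetric] simp_thms not_False_eq_True)
    qed
    also have "2 * \<dots> \<le> 2 ^ p * (r powr (- (real d * real (p - 1) / (2 * real p) + 1 / (4 * real p)))) ^ p"
      using two by (intro mult_right_mono) auto
    finally show ?thesis
      using 1 True p by (simp add: power_mult_distrib)
  next
    case False
    have "r powr (- ?A) * (1 + r powr (- (1/4))) \<le> 1 * (1 + 1)"
      using False A by (intro mult_mono add_mono powr_powr_neg_le_one) auto
    then show ?thesis using 1 two False p by simp
  qed
qed auto

text \<open>The singularity at 0 has exponent \<open>g < 1\<close>, which is where the dimension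
  condition enters, and the exponential takes care of large times.\<close>

lemma nn_integral_exp_time_weight_finite:
  assumes p: "p \<ge> 1" and dp: "d * (p - 1) < 2 * p" and lam: "lam > 0"
  shows "(\<integral>\<^sup>+r. ennreal (exp (- lam * r) * time_weight d p r) * indicator {0<..} r \<partial>lborel) < \<infinity>"
proof -
  define g where "g = real d * real (p - 1) / (2 * real p) + 1 / (4 * real p)"
  have "real d * real (p - 1) = real (d * (p - 1))" by simp
  \<comment> \<open>For integers the strict inequality has a gap of 1, so the first part of
    \<open>g\<close> stays \<open>1 / (2 * p)\<close> below 1; the modulus of continuity spends
    \<open>1 / (4 * p)\<close> of it.\<close>
  also have "\<dots> \<le> real (2 * p - 1)" using dp by (intro of_nat_mono) auto
  finally have "real d * real (p - 1) \<le> 2 * real p - 1" using p by simp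
  then have "g \<le> (2 * real p - 1) / (2 * real p) + 1 / (4 * real p)"
    unfolding g_def using p by (intro add_right_mono divide_right_mono) auto
  also have "\<dots> < 1" using p by (simp add: field_simps)
  finally have g: "g < 1" .
  have "(\<integral>\<^sup>+r. ennreal (exp (- lam * r) * time_weight d p r) * indicator {0<..} r \<partial>lborel)
      \<le> (\<integral>\<^sup>+r. 2 * (ennreal (r powr (- g)) * indicator {0..1} r) + 2 * (ennreal (exp (- lam * r)) * indicator {0..} r) \<partial>lborel)"
  proof (intro nn_integral_mono)
    fix r :: real
    show "ennreal (exp (- lam * r) * time_weight d p r) * indicator {0<..} r
      \<le> 2 * (ennreal (r powr (- g)) * indicator {0..1} r) + 2 * (ennreal (exp (- lam * r)) * indicator {0..} r)"
    proof (cases "r > 0")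
      case r: True
      note tw = time_weight_le[OF r p, of d, folded g_def]
      show ?thesis
      proof (cases "r \<le> 1")
        case True
        have "exp (- lam * r) * time_weight d p r \<le> 1 * (2 * r powr (- g))"
          using tw True r lam by (intro mult_mono) (auto simp: time_weight_nonneg)
        then have "ennreal (exp (- lam * r) * time_weight d p r) \<le> ennreal (2 * r powr (- g))"
          by (intro ennreal_leI) simp
        then show ?thesis using True r
          by (simp add: ennreal_mult' add_increasing2)
      next
        case False
        have "exp (- lam * r) * time_weight d p r \<le> exp (- lam * r) * 2"
          using tw False by (intro mult_left_mono) auto
        then have "ennreal (exp (- lam * r) * time_weight d p r) \<le> ennreal (2 * exp (- lam * r))"
          by (intro ennreal_leI) simp
        then show ?thesis using False r by (simp add: ennreal_mult')
      qed
    qed simp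
  qed
  also have "\<dots> = 2 * ennreal (1 powr (- g + 1) / (- g + 1)) + 2 * ennreal (exp (- lam * 0) / lam)"
  proof -
    have 1: "(\<integral>\<^sup>+r. ennreal (r powr (- g)) * indicator {0..1} r \<partial>lborel) = ennreal (1 powr (- g + 1) / (- g + 1))"
      using g by (intro nn_integral_has_integral_lebesgue' has_integral_powr_from_0) auto
    have 2: "(\<integral>\<^sup>+r. ennreal (exp (- lam * r)) * indicator {0..} r \<partial>lborel) = ennreal (exp (- lam * 0) / lam)"
      using lam by (intro nn_integral_has_integral_lebesgue' has_integral_exp_minus_to_infinity) auto
    have [measurable]: "(\<lambda>r. ennreal (r powr (- g)) * indicator {0..1} r) \<in> borel_measurable borel"
      "(\<lambda>r. ennreal (exp (- lam * r)) * indicator {0..} r) \<in> borel_measurable borel"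
      by measurable
    show ?thesis
      unfolding 1[symmetric] 2[symmetric]
      by (subst (1 2) nn_integral_cmult[symmetric]; (rule nn_integral_add)?; measurable)
  qed
  also have "\<dots> < \<infinity>" by (simp add: ennreal_mult_less_top)
  finally show ?thesis .
qed

section \<open>Weighted \<open>L\<^sup>p\<close> norms of the pair kernel\<close>

lemma heat_kernel_bound_power:
  assumes r: "r > 0"
  shows "((2 * pi * r) powr (- (real d / 2))) ^ (p - 1) = (2 * pi * r) powr (- (real d * real (p - 1) / 2))"
proof -
  have "((2 * pi * r) powr (- (real d / 2))) ^ (p - 1) = (2 * pi * r) powr (real (p - 1) * - (real d / 2))"
    by (rule powr_power) (use r in simp)
  also have "real (p - 1) * - (real d / 2) = - (real d * real (p - 1) / 2)" by simp
  finally show ?thesis .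
qed

text \<open>Here the \<open>L\<^sup>1\<close> norm is at most 1. The bound is expressed by the
  weight that is adapted to differences, so that one choice of \<open>lam\<close> and
  \<open>c\<close> serves all factors of a product.\<close>

lemma nn_integral_heat_pair_kernel_le:
  fixes x :: "real ^ 'd"
  assumes r: "r > 0" "r' > 0" and e: "e > 0" and p: "p \<ge> 1"
  shows "(\<integral>\<^sup>+y. \<integral>\<^sup>+v. ennreal (\<bar>pair_kernel (heat_kernel e) r r' x y v\<bar> ^ p) \<partial>lborel \<partial>lborel)
    \<le> ennreal ((2 * time_weight CARD('d) p r * time_weight CARD('d) p r') ^ p)"
proof -
  let ?a = "(2 * pi * r) powr (- (real CARD('d) / 2))" and ?a' = "(2 * pi * r') powr (- (real CARD('d) / 2))"
  have q1: "(\<integral>\<^sup>+z. ennreal \<bar>heat_kernel e (z :: real ^ 'd)\<bar> \<partial>lborel) = 1" using e by simp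
  have mono1: "z \<le> z * (1 + z')" if "0 \<le> z" "0 \<le> z'" for z z' :: real
    using that by (simp add: distrib_left)
  have w: "?a ^ (p - 1) \<le> time_weight CARD('d) p r ^ p" "?a' ^ (p - 1) \<le> time_weight CARD('d) p r' ^ p"
    unfolding time_weight_power[OF r(1) p] time_weight_power[OF r(2) p]
      heat_kernel_bound_power[OF r(1)] heat_kernel_bound_power[OF r(2)]
    by - ((rule mono1; simp)+)
  have "(\<integral>\<^sup>+y. \<integral>\<^sup>+v. ennreal (\<bar>pair_kernel (heat_kernel e) r r' x y v\<bar> ^ p) \<partial>lborel \<partial>lborel)
    \<le> ennreal ((2 * (?a * ?a')) ^ (p - 1)) * (\<integral>\<^sup>+y. \<integral>\<^sup>+v. ennreal \<bar>pair_kernel (heat_kernel e) r r' x y v\<bar> \<partial>lborel \<partial>lborel)"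
    using r p q1 by (intro nn_integral_pair_kernel_power_le) auto
  also have "\<dots> \<le> ennreal ((2 * (?a * ?a')) ^ (p - 1)) * 1"
    using nn_integral_abs_pair_kernel_le[OF r, of "heat_kernel e" x] q1 by (intro mult_left_mono) auto
  also have "\<dots> \<le> ennreal ((2 * time_weight CARD('d) p r * time_weight CARD('d) p r') ^ p)"
  proof -
    have "(2 * (?a * ?a')) ^ (p - 1) = 2 ^ (p - 1) * ?a ^ (p - 1) * ?a' ^ (p - 1)"
      by (simp add: power_mult_distrib)
    also have "\<dots> \<le> 2 ^ p * time_weight CARD('d) p r ^ p * time_weight CARD('d) p r' ^ p"
      using w by (intro mult_mono) (auto simp: time_weight_nonneg)
    finally show ?thesis by (simp add: power_mult_distrib ennreal_leI)
  qed
  finally show ?thesis .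
qed

lemma nn_integral_heat_kernel_diff_le:
  assumes e: "0 < e'" "0 < e"
  shows "(\<integral>\<^sup>+z. ennreal \<bar>heat_kernel e' z - heat_kernel e (z :: real ^ 'd)\<bar> \<partial>lborel) \<le> 2"
proof -
  have "(\<integral>\<^sup>+z. ennreal \<bar>heat_kernel e' z - heat_kernel e (z :: real ^ 'd)\<bar> \<partial>lborel) \<le> (\<integral>\<^sup>+z. ennreal (heat_kernel e' z) + ennreal (heat_kernel e (z :: real ^ 'd)) \<partial>lborel)"
  proof (intro nn_integral_mono)
    fix z :: "real ^ 'd"
    have "\<bar>heat_kernel e' z - heat_kernel e z\<bar> \<le> heat_kernel e' z + heat_kernel e z"
      using heat_kernel_nonneg[of e z] heat_kernel_nonneg[of e' z] by linarith
    then show "ennreal \<bar>heat_kernel e' z - heat_kernel e z\<bar> \<le> ennreal (heat_kernel e' z) + ennreal (heat_kernel e z)"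
      by (simp add: ennreal_plus[symmetric] ennreal_leI del: ennreal_plus)
  qed
  also have "\<dots> = 2" using e by (simp add: nn_integral_add)
  finally show ?thesis .
qed

text \<open>The supremum bound enters with power \<open>p - 1\<close>, the translation error with
  power 1. That error is monotone in the smoothing parameter, so the contribution of
  \<open>e'\<close> is bounded by that of \<open>e\<close>; this is the source of the uniformity in
  \<open>e'\<close>.\<close>

lemma nn_integral_heat_diff_pair_kernel_le:
  fixes x :: "real ^ 'd"
  assumes r: "r > 0" "r' > 0" and e: "0 < e'" "e' \<le> e" and p: "p \<ge> 1"
  shows "(\<integral>\<^sup>+y. \<integral>\<^sup>+v. ennreal (\<bar>pair_kernel (\<lambda>z. heat_kernel e' z - heat_kernel e z) r r' x y v\<bar> ^ p) \<partial>lborel \<partial>lborel)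
    \<le> ennreal ((12 * (real CARD('d) * e / 8) powr (1 / (4 * real p)) * time_weight CARD('d) p r * time_weight CARD('d) p r') ^ p)"
proof -
  let ?a = "(2 * pi * r) powr (- (real CARD('d) / 2))" and ?a' = "(2 * pi * r') powr (- (real CARD('d) / 2))"
  let ?q = "\<lambda>z. heat_kernel e' z - heat_kernel e (z :: real ^ 'd)"
  define s where "s = (real CARD('d) * e / 8) powr (1/4)"
  have e0: "e > 0" using e by simp
  have q2: "(\<integral>\<^sup>+z. ennreal \<bar>?q z\<bar> \<partial>lborel) \<le> 2"
    by (rule nn_integral_heat_kernel_diff_le[OF e(1) e0])
  have hs: "heat_shift TYPE('d) f t \<le> ennreal (3 * s * t powr (- (1/4)))"
    if "0 < f" "f \<le> e" "0 < t" for f t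
  proof -
    have "heat_shift TYPE('d) f t \<le> ennreal (3 * (real CARD('d) * f / (8 * t)) powr (1/4))"
      using that by (intro heat_shift_le) auto
    also have "\<dots> \<le> ennreal (3 * (real CARD('d) * e / (8 * t)) powr (1/4))"
      using that by (intro ennreal_leI mult_left_mono powr_mono2 divide_right_mono) auto
    also have "(real CARD('d) * e / (8 * t)) = (real CARD('d) * e / 8) * (1 / t)" by simp
    also have "\<dots> powr (1/4) = s * t powr (- (1/4))"
      using that e0 unfolding s_def by (subst powr_mult) (auto simp: powr_minus_divide powr_divide)
    finally show ?thesis by (simp add: mult_ac)
  qed
  have s0: "0 \<le> s" by (simp add: s_def)
  define b b' where "b = r powr (- (1/4))" and "b' = r' powr (- (1/4))"
  have b0: "0 \<le> b" "0 \<le> b'" by (simp_all add: b_def b'_def)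
  have "(\<integral>\<^sup>+y. \<integral>\<^sup>+v. ennreal \<bar>pair_kernel ?q r r' x y v\<bar> \<partial>lborel \<partial>lborel)
    \<le> (heat_shift TYPE('d) e' r + heat_shift TYPE('d) e' r') + (heat_shift TYPE('d) e r + heat_shift TYPE('d) e r')"
    using r e by (intro nn_integral_abs_pair_kernel_diff_le) auto
  also have "\<dots> \<le> (ennreal (3 * s * b) + ennreal (3 * s * b')) + (ennreal (3 * s * b) + ennreal (3 * s * b'))"
    unfolding b_def b'_def using r e by (intro add_mono hs) auto
  also have "\<dots> = ennreal (6 * s * (b + b'))"
    using s0 b0 by (simp add: ennreal_plus[symmetric] algebra_simps del: ennreal_plus)
  \<comment> \<open>The sum becomes a product in order to separate the two times, each of which then
    carries its own weight.\<close>
  also have "\<dots> \<le> ennreal (6 * s * ((1 + b) * (1 + b')))"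
    using s0 b0 by (intro ennreal_leI mult_left_mono) (auto simp: algebra_simps)
  finally have L1: "(\<integral>\<^sup>+y. \<integral>\<^sup>+v. ennreal \<bar>pair_kernel ?q r r' x y v\<bar> \<partial>lborel \<partial>lborel) \<le> ennreal (6 * s * ((1 + b) * (1 + b')))" .
  have "(\<integral>\<^sup>+y. \<integral>\<^sup>+v. ennreal (\<bar>pair_kernel ?q r r' x y v\<bar> ^ p) \<partial>lborel \<partial>lborel)
    \<le> ennreal ((2 * (?a * ?a')) ^ (p - 1)) * (\<integral>\<^sup>+y. \<integral>\<^sup>+v. ennreal \<bar>pair_kernel ?q r r' x y v\<bar> \<partial>lborel \<partial>lborel)"
    using r p q2 by (intro nn_integral_pair_kernel_power_le) auto
  also have "\<dots> \<le> ennreal ((2 * (?a * ?a')) ^ (p - 1)) * ennreal (6 * s * ((1 + b) * (1 + b')))"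
    by (intro mult_left_mono L1) auto
  also have "\<dots> = ennreal ((2 * (?a * ?a')) ^ (p - 1) * (6 * s * ((1 + b) * (1 + b'))))"
    using s0 b0 by (simp add: ennreal_mult)
  also have "(2 * (?a * ?a')) ^ (p - 1) * (6 * s * ((1 + b) * (1 + b')))
      = (2 ^ (p - 1) * 6) * (s * (time_weight CARD('d) p r ^ p * time_weight CARD('d) p r' ^ p))"
    unfolding b_def b'_def time_weight_power[OF r(1) p] time_weight_power[OF r(2) p]
      power_mult_distrib heat_kernel_bound_power[OF r(1)] heat_kernel_bound_power[OF r(2)]
    by (simp only: mult_ac)
  also have "\<dots> \<le> 12 ^ p * (s * (time_weight CARD('d) p r ^ p * time_weight CARD('d) p r' ^ p))"
  proof (intro mult_right_mono)
    \<comment> \<open>The constant 12 is 2 from the supremum bound times 6 from the four translation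
      errors; everything is placed under a \<open>p\<close>-th power.\<close>
    have "(2::real) ^ (p - 1) * 6 \<le> 2 ^ p * 6 ^ p"
      using p self_le_power[of "6::real" p] by (intro mult_mono) auto
    then show "(2::real) ^ (p - 1) * 6 \<le> 12 ^ p" by (simp add: power_mult_distrib[symmetric])
  qed (use s0 in \<open>auto simp: time_weight_nonneg\<close>)
  also have "s = ((real CARD('d) * e / 8) powr (1 / (4 * real p))) ^ p"
    using p e0 unfolding s_def by (subst powr_power) auto
  finally show ?thesis
    by (simp add: power_mult_distrib mult_ac ennreal_leI)
qed

section \<open>Iterated kernels\<close>

text \<open>Expectation of the time-ordered integral of \<open>\<Prod>i. q (W (s i) - y i)\<close> over \<open>0 < s 1 < s 2 < \<dots> < T\<close>
  for a Brownian motion \<open>W\<close> started at \<open>x\<close>; the list gives the order in which the points are visited.\<close>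

primrec iter_kernel ::
    "(real ^ 'd \<Rightarrow> real) \<Rightarrow> 'i list \<Rightarrow> ('i \<Rightarrow> real ^ 'd) \<Rightarrow> real ^ 'd \<Rightarrow> real \<Rightarrow> real" where
  "iter_kernel q [] y x T = 1"
| "iter_kernel q (a # l) y x T = (\<integral>r. \<integral>z. (if 0 < r \<and> r < T
      then heat_kernel r (z - x) * q (z - y a) * iter_kernel q l y z (T - r) else 0) \<partial>lborel \<partial>lborel)"

lemma iter_kernel_cong:
  "(\<And>a. a \<in> set l \<Longrightarrow> y a = y' a) \<Longrightarrow> iter_kernel q l y x T = iter_kernel q l y' x T"
proof (induction l arbitrary: x T)
  case (Cons a l)
  have "iter_kernel q l y z S = iter_kernel q l y' z S" for z S
    using Cons by auto
  moreover have "y a = y' a" using Cons.prems by simp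
  ultimately show ?case by (simp cong: if_cong)
qed simp

text \<open>The recursion integrates over the starting point and shortens the horizon, so the
  induction needs measurability jointly in points, start and horizon.\<close>

lemma borel_measurable_iter_kernel_aux:
  fixes q :: "real ^ 'd \<Rightarrow> real" and l :: "'i list"
  assumes [measurable]: "q \<in> borel_measurable borel"
  shows "set l \<subseteq> I \<Longrightarrow> (\<lambda>s. iter_kernel q l (fst s) (fst (snd s)) (snd (snd s)))
    \<in> borel_measurable ((\<Pi>\<^sub>M i\<in>I. borel) \<Otimes>\<^sub>M (borel \<Otimes>\<^sub>M borel))"
proof (induction l)
  case (Cons a l)
  let ?S = "(\<Pi>\<^sub>M i\<in>I. borel) \<Otimes>\<^sub>M (borel \<Otimes>\<^sub>M borel) :: (('i \<Rightarrow> (real ^ 'd)) \<times> (real ^ 'd) \<times> real) measure"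
  have a: "a \<in> I" using Cons.prems by auto
  note IH = Cons.IH[OF subset_trans[OF set_subset_Cons Cons.prems]]
  have [measurable]: "(\<lambda>s. fst s a) \<in> borel_measurable ?S"
    using a by (intro measurable_compose[OF measurable_fst] measurable_component_singleton)
  have [measurable]: "(\<lambda>w. iter_kernel q l (fst (fst (fst w))) (snd w) (snd (snd (fst (fst w))) - snd (fst w)))
      \<in> borel_measurable ((?S \<Otimes>\<^sub>M lborel) \<Otimes>\<^sub>M lborel)"
    using measurable_compose[OF _ IH, of "\<lambda>w. (fst (fst (fst w)), snd w, snd (snd (fst (fst w))) - snd (fst w))"
        "(?S \<Otimes>\<^sub>M lborel) \<Otimes>\<^sub>M lborel"] by simp
  show ?case by simp
qed simp

lemma borel_measurable_iter_kernel:
  fixes q :: "real ^ 'd \<Rightarrow> real" and y :: "'w \<Rightarrow> 'i \<Rightarrow> real ^ 'd"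
  assumes q: "q \<in> borel_measurable borel" and l: "set l \<subseteq> I"
    and y: "y \<in> measurable M (\<Pi>\<^sub>M i\<in>I. borel)"
    and x: "x \<in> borel_measurable M" and T: "T \<in> borel_measurable M"
  shows "(\<lambda>w. iter_kernel q l (y w) (x w) (T w)) \<in> borel_measurable M"
  using measurable_compose[OF _ borel_measurable_iter_kernel_aux[OF q l], of "\<lambda>w. (y w, x w, T w)" M] y x T
  by simp

text \<open>Restricting \<open>y\<close> to the points of the list puts it into the product space
  without changing the kernel.\<close>

lemma borel_measurable_iter_kernel_const [measurable]:
  fixes q :: "real ^ 'd \<Rightarrow> real"
  assumes "q \<in> borel_measurable borel" "x \<in> borel_measurable M" "T \<in> borel_measurable M"
  shows "(\<lambda>w. iter_kernel q l y (x w) (T w)) \<in> borel_measurable M"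
proof -
  have "(\<lambda>w. iter_kernel q l (restrict y (set l)) (x w) (T w)) \<in> borel_measurable M"
    using assms by (intro borel_measurable_iter_kernel[where I = "set l"]) (auto simp: space_PiM)
  moreover have "iter_kernel q l (restrict y (set l)) (x w) (T w) = iter_kernel q l y (x w) (T w)" for w
    by (rule iter_kernel_cong) simp
  ultimately show ?thesis by simp
qed

text \<open>A crude bound through the supremum of \<open>q\<close>. It blows up with vanishing
  smoothing and serves to justify integrability and exchanges of integrals.\<close>

lemma abs_iter_kernel_le:
  fixes q :: "real ^ 'd \<Rightarrow> real"
  assumes [measurable]: "q \<in> borel_measurable borel" and K: "\<And>x. \<bar>q x\<bar> \<le> K"
  shows "0 \<le> T \<Longrightarrow> \<bar>iter_kernel q l y x T\<bar> \<le> (K * T) ^ length l"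
proof (induction l arbitrary: x T)
  case (Cons a l)
  have K0: "0 \<le> K" using K[of 0] by linarith
  have b: "ennreal \<bar>\<integral>z. (if 0 < r \<and> r < T
      then heat_kernel r (z - x) * q (z - y a) * iter_kernel q l y z (T - r) else 0) \<partial>lborel\<bar>
    \<le> ennreal (K * (K * T) ^ length l) * indicator {0..T} r" for r
  proof (cases "0 < r \<and> r < T")
    case True
    have "ennreal \<bar>\<integral>z. heat_kernel r (z - x) * q (z - y a) * iter_kernel q l y z (T - r) \<partial>lborel\<bar>
       \<le> (\<integral>\<^sup>+z. ennreal \<bar>heat_kernel r (z - x) * q (z - y a) * iter_kernel q l y z (T - r)\<bar> \<partial>lborel)"
      by (rule ennreal_abs_integral_le) measurable
    also have "\<dots> \<le> (\<integral>\<^sup>+z. ennreal (K * (K * T) ^ length l) * ennreal (heat_kernel r (z - x)) \<partial>lborel)"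
    proof (intro nn_integral_mono)
      fix z
      have "\<bar>iter_kernel q l y z (T - r)\<bar> \<le> (K * (T - r)) ^ length l"
        using True by (intro Cons.IH) auto
      also have "\<dots> \<le> (K * T) ^ length l"
        using True K0 by (intro power_mono mult_left_mono) auto
      finally have "\<bar>q (z - y a)\<bar> * \<bar>iter_kernel q l y z (T - r)\<bar> \<le> K * (K * T) ^ length l"
        using K K0 Cons.prems by (intro mult_mono) auto
      then have "heat_kernel r (z - x) * (\<bar>q (z - y a)\<bar> * \<bar>iter_kernel q l y z (T - r)\<bar>) \<le> heat_kernel r (z - x) * (K * (K * T) ^ length l)"
        by (rule mult_left_mono) simp
      then show "ennreal \<bar>heat_kernel r (z - x) * q (z - y a) * iter_kernel q l y z (T - r)\<bar>
        \<le> ennreal (K * (K * T) ^ length l) * ennreal (heat_kernel r (z - x))"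
        using K0 Cons.prems by (simp add: abs_mult ennreal_mult[symmetric] mult_ac ennreal_leI)
    qed
    also have "\<dots> = ennreal (K * (K * T) ^ length l)"
      using True by (simp add: nn_integral_cmult)
    finally show ?thesis using True by simp
  qed auto
  have "ennreal \<bar>iter_kernel q (a # l) y x T\<bar> \<le> (\<integral>\<^sup>+r. ennreal \<bar>\<integral>z. (if 0 < r \<and> r < T
      then heat_kernel r (z - x) * q (z - y a) * iter_kernel q l y z (T - r) else 0) \<partial>lborel\<bar> \<partial>lborel)"
    unfolding iter_kernel.simps by (rule ennreal_abs_integral_le) measurable
  also have "\<dots> \<le> (\<integral>\<^sup>+r. ennreal (K * (K * T) ^ length l) * indicator {0..T} r \<partial>lborel)"
    by (intro nn_integral_mono b)
  also have "\<dots> = ennreal (K * (K * T) ^ length l * T)"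
    using K0 Cons.prems by (simp add: nn_integral_cmult ennreal_mult)
  finally show ?case
    using K0 Cons.prems by (subst (asm) ennreal_le_iff) (auto simp: mult_ac)
qed simp

text \<open>The integral over the first visited position \<open>u\<close> is moved innermost. Its
  cancellation is thereby stored in \<open>pair_kernel\<close> before any absolute value is taken;
  the second position \<open>v\<close> remains as the start of the rest of the chain.\<close>

lemma iter_kernel_Cons_Cons:
  fixes q :: "real ^ 'd \<Rightarrow> real"
  assumes [measurable]: "q \<in> borel_measurable borel" and K: "\<And>x. \<bar>q x\<bar> \<le> K"
  shows "iter_kernel q (a # b # l) y x T = (\<integral>r. \<integral>r'. \<integral>v. (if 0 < r \<and> 0 < r' \<and> r + r' < T
      then q (v - y b) * iter_kernel q l y v (T - r - r') * pair_kernel q r r' x (y a) v else 0) \<partial>lborel \<partial>lborel \<partial>lborel)"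
proof -
  have K0: "0 \<le> K" using K[of 0] by linarith
  have step: "(\<integral>u. (if 0 < r \<and> r < T
      then heat_kernel r (u - x) * q (u - y a) * iter_kernel q (b # l) y u (T - r) else 0) \<partial>lborel)
    = (\<integral>r'. \<integral>v. (if 0 < r \<and> 0 < r' \<and> r + r' < T
      then q (v - y b) * iter_kernel q l y v (T - r - r') * pair_kernel q r r' x (y a) v else 0) \<partial>lborel \<partial>lborel)" for r
  proof (cases "0 < r \<and> r < T")
    case r: True
    define F where "F u = heat_kernel r (u - x) * q (u - y a)" for u
    define G where "G u r' v = (if 0 < r' \<and> r' < T - r
      then heat_kernel r' (v - u) * q (v - y b) * iter_kernel q l y v (T - r - r') else 0)" for u r' v
    define C where "C = K * (K * T) ^ length l"
    have C0: "0 \<le> C" using K0 r by (simp add: C_def)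
    have [measurable]: "F \<in> borel_measurable borel" unfolding F_def by measurable
    have [measurable]: "(\<lambda>z. \<integral>v. G (fst z) (snd z) v \<partial>lborel) \<in> borel_measurable (lborel \<Otimes>\<^sub>M lborel)"
      "\<And>r'. (\<lambda>z. G (fst z) r' (snd z)) \<in> borel_measurable (lborel \<Otimes>\<^sub>M lborel)"
      "\<And>u r'. (\<lambda>v. G u r' v) \<in> borel_measurable borel"
      unfolding G_def by measurable
    have Fb: "\<bar>F u\<bar> \<le> K * heat_kernel r (u - x)" for u
      unfolding F_def abs_mult using mult_right_mono[OF K[of "u - y a"], of "heat_kernel r (u - x)"] by (simp add: mult.commute)
    have Gb: "\<bar>G u r' v\<bar> \<le> indicator {0..T} r' * (C * heat_kernel r' (v - u))" for u r' v
    proof (cases "0 < r' \<and> r' < T - r")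
      case True
      have "\<bar>iter_kernel q l y v (T - r - r')\<bar> \<le> (K * (T - r - r')) ^ length l"
        using True by (intro abs_iter_kernel_le K) auto
      also have "\<dots> \<le> (K * T) ^ length l"
        using True K0 r by (intro power_mono mult_left_mono) auto
      finally have "\<bar>q (v - y b)\<bar> * \<bar>iter_kernel q l y v (T - r - r')\<bar> \<le> C"
        unfolding C_def using K K0 r by (intro mult_mono) auto
      then have "heat_kernel r' (v - u) * (\<bar>q (v - y b)\<bar> * \<bar>iter_kernel q l y v (T - r - r')\<bar>) \<le> heat_kernel r' (v - u) * C"
        by (rule mult_left_mono) simp
      then show ?thesis using True r by (simp add: G_def abs_mult mult_ac)
    qed (use C0 in \<open>auto simp: G_def indicator_def\<close>)
    have nnv: "(\<integral>\<^sup>+v. ennreal \<bar>G u r' v\<bar> \<partial>lborel) \<le> ennreal C * indicator {0..T} r'" for u r'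
    proof (cases "0 < r' \<and> r' < T - r")
      case True
      have "(\<integral>\<^sup>+v. ennreal \<bar>G u r' v\<bar> \<partial>lborel) \<le> (\<integral>\<^sup>+v. ennreal C * ennreal (heat_kernel r' (v - u)) \<partial>lborel)"
        using Gb[of u r'] True r C0
        by (intro nn_integral_mono) (auto simp: ennreal_mult[symmetric] intro!: ennreal_leI)
      then show ?thesis using True r by (simp add: nn_integral_cmult)
    qed (auto simp: G_def)
    have int1: "integrable (lborel \<Otimes>\<^sub>M lborel) (\<lambda>z. F (fst z) * (\<integral>v. G (fst z) (snd z) v \<partial>lborel))"
    proof (rule integrableI_bounded)
      have "(\<integral>\<^sup>+z. ennreal (norm (F (fst z) * (\<integral>v. G (fst z) (snd z) v \<partial>lborel))) \<partial>(lborel \<Otimes>\<^sub>M lborel))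
        = (\<integral>\<^sup>+u. \<integral>\<^sup>+r'. ennreal (\<bar>F u\<bar> * \<bar>\<integral>v. G u r' v \<partial>lborel\<bar>) \<partial>lborel \<partial>lborel)"
        by (subst lborel.nn_integral_fst[symmetric]) (auto simp: abs_mult)
      also have "\<dots> \<le> (\<integral>\<^sup>+u. \<integral>\<^sup>+r'. ennreal (K * heat_kernel r (u - x)) * (ennreal C * indicator {0..T} r') \<partial>lborel \<partial>lborel)"
      proof (intro nn_integral_mono)
        fix u r'
        have "ennreal \<bar>\<integral>v. G u r' v \<partial>lborel\<bar> \<le> ennreal C * indicator {0..T} r'"
          by (rule order_trans[OF ennreal_abs_integral_le nnv]) measurable
        then have "ennreal \<bar>F u\<bar> * ennreal \<bar>\<integral>v. G u r' v \<partial>lborel\<bar> \<le> ennreal (K * heat_kernel r (u - x)) * (ennreal C * indicator {0..T} r')"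
          using Fb[of u] by (intro mult_mono ennreal_leI) auto
        then show "ennreal (\<bar>F u\<bar> * \<bar>\<integral>v. G u r' v \<partial>lborel\<bar>) \<le> ennreal (K * heat_kernel r (u - x)) * (ennreal C * indicator {0..T} r')"
          by (simp add: ennreal_mult)
      qed
      also have "\<dots> = ennreal K * (ennreal C * ennreal T)"
        using r K0 by (simp add: nn_integral_cmult nn_integral_multc ennreal_mult)
      also have "\<dots> < \<infinity>" by (simp add: ennreal_mult_less_top)
      finally show "(\<integral>\<^sup>+z. ennreal (norm (F (fst z) * (\<integral>v. G (fst z) (snd z) v \<partial>lborel))) \<partial>(lborel \<Otimes>\<^sub>M lborel)) < \<infinity>" .
    qed measurable
    have int2: "integrable (lborel \<Otimes>\<^sub>M lborel) (\<lambda>z. F (fst z) * G (fst z) r' (snd z))" for r'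
    proof (rule integrableI_bounded)
      have "(\<integral>\<^sup>+z. ennreal (norm (F (fst z) * G (fst z) r' (snd z))) \<partial>(lborel \<Otimes>\<^sub>M lborel))
        = (\<integral>\<^sup>+u. \<integral>\<^sup>+v. ennreal \<bar>F u\<bar> * ennreal \<bar>G u r' v\<bar> \<partial>lborel \<partial>lborel)"
        by (subst lborel.nn_integral_fst[symmetric]) (auto simp: abs_mult ennreal_mult)
      also have "\<dots> = (\<integral>\<^sup>+u. ennreal \<bar>F u\<bar> * (\<integral>\<^sup>+v. ennreal \<bar>G u r' v\<bar> \<partial>lborel) \<partial>lborel)"
        by (intro nn_integral_cong nn_integral_cmult) measurable
      also have "\<dots> \<le> (\<integral>\<^sup>+u. ennreal (K * heat_kernel r (u - x)) * (ennreal C * indicator {0..T} r') \<partial>lborel)"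
        using Fb by (intro nn_integral_mono mult_mono ennreal_leI nnv) auto
      also have "\<dots> = ennreal K * (ennreal C * indicator {0..T} r')"
        using r K0 by (simp add: nn_integral_cmult nn_integral_multc ennreal_mult)
      also have "\<dots> < \<infinity>" by (simp add: ennreal_mult_less_top indicator_def)
      finally show "(\<integral>\<^sup>+z. ennreal (norm (F (fst z) * G (fst z) r' (snd z))) \<partial>(lborel \<Otimes>\<^sub>M lborel)) < \<infinity>" .
    qed measurable
    have "(\<integral>u. (if 0 < r \<and> r < T
        then heat_kernel r (u - x) * q (u - y a) * iter_kernel q (b # l) y u (T - r) else 0) \<partial>lborel)
      = (\<integral>u. F u * (\<integral>r'. \<integral>v. G u r' v \<partial>lborel \<partial>lborel) \<partial>lborel)"
      using r by (simp add: F_def G_def)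
    also have "\<dots> = (\<integral>u. \<integral>r'. F u * (\<integral>v. G u r' v \<partial>lborel) \<partial>lborel \<partial>lborel)"
      by simp
    \<comment> \<open>The variable \<open>u\<close> passes first \<open>r'\<close> and then
      \<open>v\<close>; \<open>int1\<close> and \<open>int2\<close> justify the two
      exchanges.\<close>
    also have "\<dots> = (\<integral>r'. \<integral>u. F u * (\<integral>v. G u r' v \<partial>lborel) \<partial>lborel \<partial>lborel)"
      using lborel_pair.Fubini_integral[of "\<lambda>u r'. F u * (\<integral>v. G u r' v \<partial>lborel)"] int1 by (simp add: case_prod_unfold)
    also have "\<dots> = (\<integral>r'. \<integral>u. \<integral>v. F u * G u r' v \<partial>lborel \<partial>lborel \<partial>lborel)"
      by simp
    also have "\<dots> = (\<integral>r'. \<integral>v. \<integral>u. F u * G u r' v \<partial>lborel \<partial>lborel \<partial>lborel)"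
      using lborel_pair.Fubini_integral[of "\<lambda>u v. F u * G u r' v" for r'] int2 by (simp add: case_prod_unfold)
    also have "\<dots> = (\<integral>r'. \<integral>v. (if 0 < r \<and> 0 < r' \<and> r + r' < T
      then q (v - y b) * iter_kernel q l y v (T - r - r') * pair_kernel q r r' x (y a) v else 0) \<partial>lborel \<partial>lborel)"
    proof (intro Bochner_Integration.integral_cong refl)
      fix r' v
      show "(\<integral>u. F u * G u r' v \<partial>lborel) = (if 0 < r \<and> 0 < r' \<and> r + r' < T
        then q (v - y b) * iter_kernel q l y v (T - r - r') * pair_kernel q r r' x (y a) v else 0)"
      proof (cases "0 < r' \<and> r' < T - r")
        case True
        have "(\<integral>u. F u * G u r' v \<partial>lborel) = (\<integral>u. (q (v - y b) * iter_kernel q l y v (T - r - r'))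
            * (heat_kernel r (u - x) * heat_kernel r' (v - u) * q (u - y a)) \<partial>lborel)"
          using True by (intro Bochner_Integration.integral_cong refl) (simp add: F_def G_def mult_ac)
        then show ?thesis using True r by (simp add: pair_kernel_def)
      qed (use r in \<open>auto simp: G_def\<close>)
    qed
    finally show ?thesis .
  next
    case False
    then have *: "\<not> (0 < r \<and> 0 < r' \<and> r + r' < T)" for r' by auto
    from False show ?thesis by (simp only: * if_False) simp
  qed
  show ?thesis
    by (subst iter_kernel.simps) (simp only: step)
qed

text \<open>The hypothesis \<open>cong\<close> expresses that \<open>h\<close> ignores the
  coordinates \<open>a\<close> and \<open>b\<close>, so the integral over the product space
  factors.\<close>

lemma nn_integral_PiM_insert_insert:
  fixes f g :: "'a::euclidean_space \<Rightarrow> ennreal" and h :: "('i \<Rightarrow> 'a) \<Rightarrow> ennreal"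
  assumes S: "finite S" "a \<notin> S" "b \<notin> S" "a \<noteq> b"
    and f[measurable]: "f \<in> borel_measurable borel" and g[measurable]: "g \<in> borel_measurable borel"
    and h[measurable]: "h \<in> borel_measurable (\<Pi>\<^sub>M i\<in>S. lborel)"
    and cong: "\<And>y y'. (\<And>i. i \<in> S \<Longrightarrow> y i = y' i) \<Longrightarrow> h y = h y'"
  shows "(\<integral>\<^sup>+y. f (y b) * g (y a) * h y \<partial>(\<Pi>\<^sub>M i\<in>insert a (insert b S). lborel))
    = (\<integral>\<^sup>+x. f x \<partial>lborel) * (\<integral>\<^sup>+x. g x \<partial>lborel) * (\<integral>\<^sup>+y. h y \<partial>(\<Pi>\<^sub>M i\<in>S. lborel))"
proof -
  interpret product_sigma_finite "\<lambda>_ :: 'i. lborel :: 'a measure" by standard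
  have h_meas: "h \<in> borel_measurable (\<Pi>\<^sub>M i\<in>I. lborel)" if "S \<subseteq> I" for I
  proof -
    have "(\<lambda>y. h (restrict y S)) \<in> borel_measurable (\<Pi>\<^sub>M i\<in>I. lborel)"
      using that by (intro measurable_compose[OF measurable_restrict_subset h])
    moreover have "h (restrict y S) = h y" for y by (rule cong) simp
    ultimately show ?thesis by simp
  qed
  have [measurable]: "h \<in> borel_measurable (\<Pi>\<^sub>M i\<in>insert b S. lborel)"
    "h \<in> borel_measurable (\<Pi>\<^sub>M i\<in>insert a (insert b S). lborel)"
    by (intro h_meas; auto)+
  have ha: "h (y(a := x)) = h y" and hb: "h (y(b := x)) = h y" for y x
    using S by (auto intro: cong)
  have "(\<integral>\<^sup>+y. f (y b) * g (y a) * h y \<partial>(\<Pi>\<^sub>M i\<in>insert a (insert b S). lborel))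
    = (\<integral>\<^sup>+y. \<integral>\<^sup>+x. f (y b) * g x * h y \<partial>lborel \<partial>(\<Pi>\<^sub>M i\<in>insert b S. lborel))"
    using S by (subst product_nn_integral_insert) (auto simp: ha)
  also have "\<dots> = (\<integral>\<^sup>+y. f (y b) * (\<integral>\<^sup>+x. g x \<partial>lborel) * h y \<partial>(\<Pi>\<^sub>M i\<in>insert b S. lborel))"
    by (simp add: nn_integral_cmult nn_integral_multc)
  also have "\<dots> = (\<integral>\<^sup>+y. \<integral>\<^sup>+x. f x * (\<integral>\<^sup>+x. g x \<partial>lborel) * h y \<partial>lborel \<partial>(\<Pi>\<^sub>M i\<in>S. lborel))"
    using S by (subst product_nn_integral_insert) (auto simp: hb)
  also have "\<dots> = (\<integral>\<^sup>+y. (\<integral>\<^sup>+x. f x \<partial>lborel) * (\<integral>\<^sup>+x. g x \<partial>lborel) * h y \<partial>(\<Pi>\<^sub>M i\<in>S. lborel))"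
    by (simp add: nn_integral_multc)
  also have "\<dots> = (\<integral>\<^sup>+x. f x \<partial>lborel) * (\<integral>\<^sup>+x. g x \<partial>lborel) * (\<integral>\<^sup>+y. h y \<partial>(\<Pi>\<^sub>M i\<in>S. lborel))"
    by (simp add: nn_integral_cmult)
  finally show ?thesis .
qed

lemma sigma_finite_PiM_lborel:
  "finite S \<Longrightarrow> sigma_finite_measure (\<Pi>\<^sub>M i\<in>S. (lborel :: 'a::euclidean_space measure))"
proof -
  assume "finite S"
  interpret finite_product_sigma_finite "\<lambda>_ :: 'b. lborel :: 'a measure" S by standard fact
  show "sigma_finite_measure (\<Pi>\<^sub>M i\<in>S. (lborel :: 'a measure))" by (rule sigma_finite_measure_axioms)
qed

lemma sets_PiM_lborel: "sets (\<Pi>\<^sub>M i\<in>S. (lborel :: 'a::euclidean_space measure)) = sets (\<Pi>\<^sub>M i\<in>S. borel)"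
  by (intro sets_PiM_cong) auto

section \<open>Jensen's inequality, one pair of visits at a time\<close>

text \<open>What the induction over pairs must know about \<open>q\<close>. It is instantiated with
  a heat kernel (\<open>\<kappa> = 2\<close>) and with a difference of two (small
  \<open>\<kappa>\<close>). The supremum \<open>K\<close> enters only qualitatively and is absent
  from the resulting bounds.\<close>

locale pair_kernel_bound =
  fixes q :: "real ^ 'd \<Rightarrow> real" and K \<kappa> lam c :: real and p :: nat
  assumes q_measurable [measurable]: "q \<in> borel_measurable borel"
    and q_le: "\<bar>q x\<bar> \<le> K"
    and q_mass: "(\<integral>\<^sup>+x. ennreal \<bar>q x\<bar> \<partial>lborel) \<le> 2"
    and p1: "p \<ge> 1" and kappa: "\<kappa> > 0" and lam: "lam > 0" and c: "c > 0"
    and pair_le: "\<And>r r' x. 0 < r \<Longrightarrow> 0 < r' \<Longrightarrow>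
      (\<integral>\<^sup>+y. \<integral>\<^sup>+v. ennreal (\<bar>pair_kernel q r r' x y v\<bar> ^ p) \<partial>lborel \<partial>lborel)
        \<le> ennreal ((\<kappa> * time_weight CARD('d) p r * time_weight CARD('d) p r') ^ p)"
    and weight_le: "(\<integral>\<^sup>+r. ennreal (exp (- lam * r) * time_weight CARD('d) p r) * indicator {0<..} r \<partial>lborel) \<le> ennreal c"
begin

text \<open>The density of the finite reference measure for Jensen's inequality;
  \<open>gpart\<close> is the remaining integrand divided by the weight. Keeping
  \<open>\<bar>q (v - yb)\<bar>\<close> in the reference measure spares it the \<open>p\<close>-th
  power: its mass in \<open>v\<close> bounds the total mass, and its mass in \<open>yb\<close> is
  used when the points are integrated out.\<close>

definition "fweight yb r r' v =
  (if 0 < r \<and> 0 < r' then ennreal (exp (- lam * (r + r')) * (\<kappa> * time_weight CARD('d) p r * time_weight CARD('d) p r')) * ennreal \<bar>q (v - yb)\<bar> else 0)"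

definition "gpart l y x ya T r r' v =
  (if 0 < r \<and> 0 < r' \<and> r + r' < T then ennreal (exp (lam * (r + r')) / (\<kappa> * time_weight CARD('d) p r * time_weight CARD('d) p r')
      * (\<bar>iter_kernel q l y v (T - r - r')\<bar> * \<bar>pair_kernel q r r' x ya v\<bar>)) else 0)"

lemma weight_pos: "0 < r \<Longrightarrow> 0 < r' \<Longrightarrow> 0 < \<kappa> * time_weight CARD('d) p r * time_weight CARD('d) p r'"
  using kappa by (simp add: time_weight_pos)

text \<open>The triangle inequality for the regrouped integral, after the cancellation in the first
  position; the weights in \<open>fweight\<close> and \<open>gpart\<close> cancel.\<close>

lemma abs_iter_kernel_pair_le:
  "ennreal \<bar>iter_kernel q (a # b # l) y x T\<bar>
    \<le> (\<integral>\<^sup>+r. \<integral>\<^sup>+r'. \<integral>\<^sup>+v. fweight (y b) r r' v * gpart l y x (y a) T r r' v \<partial>lborel \<partial>lborel \<partial>lborel)"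
proof -
  define F where "F r r' v = (if 0 < r \<and> 0 < r' \<and> r + r' < T
      then q (v - y b) * iter_kernel q l y v (T - r - r') * pair_kernel q r r' x (y a) v else 0)" for r r' v
  have [measurable]: "(\<lambda>r. \<integral>r'. \<integral>v. F r r' v \<partial>lborel \<partial>lborel) \<in> borel_measurable borel"
    "\<And>r. (\<lambda>r'. \<integral>v. F r r' v \<partial>lborel) \<in> borel_measurable borel" "\<And>r r'. (\<lambda>v. F r r' v) \<in> borel_measurable borel"
    unfolding F_def by measurable
  have "iter_kernel q (a # b # l) y x T = (\<integral>r. \<integral>r'. \<integral>v. F r r' v \<partial>lborel \<partial>lborel \<partial>lborel)"
    unfolding F_def by (rule iter_kernel_Cons_Cons[OF q_measurable q_le])
  then have "ennreal \<bar>iter_kernel q (a # b # l) y x T\<bar>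
    \<le> (\<integral>\<^sup>+r. ennreal \<bar>\<integral>r'. \<integral>v. F r r' v \<partial>lborel \<partial>lborel\<bar> \<partial>lborel)"
    using ennreal_abs_integral_le[of "\<lambda>r. \<integral>r'. \<integral>v. F r r' v \<partial>lborel \<partial>lborel" lborel] by simp
  also have "\<dots> \<le> (\<integral>\<^sup>+r. \<integral>\<^sup>+r'. ennreal \<bar>\<integral>v. F r r' v \<partial>lborel\<bar> \<partial>lborel \<partial>lborel)"
    by (intro nn_integral_mono ennreal_abs_integral_le) measurable
  also have "\<dots> \<le> (\<integral>\<^sup>+r. \<integral>\<^sup>+r'. \<integral>\<^sup>+v. ennreal \<bar>F r r' v\<bar> \<partial>lborel \<partial>lborel \<partial>lborel)"
    by (intro nn_integral_mono ennreal_abs_integral_le) measurable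
  also have "\<dots> = (\<integral>\<^sup>+r. \<integral>\<^sup>+r'. \<integral>\<^sup>+v. fweight (y b) r r' v * gpart l y x (y a) T r r' v \<partial>lborel \<partial>lborel \<partial>lborel)"
  proof (intro nn_integral_cong)
    fix r r' v
    show "ennreal \<bar>F r r' v\<bar> = fweight (y b) r r' v * gpart l y x (y a) T r r' v"
    proof (cases "0 < r \<and> 0 < r' \<and> r + r' < T")
      case True
      define W where "W = \<kappa> * time_weight CARD('d) p r * time_weight CARD('d) p r'"
      have W: "0 < W" using True weight_pos by (simp add: W_def)
      have e: "exp (- lam * (r + r')) * exp (lam * (r + r')) = 1"
        by (simp add: exp_add[symmetric])
      have "(exp (- lam * (r + r')) * W) * \<bar>q (v - y b)\<bar> * (exp (lam * (r + r')) / W * (\<bar>iter_kernel q l y v (T - r - r')\<bar> * \<bar>pair_kernel q r r' x (y a) v\<bar>))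
         = (exp (- lam * (r + r')) * exp (lam * (r + r'))) * \<bar>F r r' v\<bar>"
        using True W by (simp add: F_def abs_mult)
      then have "(exp (- lam * (r + r')) * W) * \<bar>q (v - y b)\<bar> * (exp (lam * (r + r')) / W * (\<bar>iter_kernel q l y v (T - r - r')\<bar> * \<bar>pair_kernel q r r' x (y a) v\<bar>))
         = \<bar>F r r' v\<bar>" by (simp only: e mult_1)
      then show ?thesis
        using True W unfolding fweight_def gpart_def W_def[symmetric]
        by (simp add: ennreal_mult[symmetric])
    qed (auto simp: F_def gpart_def)
  qed
  finally show ?thesis .
qed

lemma nn_integral_weight_le:
  "(\<integral>\<^sup>+r. \<integral>\<^sup>+r'. (if 0 < r \<and> 0 < r' then ennreal (exp (- lam * (r + r')) * (\<kappa> * time_weight CARD('d) p r * time_weight CARD('d) p r')) else 0) \<partial>lborel \<partial>lborel)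
    \<le> ennreal (\<kappa> * c\<^sup>2)"
proof -
  let ?u = "\<lambda>r. ennreal (exp (- lam * r) * time_weight CARD('d) p r) * indicator {0<..} r"
  have "(\<integral>\<^sup>+r. \<integral>\<^sup>+r'. (if 0 < r \<and> 0 < r' then ennreal (exp (- lam * (r + r')) * (\<kappa> * time_weight CARD('d) p r * time_weight CARD('d) p r')) else 0) \<partial>lborel \<partial>lborel)
    = (\<integral>\<^sup>+r. \<integral>\<^sup>+r'. ennreal \<kappa> * (?u r * ?u r') \<partial>lborel \<partial>lborel)"
    using kappa by (intro nn_integral_cong)
      (auto simp: ennreal_mult[symmetric] time_weight_nonneg exp_add[symmetric] distrib_left mult_ac
        simp flip: exp_add split: split_indicator)
  also have "\<dots> = ennreal \<kappa> * ((\<integral>\<^sup>+r. ?u r \<partial>lborel) * (\<integral>\<^sup>+r. ?u r \<partial>lborel))"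
    by (simp add: nn_integral_cmult nn_integral_multc)
  also have "\<dots> \<le> ennreal \<kappa> * (ennreal c * ennreal c)"
    by (intro mult_left_mono mult_mono weight_le) auto
  also have "\<dots> = ennreal (\<kappa> * c\<^sup>2)"
    using kappa c by (simp add: ennreal_mult[symmetric] power2_eq_square)
  finally show ?thesis .
qed

lemma q_mass_shift: "(\<integral>\<^sup>+v. ennreal \<bar>q (v - y)\<bar> \<partial>lborel) \<le> 2" "(\<integral>\<^sup>+y. ennreal \<bar>q (v - y)\<bar> \<partial>lborel) \<le> 2"
  using nn_integral_lborel_diff[of "\<lambda>x. ennreal \<bar>q x\<bar>" y] nn_integral_lborel_reflect[of "\<lambda>x. ennreal \<bar>q x\<bar>" v] q_mass
  by simp_all

lemma nn_integral_fweight_le: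
  "(\<integral>\<^sup>+r. \<integral>\<^sup>+r'. \<integral>\<^sup>+v. fweight yb r r' v \<partial>lborel \<partial>lborel \<partial>lborel) \<le> ennreal (2 * \<kappa> * c\<^sup>2)"
proof -
  have "(\<integral>\<^sup>+r. \<integral>\<^sup>+r'. \<integral>\<^sup>+v. fweight yb r r' v \<partial>lborel \<partial>lborel \<partial>lborel)
    \<le> (\<integral>\<^sup>+r. \<integral>\<^sup>+r'. (if 0 < r \<and> 0 < r' then ennreal (exp (- lam * (r + r')) * (\<kappa> * time_weight CARD('d) p r * time_weight CARD('d) p r')) else 0) * 2 \<partial>lborel \<partial>lborel)"
  proof (intro nn_integral_mono)
    fix r r'
    show "(\<integral>\<^sup>+v. fweight yb r r' v \<partial>lborel) \<le> (if 0 < r \<and> 0 < r' then ennreal (exp (- lam * (r + r')) * (\<kappa> * time_weight CARD('d) p r * time_weight CARD('d) p r')) else 0) * 2"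
      using q_mass_shift(1)[of yb] unfolding fweight_def
      by (cases "0 < r \<and> 0 < r'") (simp_all add: nn_integral_cmult mult_left_mono del: de_Morgan_conj)
  qed
  also have "\<dots> = (\<integral>\<^sup>+r. \<integral>\<^sup>+r'. (if 0 < r \<and> 0 < r' then ennreal (exp (- lam * (r + r')) * (\<kappa> * time_weight CARD('d) p r * time_weight CARD('d) p r')) else 0) \<partial>lborel \<partial>lborel) * 2"
    by (simp add: nn_integral_multc)
  also have "\<dots> \<le> ennreal (\<kappa> * c\<^sup>2) * 2"
    by (intro mult_right_mono nn_integral_weight_le) auto
  also have "\<dots> = ennreal (2 * \<kappa> * c\<^sup>2)"
    using kappa by (simp add: ennreal_mult' mult_ac)
  finally show ?thesis .
qed

lemma fweight_measurable [measurable]: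
  assumes [measurable]: "yb \<in> borel_measurable M" "r \<in> borel_measurable M" "r' \<in> borel_measurable M" "v \<in> borel_measurable M"
  shows "(\<lambda>u. fweight (yb u) (r u) (r' u) (v u)) \<in> borel_measurable M"
  unfolding fweight_def by measurable

lemma measurable_gpart:
  assumes l: "set l \<subseteq> I" and y: "y \<in> measurable M (\<Pi>\<^sub>M i\<in>I. borel)"
    and [measurable]: "ya \<in> borel_measurable M" "r \<in> borel_measurable M" "r' \<in> borel_measurable M" "v \<in> borel_measurable M"
  shows "(\<lambda>u. gpart l (y u) x (ya u) T (r u) (r' u) (v u)) \<in> borel_measurable M"
proof -
  have [measurable]: "(\<lambda>u. iter_kernel q l (y u) (v u) (T - r u - r' u)) \<in> borel_measurable M"
    by (intro borel_measurable_iter_kernel[OF _ l y]) measurable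
  show ?thesis unfolding gpart_def by measurable
qed

text \<open>Induction on the number of pairs, uniformly in the starting point. Jensen's inequality
  is applied to the first pair; then the points are integrated before times and positions. Points
  are distinct, so each coordinate occurs once, and the rest of the chain falls under the induction
  hypothesis with start \<open>v\<close> and horizon \<open>T - r - r'\<close>.\<close>

lemma nn_integral_iter_kernel_power_le:
  fixes l :: "'i list"
  shows "distinct l \<Longrightarrow> length l = 2 * n \<Longrightarrow> 0 \<le> T \<Longrightarrow>
    (\<integral>\<^sup>+y. ennreal (\<bar>iter_kernel q l y x T\<bar> ^ p) \<partial>(\<Pi>\<^sub>M i\<in>set l. lborel))
      \<le> ennreal (((2 * \<kappa> * c\<^sup>2) ^ n * exp (lam * T)) ^ p)"
proof (induction n arbitrary: l x T)
  case 0
  interpret product_sigma_finite "\<lambda>_ :: 'i. lborel :: (real ^ 'd) measure" by standard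
  have "1 ^ p \<le> exp (lam * T) ^ p" using lam 0 by (intro power_mono) auto
  then have "1 \<le> ennreal (exp (lam * T) ^ p)" using ennreal_leI by fastforce
  with 0 show ?case by (simp add: PiM_empty nn_integral_count_space_finite)
next
  case (Suc n)
  from Suc.prems obtain a b l' where l: "l = a # b # l'" and l': "length l' = 2 * n"
    by (cases l; cases "tl l") auto
  define S where "S = set l'"
  have S: "finite S" "a \<notin> S" "b \<notin> S" "a \<noteq> b" using Suc.prems l by (auto simp: S_def)
  define I where "I = insert a (insert b S)"
  have setl: "set l = I" using l by (simp add: I_def S_def)
  define m where "m = 2 * \<kappa> * c\<^sup>2"
  have m: "0 < m" using kappa c by (simp add: m_def)
  define C where "C = (m ^ n) ^ p"
  have C: "0 \<le> C" using m by (simp add: C_def)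
  let ?N = "lborel \<Otimes>\<^sub>M (lborel \<Otimes>\<^sub>M lborel) :: (real \<times> real \<times> (real ^ 'd)) measure"
  let ?P = "\<Pi>\<^sub>M i\<in>I. (lborel :: (real ^ 'd) measure)"
  let ?f = "\<lambda>y z. fweight (y b) (fst z) (fst (snd z)) (snd (snd z))"
  let ?g = "\<lambda>y z. gpart l' y x (y a) T (fst z) (fst (snd z)) (snd (snd z))"
  have sfN: "sigma_finite_measure ?N" unfolding lborel_prod by (rule lborel.sigma_finite_measure_axioms)
  have sfN2: "sigma_finite_measure (lborel \<Otimes>\<^sub>M lborel :: (real \<times> (real ^ 'd)) measure)"
    unfolding lborel_prod by (rule lborel.sigma_finite_measure_axioms)
  interpret PN: pair_sigma_finite ?P ?N
    using sfN S sigma_finite_PiM_lborel[of I] by (simp add: pair_sigma_finite_def I_def)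
  have compI: "i \<in> I \<Longrightarrow> (\<lambda>y. y i) \<in> borel_measurable ?P" for i
    using measurable_component_singleton[of i I "\<lambda>_. lborel"] by simp
  have [measurable]: "(\<lambda>y. y a) \<in> borel_measurable ?P" "(\<lambda>y. y b) \<in> borel_measurable ?P"
    by (intro compI; simp add: I_def)+
  have idP: "(\<lambda>y. y) \<in> measurable ?P (\<Pi>\<^sub>M i\<in>I. borel)"
    by (intro measurable_ident_sets sets_PiM_lborel)
  have fst_id: "(\<lambda>u. fst u) \<in> measurable (?P \<Otimes>\<^sub>M ?N) (\<Pi>\<^sub>M i\<in>I. borel)"
    using measurable_compose[OF measurable_fst idP] by simp
  have g_meas[measurable]: "(\<lambda>u. ?g (fst u) (snd u)) \<in> borel_measurable (?P \<Otimes>\<^sub>M ?N)"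
    by (rule measurable_gpart[OF _ fst_id]) (auto simp: I_def S_def)
  have g_meas2[measurable]: "(\<lambda>z. ?g y z) \<in> borel_measurable ?N" for y
  proof -
    have "(\<lambda>z. gpart l' (restrict y I) x (y a) T (fst z) (fst (snd z)) (snd (snd z))) \<in> borel_measurable ?N"
      by (rule measurable_gpart[where I = I]) (auto simp: I_def S_def space_PiM)
    moreover have "gpart l' (restrict y I) x (y a) T r r' v = gpart l' y x (y a) T r r' v" for r r' v
      unfolding gpart_def by (subst iter_kernel_cong[of l' "restrict y I" y]) (auto simp: I_def S_def)
    ultimately show ?thesis by simp
  qed
  have unfoldN: "(\<integral>\<^sup>+z. F z \<partial>?N) = (\<integral>\<^sup>+r. \<integral>\<^sup>+r'. \<integral>\<^sup>+v. F (r, r', v) \<partial>lborel \<partial>lborel \<partial>lborel)"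
    if [measurable]: "F \<in> borel_measurable ?N" for F :: "_ \<Rightarrow> ennreal"
  proof -
    have "(\<integral>\<^sup>+z. F z \<partial>?N) = (\<integral>\<^sup>+r. \<integral>\<^sup>+z. F (r, z) \<partial>(lborel \<Otimes>\<^sub>M lborel) \<partial>lborel)"
      by (subst sigma_finite_measure.nn_integral_fst[OF sfN2, symmetric]) auto
    also have "\<dots> = (\<integral>\<^sup>+r. \<integral>\<^sup>+r'. \<integral>\<^sup>+v. F (r, r', v) \<partial>lborel \<partial>lborel \<partial>lborel)"
      by (intro nn_integral_cong, subst lborel.nn_integral_fst[symmetric]) auto
    finally show ?thesis .
  qed
  \<comment> \<open>Jensen at fixed points \<open>y\<close>; the mass bound \<open>m\<close> of the
    reference measure does not depend on \<open>y\<close>.\<close>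
  have pt: "ennreal (\<bar>iter_kernel q l y x T\<bar> ^ p) \<le> ennreal m ^ (p - 1) * (\<integral>\<^sup>+z. ?f y z * ?g y z ^ p \<partial>?N)" for y
  proof -
    have "ennreal \<bar>iter_kernel q l y x T\<bar> \<le> (\<integral>\<^sup>+z. ?f y z * ?g y z \<partial>?N)"
      unfolding l using abs_iter_kernel_pair_le[of a b l' y x T] by (subst unfoldN) auto
    then have "ennreal (\<bar>iter_kernel q l y x T\<bar> ^ p) \<le> (\<integral>\<^sup>+z. ?f y z * ?g y z \<partial>?N) ^ p"
      by (simp add: ennreal_power[symmetric] power_mono)
    also have "\<dots> \<le> ennreal m ^ (p - 1) * (\<integral>\<^sup>+z. ?f y z * ?g y z ^ p \<partial>?N)"
    proof (intro nn_integral_mult_power_le p1 m)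
      show "(\<integral>\<^sup>+z. ?f y z \<partial>?N) \<le> ennreal m"
        unfolding m_def using nn_integral_fweight_le[of "y b"] by (subst unfoldN) auto
    qed measurable
    finally show ?thesis .
  qed
  let ?B = "\<lambda>r r' v ya. ennreal (\<bar>pair_kernel q r r' x ya v\<bar> ^ p / (\<kappa> * time_weight CARD('d) p r * time_weight CARD('d) p r') ^ p)"
  let ?W = "\<lambda>r r'. ennreal (exp (- lam * (r + r')) * (\<kappa> * time_weight CARD('d) p r * time_weight CARD('d) p r'))"
  \<comment> \<open>At fixed times and position \<open>v\<close> the points separate:
    \<open>y b\<close> occurs only in the reference measure, \<open>y a\<close> only in the pair
    kernel, and the others only in the rest of the chain.\<close>
  have inner: "(\<integral>\<^sup>+y. ?f y (r, r', v) * ?g y (r, r', v) ^ p \<partial>?P)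
      \<le> (if 0 < r \<and> 0 < r' then ?W r r' else 0) * 2 * ennreal (C * exp (lam * T) ^ p) * (\<integral>\<^sup>+ya. ?B r r' v ya \<partial>lborel)" for r r' v
  proof (cases "0 < r \<and> 0 < r' \<and> r + r' < T")
    case True
    define V where "V = \<kappa> * time_weight CARD('d) p r * time_weight CARD('d) p r'"
    have V: "0 < V" using True weight_pos by (simp add: V_def)
    let ?H = "\<lambda>y. ennreal (exp (lam * (r + r')) ^ p * \<bar>iter_kernel q l' y v (T - r - r')\<bar> ^ p)"
    have "(\<integral>\<^sup>+y. ?f y (r, r', v) * ?g y (r, r', v) ^ p \<partial>?P)
       = (\<integral>\<^sup>+y. fweight (y b) r r' v * ?B r r' v (y a) * ?H y \<partial>?P)"
      using True V unfolding gpart_def fst_conv snd_conv V_def[symmetric]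
      by (intro nn_integral_cong)
        (simp add: ennreal_power ennreal_mult[symmetric] power_mult_distrib power_divide mult_ac)
    also have "\<dots> = (\<integral>\<^sup>+yb. fweight yb r r' v \<partial>lborel) * (\<integral>\<^sup>+ya. ?B r r' v ya \<partial>lborel) * (\<integral>\<^sup>+y. ?H y \<partial>(\<Pi>\<^sub>M i\<in>S. lborel))"
      unfolding I_def
    proof (rule nn_integral_PiM_insert_insert[OF S])
      have "(\<lambda>y. iter_kernel q l' y v (T - r - r')) \<in> borel_measurable (\<Pi>\<^sub>M i\<in>S. (lborel :: (real ^ 'd) measure))"
        by (rule borel_measurable_iter_kernel[where I = S])
          (auto simp: S_def intro!: measurable_ident_sets sets_PiM_lborel)
      then show "?H \<in> borel_measurable (\<Pi>\<^sub>M i\<in>S. lborel)" by measurable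
    next
      fix y y' :: "'i \<Rightarrow> real ^ 'd" assume "\<And>i. i \<in> S \<Longrightarrow> y i = y' i"
      then have "iter_kernel q l' y v (T - r - r') = iter_kernel q l' y' v (T - r - r')"
        by (intro iter_kernel_cong) (auto simp: S_def)
      then show "?H y = ?H y'" by simp
    qed measurable
    also have "\<dots> \<le> (?W r r' * 2) * (\<integral>\<^sup>+ya. ?B r r' v ya \<partial>lborel) * ennreal (C * exp (lam * T) ^ p)"
    proof (intro mult_mono order_refl)
      show "(\<integral>\<^sup>+yb. fweight yb r r' v \<partial>lborel) \<le> ?W r r' * 2"
        using True q_mass_shift(2)[of v] unfolding fweight_def by (simp add: nn_integral_cmult mult_left_mono)
      have "(\<integral>\<^sup>+y. ?H y \<partial>(\<Pi>\<^sub>M i\<in>S. lborel))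
        = ennreal (exp (lam * (r + r')) ^ p) * (\<integral>\<^sup>+y. ennreal (\<bar>iter_kernel q l' y v (T - r - r')\<bar> ^ p) \<partial>(\<Pi>\<^sub>M i\<in>S. lborel))"
      proof (subst nn_integral_cmult[symmetric])
        have [measurable]: "(\<lambda>y. iter_kernel q l' y v (T - r - r')) \<in> borel_measurable (\<Pi>\<^sub>M i\<in>S. (lborel :: (real ^ 'd) measure))"
          by (rule borel_measurable_iter_kernel[where I = S])
            (auto simp: S_def intro!: measurable_ident_sets sets_PiM_lborel)
        show "(\<lambda>y. ennreal (\<bar>iter_kernel q l' y v (T - r - r')\<bar> ^ p)) \<in> borel_measurable (\<Pi>\<^sub>M i\<in>S. lborel)"
          by measurable
      qed (simp add: ennreal_mult)
      also have "\<dots> \<le> ennreal (exp (lam * (r + r')) ^ p) * ennreal ((m ^ n * exp (lam * (T - r - r'))) ^ p)"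
        unfolding S_def m_def using True Suc.prems l l' by (intro mult_left_mono Suc.IH) auto
      also have "\<dots> = ennreal (C * (exp (lam * (r + r')) * exp (lam * (T - r - r'))) ^ p)"
        using m by (simp add: ennreal_mult[symmetric] C_def power_mult_distrib mult_ac)
      \<comment> \<open>The weight inverted in \<open>gpart\<close> restores exactly the time used
        up by the pair.\<close>
      also have "exp (lam * (r + r')) * exp (lam * (T - r - r')) = exp (lam * T)"
        by (simp add: exp_add[symmetric] algebra_simps)
      finally show "(\<integral>\<^sup>+y. ?H y \<partial>(\<Pi>\<^sub>M i\<in>S. lborel)) \<le> ennreal (C * exp (lam * T) ^ p)" .
    qed auto
    finally show ?thesis using True by (simp add: mult_ac)
  next
    case False
    \<comment> \<open>Outside the time simplex \<open>gpart\<close> vanishes, and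
      \<open>0 ^ p = 0\<close> as \<open>p\<close> is positive. The right-hand side keeps the whole
      quadrant of times, whose weight is a product of two one-dimensional integrals.\<close>
    then have "?f y (r, r', v) * ?g y (r, r', v) ^ p = 0" for y
      using p1 by (auto simp: gpart_def)
    then show ?thesis by (simp del: mult_eq_0_iff)
  qed
  have Bint: "(\<integral>\<^sup>+v. \<integral>\<^sup>+ya. ?B r r' v ya \<partial>lborel \<partial>lborel) \<le> 1" if r: "0 < r" "0 < r'" for r r'
  proof -
    define V where "V = (\<kappa> * time_weight CARD('d) p r * time_weight CARD('d) p r') ^ p"
    have V: "0 < V" using r weight_pos by (simp add: V_def)
    have "(\<integral>\<^sup>+v. \<integral>\<^sup>+ya. ?B r r' v ya \<partial>lborel \<partial>lborel) = (\<integral>\<^sup>+ya. \<integral>\<^sup>+v. ?B r r' v ya \<partial>lborel \<partial>lborel)"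
      by (rule lborel_pair.Fubini') simp
    also have "\<dots> = (\<integral>\<^sup>+ya. \<integral>\<^sup>+v. ennreal (1 / V) * ennreal (\<bar>pair_kernel q r r' x ya v\<bar> ^ p) \<partial>lborel \<partial>lborel)"
      using V unfolding V_def[symmetric] by (simp add: ennreal_mult[symmetric])
    also have "\<dots> = ennreal (1 / V) * (\<integral>\<^sup>+ya. \<integral>\<^sup>+v. ennreal (\<bar>pair_kernel q r r' x ya v\<bar> ^ p) \<partial>lborel \<partial>lborel)"
      by (simp add: nn_integral_cmult)
    also have "\<dots> \<le> ennreal (1 / V) * ennreal V"
      unfolding V_def by (intro mult_left_mono pair_le r) auto
    also have "\<dots> = 1" using V by (simp add: ennreal_mult[symmetric])
    finally show ?thesis .
  qed
  have "(\<integral>\<^sup>+y. ennreal (\<bar>iter_kernel q l y x T\<bar> ^ p) \<partial>?P)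
      \<le> (\<integral>\<^sup>+y. ennreal m ^ (p - 1) * (\<integral>\<^sup>+z. ?f y z * ?g y z ^ p \<partial>?N) \<partial>?P)"
    by (intro nn_integral_mono pt)
  also have "\<dots> = ennreal m ^ (p - 1) * (\<integral>\<^sup>+y. \<integral>\<^sup>+z. ?f y z * ?g y z ^ p \<partial>?N \<partial>?P)"
  proof (rule nn_integral_cmult)
    show "(\<lambda>y. \<integral>\<^sup>+z. ?f y z * ?g y z ^ p \<partial>?N) \<in> borel_measurable ?P"
      using sigma_finite_measure.borel_measurable_nn_integral_fst[OF sfN, of "\<lambda>u. ?f (fst u) (snd u) * ?g (fst u) (snd u) ^ p" ?P]
      by simp
  qed
  also have "(\<integral>\<^sup>+y. \<integral>\<^sup>+z. ?f y z * ?g y z ^ p \<partial>?N \<partial>?P) = (\<integral>\<^sup>+z. \<integral>\<^sup>+y. ?f y z * ?g y z ^ p \<partial>?P \<partial>?N)"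
    by (rule PN.Fubini'[symmetric]) (simp add: case_prod_unfold)
  also have "\<dots> = (\<integral>\<^sup>+r. \<integral>\<^sup>+r'. \<integral>\<^sup>+v. \<integral>\<^sup>+y. ?f y (r, r', v) * ?g y (r, r', v) ^ p \<partial>?P \<partial>lborel \<partial>lborel \<partial>lborel)"
  proof (rule unfoldN)
    show "(\<lambda>z. \<integral>\<^sup>+y. ?f y z * ?g y z ^ p \<partial>?P) \<in> borel_measurable ?N"
    proof (rule PN.M1.borel_measurable_nn_integral)
      have sw: "(\<lambda>u. (snd u, fst u)) \<in> measurable (?N \<Otimes>\<^sub>M ?P) (?P \<Otimes>\<^sub>M ?N)" by measurable
      have "(\<lambda>u. ?f (fst u) (snd u) * ?g (fst u) (snd u) ^ p) \<in> borel_measurable (?P \<Otimes>\<^sub>M ?N)" by measurable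
      from measurable_compose[OF sw this]
      show "(\<lambda>(z, y). ?f y z * ?g y z ^ p) \<in> borel_measurable (?N \<Otimes>\<^sub>M ?P)"
        by (simp add: case_prod_unfold)
    qed
  qed
  also have "\<dots> \<le> (\<integral>\<^sup>+r. \<integral>\<^sup>+r'. \<integral>\<^sup>+v. (if 0 < r \<and> 0 < r' then ?W r r' else 0) * 2 * ennreal (C * exp (lam * T) ^ p) * (\<integral>\<^sup>+ya. ?B r r' v ya \<partial>lborel) \<partial>lborel \<partial>lborel \<partial>lborel)"
    by (intro nn_integral_mono inner)
  also have "\<dots> = (\<integral>\<^sup>+r. \<integral>\<^sup>+r'. (if 0 < r \<and> 0 < r' then ?W r r' else 0) * 2 * ennreal (C * exp (lam * T) ^ p) * (\<integral>\<^sup>+v. \<integral>\<^sup>+ya. ?B r r' v ya \<partial>lborel \<partial>lborel) \<partial>lborel \<partial>lborel)"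
    by (intro nn_integral_cong nn_integral_cmult) measurable
  also have "\<dots> \<le> (\<integral>\<^sup>+r. \<integral>\<^sup>+r'. (if 0 < r \<and> 0 < r' then ?W r r' else 0) * (2 * ennreal (C * exp (lam * T) ^ p)) \<partial>lborel \<partial>lborel)"
  proof (intro nn_integral_mono)
    fix r r'
    show "(if 0 < r \<and> 0 < r' then ?W r r' else 0) * 2 * ennreal (C * exp (lam * T) ^ p) * (\<integral>\<^sup>+v. \<integral>\<^sup>+ya. ?B r r' v ya \<partial>lborel \<partial>lborel)
      \<le> (if 0 < r \<and> 0 < r' then ?W r r' else 0) * (2 * ennreal (C * exp (lam * T) ^ p))"
      using mult_left_mono[OF Bint[of r r'], of "?W r r' * (2 * ennreal (C * exp (lam * T) ^ p))"]
      by (auto simp: mult.assoc)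
  qed
  also have "\<dots> = (\<integral>\<^sup>+r. \<integral>\<^sup>+r'. (if 0 < r \<and> 0 < r' then ?W r r' else 0) \<partial>lborel \<partial>lborel) * (2 * ennreal (C * exp (lam * T) ^ p))"
    by (simp add: nn_integral_multc)
  also have "\<dots> \<le> ennreal (\<kappa> * c\<^sup>2) * (2 * ennreal (C * exp (lam * T) ^ p))"
    by (intro mult_right_mono nn_integral_weight_le) auto
  also have "\<dots> = ennreal (m * (C * exp (lam * T) ^ p))"
    using kappa C unfolding m_def by (simp add: ennreal_mult' mult_ac)
  \<comment> \<open>Jensen contributes \<open>m ^ (p - 1)\<close> and the remaining integral of the
    weight one more \<open>m\<close>, which makes one \<open>m\<close> per pair under the
    \<open>p\<close>-th power.\<close>
  also have "ennreal m ^ (p - 1) * ennreal (m * (C * exp (lam * T) ^ p)) = ennreal (m ^ (p - 1) * m * (C * exp (lam * T) ^ p))"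
    using m C by (simp add: ennreal_power ennreal_mult[symmetric] mult_ac)
  also have "m ^ (p - 1) * m * (C * exp (lam * T) ^ p) = (m ^ Suc n * exp (lam * T)) ^ p"
    using p1 by (cases p) (auto simp: C_def power_mult_distrib mult_ac)
  finally show ?case
    unfolding setl m_def by (simp add: mult_left_mono)
qed

end

section \<open>Products of time integrals as sums over visiting orders\<close>

text \<open>The pathwise counterpart of \<open>iter_kernel\<close>, before the expectation. The
  upper end of the time interval is fixed and the lower end moves, since the Markov property is
  applied at the lower end.\<close>

primrec iter_integral :: "('i \<Rightarrow> real \<Rightarrow> real) \<Rightarrow> 'i list \<Rightarrow> real \<Rightarrow> real \<Rightarrow> real" where
  "iter_integral f [] s t = 1"
| "iter_integral f (a # l) s t = (\<integral>u. indicator {s..t} u * (f a u * iter_integral f l u t) \<partial>lborel)"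

lemma integrable_indicator_Icc: "integrable lborel (indicat_real {s..t :: real})"
  by (intro integrable_real_indicator) (auto simp: emeasure_lborel_Icc_eq)

lemma integrable_bounded_Icc:
  fixes g :: "real \<Rightarrow> real"
  assumes [measurable]: "g \<in> borel_measurable borel" and b: "\<And>u. s \<le> u \<Longrightarrow> u \<le> t \<Longrightarrow> \<bar>g u\<bar> \<le> B"
  shows "integrable lborel (\<lambda>u. indicator {s..t} u * g u)"
proof (rule Bochner_Integration.integrable_bound)
  show "integrable lborel (\<lambda>u. B * indicator {s..t} u)"
    using integrable_indicator_Icc by (rule integrable_mult_right)
  show "AE u in lborel. norm (indicator {s..t} u * g u) \<le> norm (B * indicator {s..t} u)"
    using b by (intro AE_I2) (auto simp: indicator_def intro!: order_trans[OF b abs_ge_self])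
qed measurable

lemma abs_integral_Icc_le:
  fixes g :: "real \<Rightarrow> real"
  assumes g: "g \<in> borel_measurable borel" and b: "\<And>u. s \<le> u \<Longrightarrow> u \<le> t \<Longrightarrow> \<bar>g u\<bar> \<le> B" and st: "s \<le> t"
  shows "\<bar>\<integral>u. indicator {s..t} u * g u \<partial>lborel\<bar> \<le> B * (t - s)"
proof -
  have "\<bar>\<integral>u. indicator {s..t} u * g u \<partial>lborel\<bar> \<le> (\<integral>u. \<bar>indicator {s..t} u * g u\<bar> \<partial>lborel)"
    by (rule integral_abs_bound)
  also have "\<dots> \<le> (\<integral>u. B * indicator {s..t} u \<partial>lborel)"
  proof (rule integral_mono)
    show "integrable lborel (\<lambda>u. \<bar>indicator {s..t} u * g u\<bar>)"
      using g b by (intro integrable_abs integrable_bounded_Icc) auto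
    show "integrable lborel (\<lambda>u. B * indicator {s..t} u)"
      using integrable_indicator_Icc by (rule integrable_mult_right)
    show "\<bar>indicator {s..t} u * g u\<bar> \<le> B * indicator {s..t} u" for u
      using b[of u] by (simp add: abs_mult indicator_def)
  qed
  also have "\<dots> = B * (t - s)" using st by simp
  finally show ?thesis .
qed

lemma borel_measurable_iter_integral_aux:
  assumes [measurable]: "\<And>a. a \<in> set l \<Longrightarrow> (\<lambda>(w, u). F a w u) \<in> borel_measurable (M \<Otimes>\<^sub>M borel)"
  shows "(\<lambda>x. iter_integral (\<lambda>a. F a (fst x)) l (snd x) t) \<in> borel_measurable (M \<Otimes>\<^sub>M borel)"
  using assms
proof (induction l)
  case (Cons a l)
  have F: "(\<lambda>x. F a (fst x) (snd x)) \<in> borel_measurable (M \<Otimes>\<^sub>M borel)"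
    using Cons.prems[of a] by (simp add: case_prod_unfold)
  have IH: "(\<lambda>x. iter_integral (\<lambda>a. F a (fst x)) l (snd x) t) \<in> borel_measurable (M \<Otimes>\<^sub>M borel)"
    using Cons by auto
  have m: "(\<lambda>z. (fst (fst z), snd z)) \<in> measurable ((M \<Otimes>\<^sub>M borel) \<Otimes>\<^sub>M lborel) (M \<Otimes>\<^sub>M (borel :: real measure))"
    by measurable
  have [measurable]: "(\<lambda>z. F a (fst (fst z)) (snd z)) \<in> borel_measurable ((M \<Otimes>\<^sub>M (borel :: real measure)) \<Otimes>\<^sub>M lborel)"
    "(\<lambda>z. iter_integral (\<lambda>a. F a (fst (fst z))) l (snd z) t) \<in> borel_measurable ((M \<Otimes>\<^sub>M (borel :: real measure)) \<Otimes>\<^sub>M lborel)"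
    using measurable_compose[OF m F] measurable_compose[OF m IH] by simp_all
  have ind: "indicator {snd x..t} u = (if snd x \<le> u \<and> u \<le> t then 1 else 0 :: real)" for x :: "_ \<times> real" and u
    by (simp add: indicator_def)
  show ?case
    unfolding iter_integral.simps ind by measurable
qed simp

lemma borel_measurable_iter_integral:
  assumes "\<And>a. a \<in> set l \<Longrightarrow> f a \<in> borel_measurable borel"
  shows "(\<lambda>u. iter_integral f l u t) \<in> borel_measurable borel"
proof -
  have "(\<lambda>x. iter_integral (\<lambda>a. f a) l (snd x) t) \<in> borel_measurable (count_space {()} \<Otimes>\<^sub>M borel)"
  proof (rule borel_measurable_iter_integral_aux)
    fix a assume "a \<in> set l"
    then have [measurable]: "f a \<in> borel_measurable borel" by (rule assms)
    show "(\<lambda>(w :: unit, u). f a u) \<in> borel_measurable (count_space {()} \<Otimes>\<^sub>M borel)" by measurable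
  qed
  from measurable_compose[OF _ this, of "\<lambda>u. ((), u)" borel] show ?thesis by simp
qed

lemma abs_iter_integral_le:
  assumes m: "\<And>a. a \<in> set l \<Longrightarrow> f a \<in> borel_measurable borel"
    and K: "\<And>a u. a \<in> set l \<Longrightarrow> \<bar>f a u\<bar> \<le> K" and K0: "0 \<le> K"
  shows "s \<le> t \<Longrightarrow> \<bar>iter_integral f l s t\<bar> \<le> (K * (t - s)) ^ length l"
  using m K
proof (induction l arbitrary: s)
  case (Cons a l)
  have [measurable]: "f a \<in> borel_measurable borel" "(\<lambda>u. iter_integral f l u t) \<in> borel_measurable borel"
    using Cons.prems by (auto intro: borel_measurable_iter_integral)
  have "\<bar>iter_integral f (a # l) s t\<bar> \<le> (K * (K * (t - s)) ^ length l) * (t - s)"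
    unfolding iter_integral.simps
  proof (rule abs_integral_Icc_le)
    fix u assume u: "s \<le> u" "u \<le> t"
    have "\<bar>iter_integral f l u t\<bar> \<le> (K * (t - u)) ^ length l" using Cons u by auto
    also have "\<dots> \<le> (K * (t - s)) ^ length l" using u K0 by (intro power_mono mult_left_mono) auto
    finally show "\<bar>f a u * iter_integral f l u t\<bar> \<le> K * (K * (t - s)) ^ length l"
      unfolding abs_mult using Cons.prems K0 by (intro mult_mono) auto
  qed (use Cons.prems in measurable)
  then show ?case by (simp add: mult_ac)
qed simp

text \<open>Differentiating the product of the integrals over \<open>[s, t]\<close> in \<open>s\<close> singles out the point
  that is visited first.\<close>

lemma prod_integral_eq_sum_iter_integral:
  fixes f :: "'i \<Rightarrow> real \<Rightarrow> real"
  assumes "finite A" and cont: "\<And>a. a \<in> A \<Longrightarrow> continuous_on UNIV (f a)"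
    and K: "\<And>a u. a \<in> A \<Longrightarrow> \<bar>f a u\<bar> \<le> K" and K0: "0 \<le> K" and "s \<le> t"
  shows "(\<Prod>a\<in>A. \<integral>u. indicator {s..t} u * f a u \<partial>lborel) = (\<Sum>l\<in>permutations_of_set A. iter_integral f l s t)"
  using assms(1) cont K \<open>s \<le> t\<close>
proof (induction A arbitrary: s rule: finite_psubset_induct)
  case (psubset A)
  show ?case
  proof (cases "A = {}")
    case False
    have meas: "f a \<in> borel_measurable borel" if "a \<in> A" for a
      using psubset.prems that by (intro borel_measurable_continuous_onI) auto
    \<comment> \<open>Antiderivatives on the whole line have two-sided derivatives at the end points
      too, so that the product rule applies everywhere.\<close>
    have "\<exists>G. \<forall>x. DERIV G x :> f a x" if "a \<in> A" for a
      using einterval_antiderivative[of "-\<infinity>" "\<infinity>" "f a"] psubset.prems(1)[OF that]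
      by (auto simp: continuous_on_eq_continuous_at has_real_derivative_iff_has_vector_derivative)
    then obtain G where G: "\<And>a x. a \<in> A \<Longrightarrow> DERIV (G a) x :> f a x" by metis
    have isC: "isCont (f a) x" if "a \<in> A" for a x
      using psubset.prems(1)[OF that] by (simp add: continuous_on_eq_continuous_at)
    have Fint: "(\<integral>u. indicator {v..t} u * f a u \<partial>lborel) = G a t - G a v" if "a \<in> A" "v \<le> t" for a v
      using integral_FTC_Icc_real[of v t "G a" "f a"] that G isC by (simp add: mult.commute)
    define P where "P v = (\<Prod>a\<in>A. G a t - G a v)" for v
    define P' where "P' v = (\<Sum>a\<in>A. f a v * (\<Prod>b\<in>A - {a}. G b t - G b v))" for v
    have DP: "DERIV P v :> - P' v" for v
    proof -
      have "DERIV (\<lambda>v. \<Prod>a\<in>A. G a t - G a v) v :> (\<Sum>a\<in>A. (0 - f a v) * (\<Prod>b\<in>A - {a}. G b t - G b v))"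
        by (intro has_field_derivative_prod derivative_intros G)
      then show ?thesis unfolding P_def P'_def by (simp add: sum_negf)
    qed
    have "(\<integral>u. - P' u * indicator {s..t} u \<partial>lborel) = P t - P s"
    proof (rule integral_FTC_Icc_real)
      fix x
      have "isCont (G a) x" if "a \<in> A" for a using G[OF that] by (rule DERIV_isCont)
      then show "isCont (\<lambda>u. - P' u) x"
        unfolding P'_def by (intro continuous_intros isC) auto
    qed (use DP psubset.prems in auto)
    \<comment> \<open>At the upper end all factors vanish, and there is at least one.\<close>
    moreover have "P t = 0" using False psubset.hyps by (auto simp: P_def)
    ultimately have Ps: "P s = (\<integral>u. indicator {s..t} u * P' u \<partial>lborel)"
      by (simp add: mult.commute)
    have perm: "(\<Prod>b\<in>A - {a}. G b t - G b u) = (\<Sum>l\<in>permutations_of_set (A - {a}). iter_integral f l u t)"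
      if "a \<in> A" "u \<le> t" for a u
    proof -
      have "(\<Prod>b\<in>A - {a}. G b t - G b u) = (\<Prod>b\<in>A - {a}. \<integral>v. indicator {u..t} v * f b v \<partial>lborel)"
        using that by (intro prod.cong) (auto simp: Fint)
      also have "\<dots> = (\<Sum>l\<in>permutations_of_set (A - {a}). iter_integral f l u t)"
        using psubset.prems that by (intro psubset.IH) auto
      finally show ?thesis .
    qed
    have int: "integrable lborel (\<lambda>u. indicator {s..t} u * (f a u * iter_integral f l u t))"
      if a: "a \<in> A" and l: "l \<in> permutations_of_set (A - {a})" for a l
    proof (rule integrable_bounded_Icc)
      have sl: "set l \<subseteq> A" using l by (auto dest: permutations_of_setD)
      have "(\<lambda>u. iter_integral f l u t) \<in> borel_measurable borel"
        using sl meas by (intro borel_measurable_iter_integral) auto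
      then show "(\<lambda>u. f a u * iter_integral f l u t) \<in> borel_measurable borel"
        using meas[OF a] by measurable
      fix u assume u: "s \<le> u" "u \<le> t"
      have "\<bar>iter_integral f l u t\<bar> \<le> (K * (t - u)) ^ length l"
        using sl meas psubset.prems(2) u by (intro abs_iter_integral_le K0) auto
      also have "\<dots> \<le> (K * (t - s)) ^ length l" using u K0 by (intro power_mono mult_left_mono) auto
      finally show "\<bar>f a u * iter_integral f l u t\<bar> \<le> K * (K * (t - s)) ^ length l"
        unfolding abs_mult using psubset.prems(2)[OF a] K0 by (intro mult_mono) auto
    qed
    have "(\<Prod>a\<in>A. \<integral>u. indicator {s..t} u * f a u \<partial>lborel) = P s"
      unfolding P_def using psubset.prems by (intro prod.cong) (auto simp: Fint)
    also have "\<dots> = (\<integral>u. (\<Sum>a\<in>A. \<Sum>l\<in>permutations_of_set (A - {a}). indicator {s..t} u * (f a u * iter_integral f l u t)) \<partial>lborel)"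
      unfolding Ps P'_def using perm
      by (intro Bochner_Integration.integral_cong refl)
        (auto simp: indicator_def sum_distrib_left intro!: sum.cong)
    also have "\<dots> = (\<Sum>a\<in>A. \<integral>u. (\<Sum>l\<in>permutations_of_set (A - {a}). indicator {s..t} u * (f a u * iter_integral f l u t)) \<partial>lborel)"
      by (intro Bochner_Integration.integral_sum Bochner_Integration.integrable_sum int)
    also have "\<dots> = (\<Sum>a\<in>A. \<Sum>l\<in>permutations_of_set (A - {a}). iter_integral f (a # l) s t)"
      unfolding iter_integral.simps
      by (intro sum.cong refl Bochner_Integration.integral_sum int)
    also have "\<dots> = (\<Sum>a\<in>A. \<Sum>l\<in>(#) a ` permutations_of_set (A - {a}). iter_integral f l s t)"
      by (rule sum.cong[OF refl]) (simp add: sum.reindex inj_on_def)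
    also have "\<dots> = (\<Sum>l\<in>(\<Union>a\<in>A. (#) a ` permutations_of_set (A - {a})). iter_integral f l s t)"
      using psubset.hyps by (intro sum.UNION_disjoint[symmetric]) auto
    also have "(\<Union>a\<in>A. (#) a ` permutations_of_set (A - {a})) = permutations_of_set A"
      using False by (simp add: permutations_of_set_nonempty)
    finally show ?thesis .
  qed simp
qed

section \<open>Brownian motion with everywhere continuous paths\<close>

text \<open>The path is the limit of its values at the grid points below \<open>s\<close>. For each
  mesh there are countably many grid points, so the approximations are jointly measurable.\<close>

lemma joint_measurable_continuous_path:
  fixes V :: "real \<Rightarrow> 'w \<Rightarrow> 'b::metric_space"
  assumes V_measurable [measurable]: "\<And>s. V s \<in> borel_measurable M"
    and V_continuous: "\<And>\<omega>. continuous_on UNIV (\<lambda>s. V s \<omega>)"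
  shows "(\<lambda>x. V (snd x) (fst x)) \<in> borel_measurable (M \<Otimes>\<^sub>M borel)"
proof (rule borel_measurable_LIMSEQ_metric)
  fix n :: nat
  have "(\<lambda>x. (\<lambda>k x. V (real_of_int k / real (Suc n)) (fst x)) \<lfloor>real (Suc n) * snd x\<rfloor> x)
      \<in> borel_measurable (M \<Otimes>\<^sub>M borel)"
    by (rule measurable_compose_countable) measurable
  then show "(\<lambda>x. V (real_of_int \<lfloor>real (Suc n) * snd x\<rfloor> / real (Suc n)) (fst x)) \<in> borel_measurable (M \<Otimes>\<^sub>M borel)"
    by simp
next
  fix x :: "'w \<times> real"
  have "(\<lambda>n. real_of_int \<lfloor>real (Suc n) * snd x\<rfloor> / real (Suc n)) \<longlonglongrightarrow> snd x"
  proof (rule tendsto_sandwich)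
    show "(\<lambda>n. snd x - inverse (real (Suc n))) \<longlonglongrightarrow> snd x"
      using tendsto_diff[OF tendsto_const LIMSEQ_inverse_real_of_nat, of "snd x"] by simp
    show "(\<lambda>n. snd x) \<longlonglongrightarrow> snd x" by simp
    show "\<forall>\<^sub>F n in sequentially. snd x - inverse (real (Suc n)) \<le> real_of_int \<lfloor>real (Suc n) * snd x\<rfloor> / real (Suc n)"
    proof (intro always_eventually allI)
      fix n
      have "real (Suc n) * snd x - 1 \<le> real_of_int \<lfloor>real (Suc n) * snd x\<rfloor>" by linarith
      then have "(real (Suc n) * snd x - 1) / real (Suc n) \<le> real_of_int \<lfloor>real (Suc n) * snd x\<rfloor> / real (Suc n)"
        by (intro divide_right_mono) auto
      then show "snd x - inverse (real (Suc n)) \<le> real_of_int \<lfloor>real (Suc n) * snd x\<rfloor> / real (Suc n)"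
        by (simp add: diff_divide_distrib inverse_eq_divide)
    qed
    show "\<forall>\<^sub>F n in sequentially. real_of_int \<lfloor>real (Suc n) * snd x\<rfloor> / real (Suc n) \<le> snd x"
    proof (intro always_eventually allI)
      fix n
      have "real_of_int \<lfloor>real (Suc n) * snd x\<rfloor> / real (Suc n) \<le> (real (Suc n) * snd x) / real (Suc n)"
        by (intro divide_right_mono) auto
      then show "real_of_int \<lfloor>real (Suc n) * snd x\<rfloor> / real (Suc n) \<le> snd x" by simp
    qed
  qed
  then show "(\<lambda>n. V (real_of_int \<lfloor>real (Suc n) * snd x\<rfloor> / real (Suc n)) (fst x)) \<longlonglongrightarrow> V (snd x) (fst x)"
    using V_continuous[of "fst x"] by (intro isCont_tendsto_compose[of _ "\<lambda>s. V s (fst x)"])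
      (auto simp: continuous_on_eq_continuous_at)
qed

lemma lborel_integral_shift:
  fixes f :: "'a::euclidean_space \<Rightarrow> real"
  assumes [measurable]: "f \<in> borel_measurable borel"
  shows "(\<integral>x. f (x + c) \<partial>lborel) = (\<integral>x. f x \<partial>lborel)"
proof -
  have "(\<integral>x. f x \<partial>lborel) = (\<integral>x. f x \<partial>distr lborel borel ((+) c))"
    by (simp add: lborel_distr_plus)
  also have "\<dots> = (\<integral>x. f (c + x) \<partial>lborel)"
    by (subst integral_distr) auto
  finally show ?thesis by (simp add: add.commute)
qed

section \<open>Markov property along products of functions of the path\<close>

text \<open>Continuity without exceptional outcomes makes integrals along the path measurable
  everywhere. Independence is stated as a product law for the past increments and the next one, the
  form in which Fubini's theorem applies; \<open>\<tau> n < r\<close> makes the last increment have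
  a density.\<close>

locale continuous_brownian_motion = prob_space M for M :: "'w measure" +
  fixes V :: "real \<Rightarrow> 'w \<Rightarrow> real ^ 'd"
  assumes V_measurable [measurable]: "\<And>s. V s \<in> borel_measurable M"
    and V_continuous: "\<And>\<omega>. continuous_on UNIV (\<lambda>s. V s \<omega>)"
    and V_0: "\<And>\<omega>. V 0 \<omega> = 0"
    and V_indep: "\<And>n \<tau> r. 0 \<le> \<tau> 0 \<Longrightarrow> (\<And>i. i < n \<Longrightarrow> \<tau> i \<le> \<tau> (Suc i)) \<Longrightarrow> \<tau> n < r \<Longrightarrow>
      distr M (\<Pi>\<^sub>M i\<in>{..<n}. borel) (\<lambda>\<omega>. \<lambda>i\<in>{..<n}. V (\<tau> (Suc i)) \<omega> - V (\<tau> i) \<omega>)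
          \<Otimes>\<^sub>M distr M borel (\<lambda>\<omega>. V r \<omega> - V (\<tau> n) \<omega>)
        = distr M ((\<Pi>\<^sub>M i\<in>{..<n}. borel) \<Otimes>\<^sub>M borel)
            (\<lambda>\<omega>. (\<lambda>i\<in>{..<n}. V (\<tau> (Suc i)) \<omega> - V (\<tau> i) \<omega>, V r \<omega> - V (\<tau> n) \<omega>))"
    and V_distr: "\<And>s r. 0 \<le> s \<Longrightarrow> s < r \<Longrightarrow>
      distributed M lborel (\<lambda>\<omega>. V r \<omega> - V s \<omega>) (\<lambda>x. ennreal (heat_kernel (r - s) x))"
begin

lemma V_joint_measurable: "(\<lambda>x. V (snd x) (fst x)) \<in> borel_measurable (M \<Otimes>\<^sub>M borel)"
  by (rule joint_measurable_continuous_path[OF V_measurable V_continuous])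

lemma V_measurable_compose [measurable]:
  assumes "s \<in> borel_measurable N" "w \<in> measurable N M"
  shows "(\<lambda>x. V (s x) (w x)) \<in> borel_measurable N"
  using measurable_compose[OF _ V_joint_measurable, of "\<lambda>x. (w x, s x)" N] assms by simp

text \<open>A finite-dimensional substitute for measurability with respect to the past up to
  \<open>s\<close>. It suffices because only products of functions of finitely many positions are
  collected. As the times start at 0, positions are sums of the increments.\<close>

definition adapted :: "real \<Rightarrow> ('w \<Rightarrow> real) \<Rightarrow> bool" where
  "adapted s Z \<longleftrightarrow> (\<exists>n \<tau> g. \<tau> 0 = 0 \<and> (\<forall>i<n. \<tau> i \<le> \<tau> (Suc i)) \<and> \<tau> n = s \<and>
     g \<in> borel_measurable (\<Pi>\<^sub>M i\<in>{..<n}. borel) \<and>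
     Z = (\<lambda>\<omega>. g (\<lambda>i\<in>{..<n}. V (\<tau> (Suc i)) \<omega> - V (\<tau> i) \<omega>)))"

lemma adapted_const: "adapted 0 (\<lambda>_. c)"
  unfolding adapted_def by (intro exI[of _ 0] exI[of _ "\<lambda>_. 0"] exI[of _ "\<lambda>_. c"]) auto

lemma adapted_measurable: "adapted s Z \<Longrightarrow> Z \<in> borel_measurable M"
proof -
  assume "adapted s Z"
  then obtain n \<tau> g where g: "g \<in> borel_measurable (\<Pi>\<^sub>M i\<in>{..<n}. borel)"
    and Z: "Z = (\<lambda>\<omega>. g (\<lambda>i\<in>{..<n}. V (\<tau> (Suc i)) \<omega> - V (\<tau> i) \<omega>))"
    unfolding adapted_def by blast
  show ?thesis unfolding Z
    by (rule measurable_compose[OF _ g]) (intro measurable_restrict, measurable)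
qed

lemma V_eq_sum: "\<tau> 0 = 0 \<Longrightarrow> V (\<tau> n) \<omega> = (\<Sum>i<n. V (\<tau> (Suc i)) \<omega> - V (\<tau> i) \<omega>)"
  by (simp add: sum_lessThan_telescope[of "\<lambda>i. V (\<tau> i) \<omega>"] V_0)

text \<open>One more time \<open>r\<close> is appended; \<open>V r\<close> is the sum of all
  increments up to it.\<close>

lemma adapted_mult:
  assumes Z: "adapted s Z" and r: "s \<le> r" and \<phi>[measurable]: "\<phi> \<in> borel_measurable borel"
  shows "adapted r (\<lambda>\<omega>. Z \<omega> * \<phi> (V r \<omega>))"
proof -
  from Z obtain n \<tau> g where \<tau>: "\<tau> 0 = 0" "\<And>i. i < n \<Longrightarrow> \<tau> i \<le> \<tau> (Suc i)" "\<tau> n = s"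
    and g: "g \<in> borel_measurable (\<Pi>\<^sub>M i\<in>{..<n}. borel)"
    and Zeq: "Z = (\<lambda>\<omega>. g (\<lambda>i\<in>{..<n}. V (\<tau> (Suc i)) \<omega> - V (\<tau> i) \<omega>))"
    unfolding adapted_def by blast
  define \<tau>' where "\<tau>' = \<tau>(Suc n := r)"
  define g' where "g' x = g (restrict x {..<n}) * \<phi> (\<Sum>i<Suc n. x i)" for x
  show ?thesis
    unfolding adapted_def
  proof (intro exI[of _ "Suc n"] exI[of _ \<tau>'] exI[of _ g'] conjI allI impI)
    have m1: "(\<lambda>x. g (restrict x {..<n})) \<in> borel_measurable (\<Pi>\<^sub>M i\<in>{..<Suc n}. borel)"
      by (rule measurable_compose[OF measurable_restrict_subset g]) auto
    have "(\<lambda>x. \<Sum>i<Suc n. x i) \<in> borel_measurable (\<Pi>\<^sub>M i\<in>{..<Suc n}. (borel :: (real ^ 'd) measure))"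
      by (intro borel_measurable_sum measurable_component_singleton) auto
    with m1 show "g' \<in> borel_measurable (\<Pi>\<^sub>M i\<in>{..<Suc n}. borel)"
      unfolding g'_def by measurable
    show "(\<lambda>\<omega>. Z \<omega> * \<phi> (V r \<omega>)) = (\<lambda>\<omega>. g' (\<lambda>i\<in>{..<Suc n}. V (\<tau>' (Suc i)) \<omega> - V (\<tau>' i) \<omega>))"
    proof
      fix \<omega>
      have "restrict (\<lambda>i\<in>{..<Suc n}. V (\<tau>' (Suc i)) \<omega> - V (\<tau>' i) \<omega>) {..<n} = (\<lambda>i\<in>{..<n}. V (\<tau> (Suc i)) \<omega> - V (\<tau> i) \<omega>)"
        by (auto simp: \<tau>'_def restrict_def)
      moreover have "(\<Sum>i<Suc n. (\<lambda>i\<in>{..<Suc n}. V (\<tau>' (Suc i)) \<omega> - V (\<tau>' i) \<omega>) i) = V (\<tau>' (Suc n)) \<omega>"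
        using V_eq_sum[of \<tau>' "Suc n" \<omega>] \<tau> by (simp add: \<tau>'_def)
      ultimately show "Z \<omega> * \<phi> (V r \<omega>) = g' (\<lambda>i\<in>{..<Suc n}. V (\<tau>' (Suc i)) \<omega> - V (\<tau>' i) \<omega>)"
        unfolding g'_def Zeq by (simp add: \<tau>'_def)
    qed
  qed (use \<tau> r in \<open>auto simp: \<tau>'_def less_Suc_eq\<close>)
qed

text \<open>The Markov property for one step: \<open>V r\<close> is \<open>V s\<close> plus an
  increment independent of the data of \<open>Z\<close>, and integrating over that increment
  produces the transition density.\<close>

lemma expectation_adapted_step:
  assumes Z: "adapted s Z" and ZC: "\<And>\<omega>. \<bar>Z \<omega>\<bar> \<le> C" and s: "0 \<le> s" "s < r"
    and \<psi>[measurable]: "\<psi> \<in> borel_measurable borel" and \<psi>B: "\<And>x. \<bar>\<psi> x\<bar> \<le> B"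
  shows "expectation (\<lambda>\<omega>. Z \<omega> * \<psi> (V r \<omega>))
    = expectation (\<lambda>\<omega>. Z \<omega> * (\<integral>z. heat_kernel (r - s) (z - V s \<omega>) * \<psi> z \<partial>lborel))"
proof -
  from Z obtain n \<tau> g where \<tau>: "\<tau> 0 = 0" "\<And>i. i < n \<Longrightarrow> \<tau> i \<le> \<tau> (Suc i)" "\<tau> n = s"
    and g[measurable]: "g \<in> borel_measurable (\<Pi>\<^sub>M i\<in>{..<n}. borel)"
    and Zeq: "Z = (\<lambda>\<omega>. g (\<lambda>i\<in>{..<n}. V (\<tau> (Suc i)) \<omega> - V (\<tau> i) \<omega>))"
    unfolding adapted_def by blast
  have C0: "0 \<le> C" using ZC[of undefined] by linarith
  \<comment> \<open>The function \<open>g\<close> is known to be bounded only on the increments that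
    occur; clipping makes it bounded on the whole product space and does not change
    \<open>Z\<close>.\<close>
  define g' where "g' x = max (- C) (min C (g x))" for x
  have g'_meas[measurable]: "g' \<in> borel_measurable (\<Pi>\<^sub>M i\<in>{..<n}. borel)" unfolding g'_def by measurable
  have g'C: "\<bar>g' x\<bar> \<le> C" for x using C0 by (auto simp: g'_def)
  define X where "X \<omega> = (\<lambda>i\<in>{..<n}. V (\<tau> (Suc i)) \<omega> - V (\<tau> i) \<omega>)" for \<omega>
  define Y where "Y \<omega> = V r \<omega> - V s \<omega>" for \<omega>
  let ?S = "\<Pi>\<^sub>M i\<in>{..<n}. (borel :: (real ^ 'd) measure)"
  have Zg': "Z \<omega> = g' (X \<omega>)" for \<omega>
    using ZC[of \<omega>] unfolding Zeq g'_def X_def by (auto simp: abs_le_iff)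
  have X_meas[measurable]: "X \<in> measurable M ?S"
    unfolding X_def by (intro measurable_restrict) measurable
  have Y_meas[measurable]: "Y \<in> borel_measurable M" unfolding Y_def by measurable
  have joint: "distr M ?S X \<Otimes>\<^sub>M distr M borel Y = distr M (?S \<Otimes>\<^sub>M borel) (\<lambda>\<omega>. (X \<omega>, Y \<omega>))"
    unfolding X_def Y_def using V_indep[of \<tau> n r] \<tau> s by auto
  interpret DX: prob_space "distr M ?S X" by (rule prob_space_distr) measurable
  interpret DY: prob_space "distr M borel Y" by (rule prob_space_distr) measurable
  interpret DXY: pair_prob_space "distr M ?S X" "distr M borel Y" ..
  have sum_meas[measurable]: "(\<lambda>x. \<Sum>i<n. x i) \<in> borel_measurable ?S"
    by (intro borel_measurable_sum measurable_component_singleton) auto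
  have Vs: "V s \<omega> = (\<Sum>i<n. X \<omega> i)" for \<omega>
    using V_eq_sum[of \<tau> n \<omega>] \<tau> by (simp add: X_def)
  have Vr: "V r \<omega> = (\<Sum>i<n. X \<omega> i) + Y \<omega>" for \<omega>
    using Vs by (simp add: Y_def)
  have B0: "0 \<le> B" using \<psi>B[of 0] by linarith
  have int: "integrable (distr M ?S X \<Otimes>\<^sub>M distr M borel Y) (\<lambda>(x, y). g' x * \<psi> ((\<Sum>i<n. x i) + y))"
  proof (rule DXY.P.integrable_const_bound[of _ "C * B"])
    show "AE z in distr M ?S X \<Otimes>\<^sub>M distr M borel Y. norm (case z of (x, y) \<Rightarrow> g' x * \<psi> ((\<Sum>i<n. x i) + y)) \<le> C * B"
      using g'C \<psi>B C0 by (intro AE_I2) (auto simp: abs_mult intro!: mult_mono)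
  qed measurable
  have "expectation (\<lambda>\<omega>. Z \<omega> * \<psi> (V r \<omega>)) = expectation (\<lambda>\<omega>. (\<lambda>(x, y). g' x * \<psi> ((\<Sum>i<n. x i) + y)) (X \<omega>, Y \<omega>))"
    by (simp add: Zg' Vr)
  also have "\<dots> = (\<integral>z. (\<lambda>(x, y). g' x * \<psi> ((\<Sum>i<n. x i) + y)) z \<partial>distr M (?S \<Otimes>\<^sub>M borel) (\<lambda>\<omega>. (X \<omega>, Y \<omega>)))"
    by (rule integral_distr[symmetric]) measurable
  also have "\<dots> = (\<integral>x. \<integral>y. g' x * \<psi> ((\<Sum>i<n. x i) + y) \<partial>distr M borel Y \<partial>distr M ?S X)"
    unfolding joint[symmetric] using DXY.integral_fst[OF int] by simp
  also have "\<dots> = (\<integral>x. g' x * (\<integral>z. heat_kernel (r - s) (z - (\<Sum>i<n. x i)) * \<psi> z \<partial>lborel) \<partial>distr M ?S X)"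
  proof (intro Bochner_Integration.integral_cong refl)
    fix x :: "nat \<Rightarrow> real ^ 'd"
    have "(\<integral>y. \<psi> ((\<Sum>i<n. x i) + y) \<partial>distr M borel Y) = expectation (\<lambda>\<omega>. \<psi> ((\<Sum>i<n. x i) + Y \<omega>))"
      by (rule integral_distr) measurable
    also have "\<dots> = (\<integral>z. heat_kernel (r - s) z * \<psi> ((\<Sum>i<n. x i) + z) \<partial>lborel)"
      unfolding Y_def using V_distr[OF s] by (intro distributed_integral[symmetric]) auto
    also have "\<dots> = (\<integral>z. heat_kernel (r - s) (z - (\<Sum>i<n. x i)) * \<psi> z \<partial>lborel)"
      using lborel_integral_shift[of "\<lambda>z. heat_kernel (r - s) (z - (\<Sum>i<n. x i)) * \<psi> z" "\<Sum>i<n. x i"]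
      by (simp add: add.commute)
    finally show "(\<integral>y. g' x * \<psi> ((\<Sum>i<n. x i) + y) \<partial>distr M borel Y) = g' x * (\<integral>z. heat_kernel (r - s) (z - (\<Sum>i<n. x i)) * \<psi> z \<partial>lborel)"
      by simp
  qed
  also have "\<dots> = expectation (\<lambda>\<omega>. g' (X \<omega>) * (\<integral>z. heat_kernel (r - s) (z - (\<Sum>i<n. X \<omega> i)) * \<psi> z \<partial>lborel))"
    by (rule integral_distr) measurable
  finally show ?thesis by (simp add: Zg' Vs)
qed

lemma integrable_bounded_Icc_pair:
  fixes g :: "'w \<times> real \<Rightarrow> real"
  assumes [measurable]: "g \<in> borel_measurable (M \<Otimes>\<^sub>M lborel)"
    and b: "\<And>\<omega> u. \<bar>g (\<omega>, u)\<bar> \<le> B * indicator {s..t} u"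
  shows "integrable (M \<Otimes>\<^sub>M lborel) g"
proof (rule integrableI_bounded)
  have "(\<integral>\<^sup>+z. ennreal (norm (g z)) \<partial>(M \<Otimes>\<^sub>M lborel)) = (\<integral>\<^sup>+\<omega>. \<integral>\<^sup>+u. ennreal \<bar>g (\<omega>, u)\<bar> \<partial>lborel \<partial>M)"
    by (subst lborel.nn_integral_fst[symmetric]) auto
  also have "\<dots> \<le> (\<integral>\<^sup>+\<omega>. \<integral>\<^sup>+u. ennreal (B * indicator {s..t} u) \<partial>lborel \<partial>M)"
    by (intro nn_integral_mono ennreal_leI b)
  also have "\<dots> = (\<integral>\<^sup>+u. ennreal (B * indicator {s..t} u) \<partial>lborel)"
    by (simp add: emeasure_space_1)
  also have "\<dots> \<le> (\<integral>\<^sup>+u. ennreal \<bar>B\<bar> * indicator {s..t} u \<partial>lborel)"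
    by (intro nn_integral_mono) (auto simp: indicator_def intro!: ennreal_leI)
  also have "\<dots> = ennreal \<bar>B\<bar> * emeasure lborel {s..t}"
    by (simp add: nn_integral_cmult_indicator)
  also have "\<dots> < \<infinity>"
    by (simp add: ennreal_mult_less_top emeasure_lborel_Icc_eq)
  finally show "(\<integral>\<^sup>+z. ennreal (norm (g z)) \<partial>(M \<Otimes>\<^sub>M lborel)) < \<infinity>" .
qed measurable

lemma path_iter_integral_measurable:
  fixes q :: "real ^ 'd \<Rightarrow> real"
  assumes [measurable]: "q \<in> borel_measurable borel"
  shows "(\<lambda>x. iter_integral (\<lambda>a u. q (V u (fst x) - y a)) l (snd x) t) \<in> borel_measurable (M \<Otimes>\<^sub>M borel)"
  using borel_measurable_iter_integral_aux[of l "\<lambda>a \<omega> u. q (V u \<omega> - y a)" M t] by simp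

lemma path_iter_integral_le:
  fixes q :: "real ^ 'd \<Rightarrow> real"
  assumes [measurable]: "q \<in> borel_measurable borel" and K: "\<And>x. \<bar>q x\<bar> \<le> K" and st: "s \<le> t"
  shows "\<bar>iter_integral (\<lambda>a u. q (V u \<omega> - y a)) l s t\<bar> \<le> (K * (t - s)) ^ length l"
proof (rule abs_iter_integral_le)
  have "(\<lambda>u. V u \<omega>) \<in> borel_measurable borel"
    using V_continuous by (intro borel_measurable_continuous_onI)
  then show "(\<lambda>u. q (V u \<omega> - y a)) \<in> borel_measurable borel" for a by measurable
  show "0 \<le> K" using K[of 0] by linarith
qed (use K st in auto)

text \<open>The Markov property is applied at the successive times, \<open>Z\<close> collecting the factors of the points
  already visited.\<close>

lemma expectation_adapted_iter_integral:
  fixes q :: "real ^ 'd \<Rightarrow> real"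
  assumes q[measurable]: "q \<in> borel_measurable borel" and K: "\<And>x. \<bar>q x\<bar> \<le> K"
  shows "adapted s Z \<Longrightarrow> (\<And>\<omega>. \<bar>Z \<omega>\<bar> \<le> C) \<Longrightarrow> 0 \<le> s \<Longrightarrow> s \<le> t \<Longrightarrow>
    expectation (\<lambda>\<omega>. Z \<omega> * iter_integral (\<lambda>a u. q (V u \<omega> - y a)) l s t)
      = expectation (\<lambda>\<omega>. Z \<omega> * iter_kernel q l y (V s \<omega>) (t - s))"
proof (induction l arbitrary: s Z C)
  case (Cons a l)
  interpret P: pair_sigma_finite M lborel ..
  have Z[measurable]: "Z \<in> borel_measurable M" using Cons.prems by (intro adapted_measurable)
  have K0: "0 \<le> K" using K[of 0] by linarith
  have C0: "0 \<le> C" using Cons.prems(2)[of undefined] by linarith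
  define II where "II \<omega> u = iter_integral (\<lambda>a u. q (V u \<omega> - y a)) l u t" for \<omega> u
  have II_meas[measurable]: "(\<lambda>x. II (fst x) (snd x)) \<in> borel_measurable (M \<Otimes>\<^sub>M borel)"
    unfolding II_def by (rule path_iter_integral_measurable[OF q])
  have II_meas'[measurable]: "(\<lambda>x. II (fst x) (snd x)) \<in> borel_measurable (M \<Otimes>\<^sub>M lborel)"
    using II_meas by (simp cong: measurable_cong_sets)
  have IIb: "\<bar>II \<omega> u\<bar> \<le> (K * (t - s)) ^ length l" if "s \<le> u" "u \<le> t" for \<omega> u
  proof -
    have "\<bar>II \<omega> u\<bar> \<le> (K * (t - u)) ^ length l"
      unfolding II_def using that by (intro path_iter_integral_le K) auto
    also have "\<dots> \<le> (K * (t - s)) ^ length l" using that K0 by (intro power_mono mult_left_mono) auto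
    finally show ?thesis .
  qed
  define \<psi> where "\<psi> r z = q (z - y a) * iter_kernel q l y z (t - r)" for r z
  define \<Xi> where "\<Xi> r x = (\<integral>z. heat_kernel (r - s) (z - x) * \<psi> r z \<partial>lborel)" for r x
  define B where "B = K * (K * (t - s)) ^ length l"
  have B0: "0 \<le> B" using K0 Cons.prems by (simp add: B_def)
  have \<psi>_meas[measurable]: "\<psi> r \<in> borel_measurable borel" for r unfolding \<psi>_def by measurable
  have \<psi>B: "\<bar>\<psi> r z\<bar> \<le> B" if "s \<le> r" "r \<le> t" for r z
  proof -
    have "\<bar>iter_kernel q l y z (t - r)\<bar> \<le> (K * (t - r)) ^ length l"
      using that by (intro abs_iter_kernel_le K) auto
    also have "\<dots> \<le> (K * (t - s)) ^ length l" using that K0 by (intro power_mono mult_left_mono) auto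
    finally show ?thesis unfolding \<psi>_def B_def abs_mult using K K0 by (intro mult_mono) auto
  qed
  have \<Xi>B: "\<bar>\<Xi> r x\<bar> \<le> B" if "s < r" "r \<le> t" for r x
  proof -
    have "ennreal \<bar>\<Xi> r x\<bar> \<le> (\<integral>\<^sup>+z. ennreal \<bar>heat_kernel (r - s) (z - x) * \<psi> r z\<bar> \<partial>lborel)"
      unfolding \<Xi>_def by (rule ennreal_abs_integral_le) measurable
    also have "\<dots> \<le> (\<integral>\<^sup>+z. ennreal B * ennreal (heat_kernel (r - s) (z - x)) \<partial>lborel)"
      using \<psi>B[of r] that B0 mult_left_mono[OF \<psi>B[of r], of "heat_kernel (r - s) (z - x)" for z]
      by (intro nn_integral_mono) (auto simp: abs_mult ennreal_mult[symmetric] mult.commute intro!: ennreal_leI)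
    also have "\<dots> = ennreal B" using that by (simp add: nn_integral_cmult)
    finally show ?thesis using B0 by simp
  qed
  have inner: "expectation (\<lambda>\<omega>. Z \<omega> * (q (V r \<omega> - y a) * II \<omega> r)) = expectation (\<lambda>\<omega>. Z \<omega> * \<Xi> r (V s \<omega>))"
    if r: "s < r" "r < t" for r
  proof -
    have ad: "adapted r (\<lambda>\<omega>. Z \<omega> * q (V r \<omega> - y a))"
      using adapted_mult[OF Cons.prems(1), of r "\<lambda>x. q (x - y a)"] r by simp
    have "expectation (\<lambda>\<omega>. Z \<omega> * (q (V r \<omega> - y a) * II \<omega> r)) = expectation (\<lambda>\<omega>. (Z \<omega> * q (V r \<omega> - y a)) * II \<omega> r)"
      by (simp add: mult.assoc)
    also have "\<dots> = expectation (\<lambda>\<omega>. (Z \<omega> * q (V r \<omega> - y a)) * iter_kernel q l y (V r \<omega>) (t - r))"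
      unfolding II_def
    proof (rule Cons.IH[OF ad])
      show "\<bar>Z \<omega> * q (V r \<omega> - y a)\<bar> \<le> C * K" for \<omega>
        unfolding abs_mult using Cons.prems(2) K C0 by (intro mult_mono) auto
    qed (use r Cons.prems in auto)
    also have "\<dots> = expectation (\<lambda>\<omega>. Z \<omega> * \<psi> r (V r \<omega>))"
      by (simp add: \<psi>_def mult.assoc)
    also have "\<dots> = expectation (\<lambda>\<omega>. Z \<omega> * \<Xi> r (V s \<omega>))"
      unfolding \<Xi>_def using r Cons.prems
      by (intro expectation_adapted_step[where B = B and C = C] \<psi>B) auto
    finally show ?thesis .
  qed
  have meas1: "(\<lambda>z. indicator {s..t} (snd z) * (Z (fst z) * (q (V (snd z) (fst z) - y a) * II (fst z) (snd z))))
     \<in> borel_measurable (M \<Otimes>\<^sub>M lborel)" by measurable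
  have int1: "integrable (M \<Otimes>\<^sub>M lborel) (\<lambda>z. indicator {s..t} (snd z) * (Z (fst z) * (q (V (snd z) (fst z) - y a) * II (fst z) (snd z))))"
  proof (rule integrable_bounded_Icc_pair[OF meas1])
    fix \<omega> u
    have "\<bar>Z \<omega>\<bar> * (\<bar>q (V u \<omega> - y a)\<bar> * \<bar>II \<omega> u\<bar>) \<le> C * (K * (K * (t - s)) ^ length l)" if "s \<le> u" "u \<le> t"
      using Cons.prems K K0 C0 IIb[OF that] by (intro mult_mono) auto
    then show "\<bar>indicator {s..t} (snd (\<omega>, u)) * (Z (fst (\<omega>, u)) * (q (V (snd (\<omega>, u)) (fst (\<omega>, u)) - y a) * II (fst (\<omega>, u)) (snd (\<omega>, u))))\<bar>
       \<le> (C * B) * indicator {s..t} u"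
      by (auto simp: indicator_def abs_mult B_def)
  qed
  \<comment> \<open>The one-step formula requires \<open>s < r\<close>. The strict bounds change the
    integrand only at the two end points, a null set, and agree with those in
    \<open>iter_kernel\<close>.\<close>
  define H where "H r \<omega> = (if s < r \<and> r < t then Z \<omega> * \<Xi> r (V s \<omega>) else 0)" for r \<omega>
  have meas2: "(\<lambda>z. H (snd z) (fst z)) \<in> borel_measurable (M \<Otimes>\<^sub>M lborel)"
    unfolding H_def \<Xi>_def \<psi>_def by measurable
  have int2: "integrable (M \<Otimes>\<^sub>M lborel) (\<lambda>z. H (snd z) (fst z))"
  proof (rule integrable_bounded_Icc_pair[OF meas2])
    fix \<omega> u
    show "\<bar>H (snd (\<omega>, u)) (fst (\<omega>, u))\<bar> \<le> (C * B) * indicator {s..t} u"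
      using Cons.prems \<Xi>B C0 B0 by (auto simp: H_def abs_mult indicator_def intro!: mult_mono)
  qed
  have "expectation (\<lambda>\<omega>. Z \<omega> * iter_integral (\<lambda>a u. q (V u \<omega> - y a)) (a # l) s t)
    = expectation (\<lambda>\<omega>. \<integral>u. indicator {s..t} u * (Z \<omega> * (q (V u \<omega> - y a) * II \<omega> u)) \<partial>lborel)"
  proof (intro Bochner_Integration.integral_cong refl)
    fix \<omega>
    have "Z \<omega> * iter_integral (\<lambda>a u. q (V u \<omega> - y a)) (a # l) s t
      = (\<integral>u. Z \<omega> * (indicator {s..t} u * (q (V u \<omega> - y a) * II \<omega> u)) \<partial>lborel)"
      unfolding iter_integral.simps II_def by simp
    then show "Z \<omega> * iter_integral (\<lambda>a u. q (V u \<omega> - y a)) (a # l) s t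
      = (\<integral>u. indicator {s..t} u * (Z \<omega> * (q (V u \<omega> - y a) * II \<omega> u)) \<partial>lborel)"
      by (simp add: mult_ac)
  qed
  also have "\<dots> = (\<integral>u. expectation (\<lambda>\<omega>. indicator {s..t} u * (Z \<omega> * (q (V u \<omega> - y a) * II \<omega> u))) \<partial>lborel)"
    using P.Fubini_integral[of "\<lambda>\<omega> u. indicator {s..t} u * (Z \<omega> * (q (V u \<omega> - y a) * II \<omega> u))"] int1
    by (simp add: case_prod_unfold)
  also have "\<dots> = (\<integral>u. expectation (H u) \<partial>lborel)"
  proof (rule integral_cong_AE)
    have ne: "AE u in lborel. u \<noteq> s \<and> u \<noteq> t"
      using AE_lborel_singleton[of s] AE_lborel_singleton[of t] by eventually_elim simp
    show "AE u in lborel. expectation (\<lambda>\<omega>. indicator {s..t} u * (Z \<omega> * (q (V u \<omega> - y a) * II \<omega> u))) = expectation (H u)"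
      using ne
    proof eventually_elim
      case (elim u)
      show ?case
      proof (cases "s < u \<and> u < t")
        case True
        then have "H u = (\<lambda>\<omega>. Z \<omega> * \<Xi> u (V s \<omega>))" by (auto simp: H_def fun_eq_iff)
        then show ?thesis using True inner[of u] by simp
      next
        case False
        then have "u \<notin> {s..t}" using elim by auto
        moreover have "H u = (\<lambda>\<omega>. 0)" using False by (auto simp: H_def fun_eq_iff)
        ultimately show ?thesis by simp
      qed
    qed
    have sw: "(\<lambda>z. (snd z, fst z)) \<in> measurable (lborel \<Otimes>\<^sub>M M) (M \<Otimes>\<^sub>M (lborel :: real measure))" by measurable
    have "(\<lambda>z. indicator {s..t} (fst z) * (Z (snd z) * (q (V (fst z) (snd z) - y a) * II (snd z) (fst z)))) \<in> borel_measurable (lborel \<Otimes>\<^sub>M M)"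
      using measurable_compose[OF sw meas1] by simp
    then show "(\<lambda>u. expectation (\<lambda>\<omega>. indicator {s..t} u * (Z \<omega> * (q (V u \<omega> - y a) * II \<omega> u)))) \<in> borel_measurable lborel"
      by (intro borel_measurable_lebesgue_integral) (simp add: case_prod_unfold)
    have "(\<lambda>z. H (fst z) (snd z)) \<in> borel_measurable (lborel \<Otimes>\<^sub>M M)"
      using measurable_compose[OF sw meas2] by simp
    then show "(\<lambda>u. expectation (H u)) \<in> borel_measurable lborel"
      using borel_measurable_lebesgue_integral[of H lborel] by (simp add: case_prod_unfold)
  qed
  also have "\<dots> = expectation (\<lambda>\<omega>. \<integral>u. H u \<omega> \<partial>lborel)"
    using P.Fubini_integral[of "\<lambda>\<omega> u. H u \<omega>"] int2 by (simp add: case_prod_unfold)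
  also have "\<dots> = expectation (\<lambda>\<omega>. Z \<omega> * iter_kernel q (a # l) y (V s \<omega>) (t - s))"
  proof (intro Bochner_Integration.integral_cong refl)
    fix \<omega>
    define h where "h r = (if 0 < r \<and> r < t - s
      then \<integral>z. heat_kernel r (z - V s \<omega>) * q (z - y a) * iter_kernel q l y z (t - s - r) \<partial>lborel else 0)" for r
    have "H u \<omega> = Z \<omega> * h (u - s)" for u
      by (simp add: H_def \<Xi>_def \<psi>_def h_def mult.assoc)
    then have "(\<integral>u. H u \<omega> \<partial>lborel) = Z \<omega> * (\<integral>u. h (u - s) \<partial>lborel)"
      by simp
    also have "(\<integral>u. h (u - s) \<partial>lborel) = (\<integral>r. h r \<partial>lborel)"
      using lborel_integral_real_affine[of 1 h "- s"] by simp
    also have "\<dots> = iter_kernel q (a # l) y (V s \<omega>) (t - s)"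
      unfolding iter_kernel.simps h_def by (intro Bochner_Integration.integral_cong refl) auto
    finally show "(\<integral>u. H u \<omega> \<partial>lborel) = Z \<omega> * iter_kernel q (a # l) y (V s \<omega>) (t - s)" .
  qed
  finally show ?case .
qed simp

lemma expectation_prod_path_integral:
  fixes q :: "real ^ 'd \<Rightarrow> real"
  assumes A: "finite A" and q: "continuous_on UNIV q" and K: "\<And>x. \<bar>q x\<bar> \<le> K" and t: "0 \<le> t"
  shows "expectation (\<lambda>\<omega>. \<Prod>a\<in>A. \<integral>u. indicator {0..t} u * q (V u \<omega> - y a) \<partial>lborel)
    = (\<Sum>l\<in>permutations_of_set A. iter_kernel q l y 0 t)"
proof -
  have q_meas: "q \<in> borel_measurable borel" using q by (rule borel_measurable_continuous_onI)
  have K0: "0 \<le> K" using K[of 0] by linarith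
  have "expectation (\<lambda>\<omega>. \<Prod>a\<in>A. \<integral>u. indicator {0..t} u * q (V u \<omega> - y a) \<partial>lborel)
    = expectation (\<lambda>\<omega>. \<Sum>l\<in>permutations_of_set A. iter_integral (\<lambda>a u. q (V u \<omega> - y a)) l 0 t)"
  proof (intro Bochner_Integration.integral_cong refl prod_integral_eq_sum_iter_integral A t K0)
    show "continuous_on UNIV (\<lambda>u. q (V u \<omega> - y a))" for \<omega> a
      using V_continuous[of \<omega>] by (intro continuous_on_compose2[OF q] continuous_intros) auto
  qed (use K K0 in auto)
  also have "\<dots> = (\<Sum>l\<in>permutations_of_set A. expectation (\<lambda>\<omega>. iter_integral (\<lambda>a u. q (V u \<omega> - y a)) l 0 t))"
  proof (rule Bochner_Integration.integral_sum)
    fix l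
    have "(\<lambda>\<omega>. iter_integral (\<lambda>a u. q (V u \<omega> - y a)) l 0 t) \<in> borel_measurable M"
      using measurable_compose[OF _ path_iter_integral_measurable[OF q_meas], of "\<lambda>\<omega>. (\<omega>, 0)" M] by simp
    then show "integrable M (\<lambda>\<omega>. iter_integral (\<lambda>a u. q (V u \<omega> - y a)) l 0 t)"
      using path_iter_integral_le[OF q_meas K t]
      by (intro integrable_const_bound[of _ "(K * (t - 0)) ^ length l"]) (auto simp: K0)
  qed
  also have "\<dots> = (\<Sum>l\<in>permutations_of_set A. iter_kernel q l y 0 t)"
    using expectation_adapted_iter_integral[OF q_meas K adapted_const, of 1 1 t y] t
    by (simp add: V_0 prob_space)
  finally show ?thesis .
qed

end

section \<open>Passage to everywhere continuous paths\<close>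

text \<open>The increments of the extended sequence \<open>\<sigma>\<close> are independent as a
  family. They are grouped into the first \<open>n\<close> and the last one, and the law of the
  one-element group is transported to \<open>borel\<close> by evaluation.\<close>

lemma (in prob_space) indep_increments_distr:
  fixes W :: "real \<Rightarrow> 'a \<Rightarrow> real ^ 'd"
  assumes W: "standard_brownian_motion M W"
    and \<tau>: "0 \<le> \<tau> 0" "\<And>i. i < n \<Longrightarrow> \<tau> i \<le> \<tau> (Suc i)" "\<tau> n < r"
  shows "distr M (\<Pi>\<^sub>M i\<in>{..<n}. borel) (\<lambda>\<omega>. \<lambda>i\<in>{..<n}. W (\<tau> (Suc i)) \<omega> - W (\<tau> i) \<omega>)
      \<Otimes>\<^sub>M distr M borel (\<lambda>\<omega>. W r \<omega> - W (\<tau> n) \<omega>)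
    = distr M ((\<Pi>\<^sub>M i\<in>{..<n}. borel) \<Otimes>\<^sub>M borel)
        (\<lambda>\<omega>. (\<lambda>i\<in>{..<n}. W (\<tau> (Suc i)) \<omega> - W (\<tau> i) \<omega>, W r \<omega> - W (\<tau> n) \<omega>))"
proof -
  define \<sigma> where "\<sigma> = \<tau>(Suc n := r)"
  let ?I = "\<lambda>i \<omega>. W (\<sigma> (Suc i)) \<omega> - W (\<sigma> i) \<omega>"
  let ?A = "{..<n}" and ?B = "{n}"
  let ?X = "\<lambda>\<omega>. \<lambda>i\<in>?A. ?I i \<omega>" and ?Y = "\<lambda>\<omega>. \<lambda>i\<in>?B. ?I i \<omega>"
  let ?S = "PiM ?A (\<lambda>_. borel :: (real ^ 'd) measure)" and ?T = "PiM ?B (\<lambda>_. borel :: (real ^ 'd) measure)"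
  have "0 \<le> \<sigma> 0 \<and> (\<forall>i<Suc n. \<sigma> i \<le> \<sigma> (Suc i))"
    using \<tau> by (auto simp: \<sigma>_def less_Suc_eq)
  with W have "indep_vars (\<lambda>_. borel) ?I {..<Suc n}"
    unfolding standard_brownian_motion_def by blast
  then have "indep_var ?S ?X ?T ?Y"
    by (rule indep_var_restrict) auto
  then have X[measurable]: "?X \<in> measurable M ?S" and Y[measurable]: "?Y \<in> measurable M ?T"
    and joint: "distr M ?S ?X \<Otimes>\<^sub>M distr M ?T ?Y = distr M (?S \<Otimes>\<^sub>M ?T) (\<lambda>\<omega>. (?X \<omega>, ?Y \<omega>))"
    unfolding indep_var_distribution_eq by blast+
  have c[measurable]: "(\<lambda>x. x n) \<in> measurable ?T borel"
    by (rule measurable_component_singleton) simp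
  interpret X: prob_space "distr M ?S ?X" by (rule prob_space_distr) measurable
  interpret Y: prob_space "distr M ?T ?Y" by (rule prob_space_distr) measurable
  have dY: "distr (distr M ?T ?Y) borel (\<lambda>x. x n) = distr M borel (\<lambda>\<omega>. W r \<omega> - W (\<tau> n) \<omega>)"
    by (subst distr_distr[OF c Y]) (simp add: comp_def \<sigma>_def)
  have sf: "sigma_finite_measure (distr (distr M ?T ?Y) borel (\<lambda>x. x n))"
    by (intro prob_space_imp_sigma_finite Y.prob_space_distr) measurable
  have "distr M ?S ?X \<Otimes>\<^sub>M distr (distr M ?T ?Y) borel (\<lambda>x. x n)
      = distr (distr M ?S ?X) ?S (\<lambda>x. x) \<Otimes>\<^sub>M distr (distr M ?T ?Y) borel (\<lambda>x. x n)"
    by (subst (2) distr_distr) (auto simp: comp_def)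
  also have "\<dots> = distr (distr M ?S ?X \<Otimes>\<^sub>M distr M ?T ?Y) (?S \<Otimes>\<^sub>M borel) (\<lambda>(x, y). (x, y n))"
    by (rule pair_measure_distr[OF _ _ sf]) measurable
  also have "\<dots> = distr M (?S \<Otimes>\<^sub>M borel) (\<lambda>\<omega>. (?X \<omega>, ?Y \<omega> n))"
    unfolding joint by (subst distr_distr) (auto simp: comp_def)
  finally have *: "distr M ?S ?X \<Otimes>\<^sub>M distr M borel (\<lambda>\<omega>. W r \<omega> - W (\<tau> n) \<omega>)
      = distr M (?S \<Otimes>\<^sub>M borel) (\<lambda>\<omega>. (?X \<omega>, ?Y \<omega> n))"
    unfolding dY .
  have "(\<lambda>i\<in>?A. ?I i \<omega>) = (\<lambda>i\<in>{..<n}. W (\<tau> (Suc i)) \<omega> - W (\<tau> i) \<omega>)"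
    and "(\<lambda>i\<in>?B. ?I i \<omega>) n = W r \<omega> - W (\<tau> n) \<omega>" for \<omega>
    by (auto simp: \<sigma>_def restrict_def)
  then show ?thesis using * by (simp only:)
qed

text \<open>On a null set containing all bad outcomes the path is replaced by 0, and at negative
  times by its value at 0. It is then continuous on the whole line, and all laws at nonnegative
  times are unchanged.\<close>

lemma continuous_modification:
  fixes W :: "real \<Rightarrow> 'w \<Rightarrow> real ^ 'd"
  assumes W: "standard_brownian_motion M W"
  obtains V where "continuous_brownian_motion M V" "AE \<omega> in M. \<forall>s\<ge>0. V s \<omega> = W s \<omega>"
proof -
  interpret prob_space M using W by (simp add: standard_brownian_motion_def)
  have "AE \<omega> in M. W 0 \<omega> = 0 \<and> continuous_on {0..} (\<lambda>s. W s \<omega>)"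
    using W by (auto simp: standard_brownian_motion_def)
  then obtain N where N: "N \<in> null_sets M" "{\<omega> \<in> space M. \<not> (W 0 \<omega> = 0 \<and> continuous_on {0..} (\<lambda>s. W s \<omega>))} \<subseteq> N"
    unfolding eventually_ae_filter by blast
  define V where "V s \<omega> = (if \<omega> \<in> space M - N then W (max 0 s) \<omega> else 0)" for s \<omega>
  have good: "W 0 \<omega> = 0" "continuous_on {0..} (\<lambda>s. W s \<omega>)" if "\<omega> \<in> space M - N" for \<omega>
    using N that by auto
  have W_meas: "W s \<in> borel_measurable M" if "0 \<le> s" for s
    using W that by (simp add: standard_brownian_motion_def)
  have N_sets: "N \<in> sets M" using N by auto
  have V_meas: "V s \<in> borel_measurable M" for s
    unfolding V_def using N_sets W_meas[of "max 0 s"]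
    by (intro measurable_If_set measurable_const) auto
  have AEN: "AE \<omega> in M. \<omega> \<in> space M - N"
    using AE_not_in[OF N(1)] by (auto elim: eventually_mono)
  then have AE_eq: "AE \<omega> in M. \<forall>s\<ge>0. V s \<omega> = W s \<omega>"
    by eventually_elim (simp add: V_def)
  have "continuous_brownian_motion M V"
  proof
    show "continuous_on UNIV (\<lambda>s. V s \<omega>)" for \<omega>
    proof (cases "\<omega> \<in> space M - N")
      case True
      have "continuous_on UNIV (\<lambda>s. W (max 0 s) \<omega>)"
        by (rule continuous_on_compose2[OF good(2)[OF True]]) (auto intro!: continuous_intros)
      then show ?thesis using True by (simp add: V_def)
    next
      case False
      then have "V s \<omega> = 0" for s by (auto simp: V_def)
      then show ?thesis by simp
    qed
    show "V 0 \<omega> = 0" for \<omega> using good by (simp add: V_def)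
  next
    fix n and \<tau> :: "nat \<Rightarrow> real" and r
    assume \<tau>: "0 \<le> \<tau> 0" "\<And>i. i < n \<Longrightarrow> \<tau> i \<le> \<tau> (Suc i)" "\<tau> n < r"
    have pos: "0 \<le> \<tau> i" if "i \<le> n" for i
      using that \<tau>(1) by (induction i) (auto intro: order_trans[OF _ \<tau>(2)])
    have r: "0 \<le> r" using pos[of n] \<tau>(3) by simp
    let ?S = "PiM {..<n} (\<lambda>_. borel :: (real ^ 'd) measure)"
    have mW: "(\<lambda>\<omega>. \<lambda>i\<in>{..<n}. W (\<tau> (Suc i)) \<omega> - W (\<tau> i) \<omega>) \<in> measurable M ?S"
      by (intro measurable_restrict borel_measurable_diff W_meas pos) auto
    have mV: "(\<lambda>\<omega>. \<lambda>i\<in>{..<n}. V (\<tau> (Suc i)) \<omega> - V (\<tau> i) \<omega>) \<in> measurable M ?S"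
      by (intro measurable_restrict borel_measurable_diff V_meas)
    have mW': "(\<lambda>\<omega>. W r \<omega> - W (\<tau> n) \<omega>) \<in> borel_measurable M"
      by (intro borel_measurable_diff W_meas pos r) auto
    have mV': "(\<lambda>\<omega>. V r \<omega> - V (\<tau> n) \<omega>) \<in> borel_measurable M"
      by (intro borel_measurable_diff V_meas)
    have e1: "AE \<omega> in M. (\<lambda>i\<in>{..<n}. V (\<tau> (Suc i)) \<omega> - V (\<tau> i) \<omega>) = (\<lambda>i\<in>{..<n}. W (\<tau> (Suc i)) \<omega> - W (\<tau> i) \<omega>)"
      using AE_eq by eventually_elim (auto simp: pos Suc_leI intro!: restrict_ext)
    have e2: "AE \<omega> in M. V r \<omega> - V (\<tau> n) \<omega> = W r \<omega> - W (\<tau> n) \<omega>"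
      using AE_eq by eventually_elim (simp add: pos r)
    have d1: "distr M ?S (\<lambda>\<omega>. \<lambda>i\<in>{..<n}. V (\<tau> (Suc i)) \<omega> - V (\<tau> i) \<omega>) = distr M ?S (\<lambda>\<omega>. \<lambda>i\<in>{..<n}. W (\<tau> (Suc i)) \<omega> - W (\<tau> i) \<omega>)"
      by (rule distr_cong_AE[OF refl refl e1 mV mW])
    have d2: "distr M borel (\<lambda>\<omega>. V r \<omega> - V (\<tau> n) \<omega>) = distr M borel (\<lambda>\<omega>. W r \<omega> - W (\<tau> n) \<omega>)"
      by (rule distr_cong_AE[OF refl refl e2 mV' mW'])
    have d3: "distr M (?S \<Otimes>\<^sub>M borel) (\<lambda>\<omega>. (\<lambda>i\<in>{..<n}. V (\<tau> (Suc i)) \<omega> - V (\<tau> i) \<omega>, V r \<omega> - V (\<tau> n) \<omega>))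
      = distr M (?S \<Otimes>\<^sub>M borel) (\<lambda>\<omega>. (\<lambda>i\<in>{..<n}. W (\<tau> (Suc i)) \<omega> - W (\<tau> i) \<omega>, W r \<omega> - W (\<tau> n) \<omega>))"
    proof (rule distr_cong_AE[OF refl refl])
      show "AE \<omega> in M. (\<lambda>i\<in>{..<n}. V (\<tau> (Suc i)) \<omega> - V (\<tau> i) \<omega>, V r \<omega> - V (\<tau> n) \<omega>)
          = (\<lambda>i\<in>{..<n}. W (\<tau> (Suc i)) \<omega> - W (\<tau> i) \<omega>, W r \<omega> - W (\<tau> n) \<omega>)"
        using e1 e2 by eventually_elim simp
    qed (intro measurable_Pair mV mV' mW mW')+
    show "distr M ?S (\<lambda>\<omega>. \<lambda>i\<in>{..<n}. V (\<tau> (Suc i)) \<omega> - V (\<tau> i) \<omega>) \<Otimes>\<^sub>M distr M borel (\<lambda>\<omega>. V r \<omega> - V (\<tau> n) \<omega>)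
      = distr M (?S \<Otimes>\<^sub>M borel) (\<lambda>\<omega>. (\<lambda>i\<in>{..<n}. V (\<tau> (Suc i)) \<omega> - V (\<tau> i) \<omega>, V r \<omega> - V (\<tau> n) \<omega>))"
      unfolding d1 d2 d3 by (rule indep_increments_distr[OF W \<tau>])
  next
    fix s r :: real assume sr: "0 \<le> s" "s < r"
    have "distributed M lborel (\<lambda>\<omega>. W r \<omega> - W s \<omega>) (\<lambda>x. ennreal (heat_kernel (r - s) x))"
      using W sr by (simp add: standard_brownian_motion_def)
    moreover have "distr M lborel (\<lambda>\<omega>. V r \<omega> - V s \<omega>) = distr M lborel (\<lambda>\<omega>. W r \<omega> - W s \<omega>)"
      using sr AE_eq V_meas W_meas by (intro distr_cong_AE refl) (auto elim: eventually_mono)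
    ultimately show "distributed M lborel (\<lambda>\<omega>. V r \<omega> - V s \<omega>) (\<lambda>x. ennreal (heat_kernel (r - s) x))"
      using V_meas by (auto simp: distributed_def)
  qed (rule V_meas)
  with AE_eq that show thesis by blast
qed

section \<open>Independent Brownian motions\<close>

locale independent_continuous_bm = prob_space M for M :: "'w measure" +
  fixes J :: "'j set" and V :: "'j \<Rightarrow> real \<Rightarrow> 'w \<Rightarrow> real ^ 'd"
  assumes J: "finite J" "J \<noteq> {}"
    and bm: "\<And>j. j \<in> J \<Longrightarrow> continuous_brownian_motion M (V j)"
    and indep: "indep_vars (\<lambda>_. \<Pi>\<^sub>M s\<in>{0..}. borel) (\<lambda>j \<omega>. \<lambda>s\<in>{0..}. V j s \<omega>) J"
begin

text \<open>Independence concerns the sigma-algebras generated by the whole paths. Each factor is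
  therefore shown to be measurable with respect to the sigma-algebra \<open>?N j\<close> of its own
  path, not merely with respect to \<open>M\<close>.\<close>

lemma expectation_prod_path_functional:
  fixes q :: "'j \<Rightarrow> real ^ 'd \<Rightarrow> real" and y :: "'i \<Rightarrow> real ^ 'd"
  assumes A: "finite A" and q[measurable]: "\<And>j. j \<in> J \<Longrightarrow> q j \<in> borel_measurable borel"
    and K: "\<And>j x. j \<in> J \<Longrightarrow> \<bar>q j x\<bar> \<le> K" and t: "0 \<le> t"
  defines "\<Psi> \<equiv> \<lambda>j \<omega>. \<Prod>a\<in>A. \<integral>u. indicator {0..t} u * q j (V j u \<omega> - y a) \<partial>lborel"
  shows "expectation (\<lambda>\<omega>. \<Prod>j\<in>J. \<Psi> j \<omega>) = (\<Prod>j\<in>J. expectation (\<Psi> j))"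
proof -
  let ?N = "\<lambda>j. vimage_algebra (space M) (\<lambda>\<omega>. \<lambda>s\<in>{0..}. V j s \<omega>) (\<Pi>\<^sub>M s\<in>{0..}. borel)"
  let ?path = "\<lambda>j \<omega>. \<lambda>s\<in>{0..}. V j s \<omega>"
  have sp: "?path j \<in> space M \<rightarrow> space (\<Pi>\<^sub>M s\<in>{0..}. (borel :: (real ^ 'd) measure))" for j
    by (auto simp: space_PiM)
  have \<Psi>N: "\<Psi> j \<in> borel_measurable (?N j)" if j: "j \<in> J" for j
  proof -
    interpret V: continuous_brownian_motion M "V j" by (rule bm[OF j])
    \<comment> \<open>Negative times are no coordinates of the path space; \<open>max 0\<close>
      avoids them and makes no difference on \<open>{0..t}\<close>.\<close>
    have m: "(\<lambda>\<omega>. V j (max 0 s) \<omega>) \<in> borel_measurable (?N j)" for s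
    proof -
      have "(\<lambda>\<omega>. ?path j \<omega> (max 0 s)) \<in> borel_measurable (?N j)"
        by (rule measurable_compose[OF measurable_vimage_algebra1[OF sp] measurable_component_singleton]) simp
      then show ?thesis by simp
    qed
    have "continuous_on UNIV (\<lambda>s. V j (max 0 s) \<omega>)" for \<omega>
      by (rule continuous_on_compose2[OF V.V_continuous]) (auto intro!: continuous_intros)
    with m have jm: "(\<lambda>x. V j (max 0 (snd x)) (fst x)) \<in> borel_measurable (?N j \<Otimes>\<^sub>M borel)"
      using joint_measurable_continuous_path[of "\<lambda>s \<omega>. V j (max 0 s) \<omega>" "?N j"] by simp
    have jm'[measurable]: "(\<lambda>x. V j (max 0 (snd x)) (fst x)) \<in> borel_measurable (?N j \<Otimes>\<^sub>M lborel)"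
      using jm by (simp cong: measurable_cong_sets)
    have qj[measurable]: "q j \<in> borel_measurable borel" using j by (rule q)
    have "(\<lambda>\<omega>. \<Prod>a\<in>A. \<integral>u. indicator {0..t} u * q j (V j (max 0 u) \<omega> - y a) \<partial>lborel) \<in> borel_measurable (?N j)"
      by (intro borel_measurable_prod lborel.borel_measurable_lebesgue_integral) (simp add: case_prod_unfold)
    moreover have "(\<integral>u. indicator {0..t} u * q j (V j (max 0 u) \<omega> - y a) \<partial>lborel)
       = (\<integral>u. indicator {0..t} u * q j (V j u \<omega> - y a) \<partial>lborel)" for \<omega> a
      by (intro Bochner_Integration.integral_cong refl) (auto simp: indicator_def max_def)
    ultimately show ?thesis unfolding \<Psi>_def by simp
  qed
  have \<Psi>M: "\<Psi> j \<in> borel_measurable M" if j: "j \<in> J" for j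
  proof -
    have "?path j \<in> measurable M (\<Pi>\<^sub>M s\<in>{0..}. borel)"
      using indep j by (auto simp: indep_vars_def2)
    then have "sets (?N j) \<subseteq> sets M"
      unfolding sets_vimage_algebra2[OF sp] by (auto intro: measurable_sets)
    then show ?thesis using \<Psi>N[OF j] by (auto simp: measurable_def)
  qed
  have "indep_vars (\<lambda>_. borel) \<Psi> J"
    unfolding indep_vars_def2
  proof (intro conjI ballI \<Psi>M)
    have "indep_sets (\<lambda>j. {?path j -` A \<inter> space M |A. A \<in> sets (\<Pi>\<^sub>M s\<in>{0..}. borel)}) J"
      using indep by (simp add: indep_vars_def2)
    then show "indep_sets (\<lambda>j. {\<Psi> j -` A \<inter> space M |A. A \<in> sets borel}) J"
    proof (rule indep_sets_mono_sets)
      fix j assume j: "j \<in> J"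
      have "\<Psi> j -` A \<inter> space M \<in> sets (?N j)" if "A \<in> sets borel" for A
        using measurable_sets[OF \<Psi>N[OF j] that] by simp
      then show "{\<Psi> j -` A \<inter> space M |A. A \<in> sets borel} \<subseteq> {?path j -` A \<inter> space M |A. A \<in> sets (\<Pi>\<^sub>M s\<in>{0..}. borel)}"
        unfolding sets_vimage_algebra2[OF sp] by blast
    qed
  qed
  moreover have "integrable M (\<Psi> j)" if j: "j \<in> J" for j
  proof (rule integrable_const_bound[of _ "(K * t) ^ card A"])
    interpret V: continuous_brownian_motion M "V j" by (rule bm[OF j])
    show "AE \<omega> in M. norm (\<Psi> j \<omega>) \<le> (K * t) ^ card A"
    proof (intro AE_I2)
      fix \<omega>
      have b: "\<bar>\<integral>u. indicator {0..t} u * q j (V j u \<omega> - y a) \<partial>lborel\<bar> \<le> K * (t - 0)" for a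
      proof (rule abs_integral_Icc_le)
        have "(\<lambda>u. V j u \<omega>) \<in> borel_measurable borel"
          using V.V_continuous by (intro borel_measurable_continuous_onI)
        then show "(\<lambda>u. q j (V j u \<omega> - y a)) \<in> borel_measurable borel"
          using q[OF j] by measurable
      qed (use K j t in auto)
      have "norm (\<Psi> j \<omega>) = (\<Prod>a\<in>A. \<bar>\<integral>u. indicator {0..t} u * q j (V j u \<omega> - y a) \<partial>lborel\<bar>)"
        unfolding \<Psi>_def by (simp add: abs_prod)
      also have "\<dots> \<le> (\<Prod>a\<in>A. K * t)"
        using b by (intro prod_mono) auto
      finally show "norm (\<Psi> j \<omega>) \<le> (K * t) ^ card A" by simp
    qed
  qed (rule \<Psi>M[OF j])
  ultimately show ?thesis
    using J by (intro indep_vars_lebesgue_integral) auto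
qed

end

section \<open>Moments of products of smoothed local times\<close>

context pair_kernel_bound
begin

text \<open>The power mean inequality over the (2n)! visiting orders costs exactly a factor (2n)! in
  the norm.\<close>

lemma nn_integral_sum_iter_kernel_power_le:
  assumes A: "finite A" "card A = 2 * n" and T: "0 \<le> T"
  shows "(\<integral>\<^sup>+y. ennreal (\<bar>\<Sum>l\<in>permutations_of_set A. iter_kernel q l y x T\<bar> ^ p) \<partial>(\<Pi>\<^sub>M i\<in>A. lborel))
    \<le> ennreal ((fact (2 * n) * ((2 * \<kappa> * c\<^sup>2) ^ n * exp (lam * T))) ^ p)"
proof -
  define N :: real where "N = fact (2 * n)"
  have N: "N = real (card (permutations_of_set A))" using A by (simp add: N_def)
  have N0: "0 < N" by (simp add: N_def)
  define B where "B = (2 * \<kappa> * c\<^sup>2) ^ n * exp (lam * T)"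
  have B0: "0 \<le> B" using kappa by (simp add: B_def)
  have m: "(\<lambda>y. iter_kernel q l y x T) \<in> borel_measurable (\<Pi>\<^sub>M i\<in>A. lborel)" if "l \<in> permutations_of_set A" for l
    using that by (intro borel_measurable_iter_kernel[where I = A])
      (auto dest: permutations_of_setD intro!: measurable_ident_sets sets_PiM_lborel)
  have m': "(\<lambda>y. ennreal (\<bar>iter_kernel q l y x T\<bar> ^ p)) \<in> borel_measurable (\<Pi>\<^sub>M i\<in>A. lborel)"
    if "l \<in> permutations_of_set A" for l
    using m[OF that] by measurable
  have "(\<integral>\<^sup>+y. ennreal (\<bar>\<Sum>l\<in>permutations_of_set A. iter_kernel q l y x T\<bar> ^ p) \<partial>(\<Pi>\<^sub>M i\<in>A. lborel))
    \<le> (\<integral>\<^sup>+y. ennreal (N ^ (p - 1)) * (\<Sum>l\<in>permutations_of_set A. ennreal (\<bar>iter_kernel q l y x T\<bar> ^ p)) \<partial>(\<Pi>\<^sub>M i\<in>A. lborel))"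
  proof (intro nn_integral_mono)
    fix y
    have "\<bar>\<Sum>l\<in>permutations_of_set A. iter_kernel q l y x T\<bar> ^ p \<le> (\<Sum>l\<in>permutations_of_set A. \<bar>iter_kernel q l y x T\<bar>) ^ p"
      by (intro power_mono sum_abs) auto
    also have "\<dots> \<le> N ^ (p - 1) * (\<Sum>l\<in>permutations_of_set A. \<bar>iter_kernel q l y x T\<bar> ^ p)"
      unfolding N using p1 by (intro sum_power_le_card_power) auto
    finally show "ennreal (\<bar>\<Sum>l\<in>permutations_of_set A. iter_kernel q l y x T\<bar> ^ p)
        \<le> ennreal (N ^ (p - 1)) * (\<Sum>l\<in>permutations_of_set A. ennreal (\<bar>iter_kernel q l y x T\<bar> ^ p))"
      using N0 by (simp add: ennreal_mult[symmetric] sum_nonneg ennreal_leI)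
  qed
  also have "\<dots> = ennreal (N ^ (p - 1)) * (\<Sum>l\<in>permutations_of_set A. \<integral>\<^sup>+y. ennreal (\<bar>iter_kernel q l y x T\<bar> ^ p) \<partial>(\<Pi>\<^sub>M i\<in>A. lborel))"
    using m' by (simp add: nn_integral_cmult nn_integral_sum del: sum_ennreal)
  also have "\<dots> \<le> ennreal (N ^ (p - 1)) * (\<Sum>l\<in>permutations_of_set A. ennreal (B ^ p))"
  proof (intro mult_left_mono sum_mono)
    fix l assume l: "l \<in> permutations_of_set A"
    have "set l = A" "distinct l" "length l = 2 * n"
      using permutations_of_setD[OF l] length_finite_permutations_of_set[OF l] A by auto
    then show "(\<integral>\<^sup>+y. ennreal (\<bar>iter_kernel q l y x T\<bar> ^ p) \<partial>(\<Pi>\<^sub>M i\<in>A. lborel)) \<le> ennreal (B ^ p)"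
      unfolding B_def using nn_integral_iter_kernel_power_le[of l n T x] T by simp
  qed auto
  also have "\<dots> = ennreal (N ^ (p - 1)) * ennreal (N * B ^ p)"
    using N0 B0 by (simp add: N ennreal_of_nat_eq_real_of_nat ennreal_mult)
  also have "\<dots> = ennreal (N ^ (p - 1) * (N * B ^ p))"
    using N0 B0 by (simp add: ennreal_mult)
  also have "N ^ (p - 1) * (N * B ^ p) = (N * B) ^ p"
    using p1 by (cases p) (auto simp: power_mult_distrib mult_ac)
  finally show ?thesis by (simp add: N_def B_def)
qed

end

context independent_continuous_bm
begin

definition smoothed_local_time :: "(real ^ 'd \<Rightarrow> real) \<Rightarrow> real \<Rightarrow> 'j \<Rightarrow> real ^ 'd \<Rightarrow> 'w \<Rightarrow> real" where
  "smoothed_local_time q t j y \<omega> = (\<integral>u. indicator {0..t} u * q (V j u \<omega> - y) \<partial>lborel)"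

lemma V_path_measurable:
  assumes "j \<in> J" "w \<in> measurable N M" "s \<in> borel_measurable N"
  shows "(\<lambda>x. V j (s x) (w x)) \<in> borel_measurable N"
proof -
  interpret V: continuous_brownian_motion M "V j" by (rule bm[OF assms(1)])
  show ?thesis using assms by measurable
qed

lemma V_cont: "j \<in> J \<Longrightarrow> continuous_on UNIV (\<lambda>s. V j s \<omega>)"
  using continuous_brownian_motion.V_continuous[OF bm] .

lemma smoothed_local_time_measurable:
  assumes j: "j \<in> J" and [measurable]: "q \<in> borel_measurable borel" "y \<in> borel_measurable N" "w \<in> measurable N M"
  shows "(\<lambda>x. smoothed_local_time q t j (y x) (w x)) \<in> borel_measurable N"
proof -
  have [measurable]: "(\<lambda>z. V j (snd z) (w (fst z))) \<in> borel_measurable (N \<Otimes>\<^sub>M lborel)"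
    by (rule V_path_measurable[OF j]) measurable
  show ?thesis unfolding smoothed_local_time_def by measurable
qed

text \<open>For every \<open>\<omega>\<close>, including those outside \<open>space M\<close>, for
  which the constant map is not measurable into \<open>M\<close>.\<close>

lemma smoothed_local_time_measurable_omega:
  assumes j: "j \<in> J" and [measurable]: "q \<in> borel_measurable borel" "y \<in> borel_measurable N"
  shows "(\<lambda>x. smoothed_local_time q t j (y x) \<omega>) \<in> borel_measurable N"
proof -
  have [measurable]: "(\<lambda>u. V j u \<omega>) \<in> borel_measurable borel"
    using V_cont[OF j] by (intro borel_measurable_continuous_onI)
  show ?thesis unfolding smoothed_local_time_def by measurable
qed

lemma abs_smoothed_local_time_le:
  assumes j: "j \<in> J" and [measurable]: "q \<in> borel_measurable borel" and K: "\<And>x. \<bar>q x\<bar> \<le> K" and t: "0 \<le> t"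
  shows "\<bar>smoothed_local_time q t j y \<omega>\<bar> \<le> K * t"
proof -
  have [measurable]: "(\<lambda>u. V j u \<omega>) \<in> borel_measurable borel"
    using V_cont[OF j] by (intro borel_measurable_continuous_onI)
  show ?thesis
    unfolding smoothed_local_time_def
    using abs_integral_Icc_le[of "\<lambda>u. q (V j u \<omega> - y)" 0 t K] K t by simp
qed

lemma nn_integral_smoothed_local_time_le:
  assumes j: "j \<in> J" and [measurable]: "q \<in> borel_measurable borel"
    and q: "(\<integral>\<^sup>+x. ennreal \<bar>q x\<bar> \<partial>lborel) \<le> 2" and t: "0 \<le> t"
  shows "(\<integral>\<^sup>+y. ennreal \<bar>smoothed_local_time q t j y \<omega>\<bar> \<partial>lborel) \<le> ennreal (2 * t)"
proof -
  have [measurable]: "(\<lambda>u. V j u \<omega>) \<in> borel_measurable borel"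
    using V_cont[OF j] by (intro borel_measurable_continuous_onI)
  have "(\<integral>\<^sup>+y. ennreal \<bar>smoothed_local_time q t j y \<omega>\<bar> \<partial>lborel)
    \<le> (\<integral>\<^sup>+y. \<integral>\<^sup>+u. ennreal \<bar>indicator {0..t} u * q (V j u \<omega> - y)\<bar> \<partial>lborel \<partial>lborel)"
    unfolding smoothed_local_time_def by (intro nn_integral_mono ennreal_abs_integral_le) measurable
  also have "\<dots> = (\<integral>\<^sup>+u. \<integral>\<^sup>+y. ennreal \<bar>indicator {0..t} u * q (V j u \<omega> - y)\<bar> \<partial>lborel \<partial>lborel)"
    by (rule lborel_pair.Fubini') simp
  also have "\<dots> \<le> (\<integral>\<^sup>+u. 2 * indicator {0..t} u \<partial>lborel)"
  proof (intro nn_integral_mono)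
    fix u
    show "(\<integral>\<^sup>+y. ennreal \<bar>indicator {0..t} u * q (V j u \<omega> - y)\<bar> \<partial>lborel) \<le> 2 * indicator {0..t} u"
      using q nn_integral_lborel_reflect[of "\<lambda>x. ennreal \<bar>q x\<bar>" "V j u \<omega>"]
      by (auto simp: indicator_def)
  qed
  also have "\<dots> = ennreal (2 * t)"
    using t by (simp add: nn_integral_cmult_indicator ennreal_mult)
  finally show ?thesis .
qed

text \<open>One factor is integrated by its mass and the others are bounded by suprema. The bound is
  deterministic but not uniform in the smoothing, so it serves integrability only.\<close>

lemma nn_integral_prod_smoothed_local_time_le:
  fixes f :: "real ^ 'd \<Rightarrow> real"
  assumes C: "\<And>x. \<bar>f x\<bar> \<le> C"
    and q_meas: "\<And>j. j \<in> J \<Longrightarrow> q j \<in> borel_measurable borel" and q_le: "\<And>j x. j \<in> J \<Longrightarrow> \<bar>q j x\<bar> \<le> K"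
    and q_mass: "\<And>j. j \<in> J \<Longrightarrow> (\<integral>\<^sup>+x. ennreal \<bar>q j x\<bar> \<partial>lborel) \<le> 2" and t: "0 \<le> t"
  shows "(\<integral>\<^sup>+y. ennreal \<bar>f y * (\<Prod>j\<in>J. smoothed_local_time (q j) t j y \<omega>)\<bar> \<partial>lborel)
    \<le> ennreal (C * ((K * t) ^ (card J - 1) * (2 * t)))"
proof -
  obtain j0 where j0: "j0 \<in> J" using J by blast
  have K0: "0 \<le> K" using q_le[OF j0, of 0] by linarith
  have C0: "0 \<le> C" using C[of 0] by linarith
  let ?F = "\<lambda>y. f y * (\<Prod>j\<in>J. smoothed_local_time (q j) t j y \<omega>)"
  have "(\<integral>\<^sup>+y. ennreal \<bar>?F y\<bar> \<partial>lborel)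
    \<le> (\<integral>\<^sup>+y. ennreal (C * (K * t) ^ (card J - 1)) * ennreal \<bar>smoothed_local_time (q j0) t j0 y \<omega>\<bar> \<partial>lborel)"
  proof (intro nn_integral_mono)
    fix y
    have "\<bar>?F y\<bar> = \<bar>f y\<bar> * ((\<Prod>j\<in>J - {j0}. \<bar>smoothed_local_time (q j) t j y \<omega>\<bar>) * \<bar>smoothed_local_time (q j0) t j0 y \<omega>\<bar>)"
      using J j0 by (simp add: abs_mult abs_prod prod.remove[of J j0] mult.commute)
    also have "\<dots> \<le> C * ((\<Prod>j\<in>J - {j0}. K * t) * \<bar>smoothed_local_time (q j0) t j0 y \<omega>\<bar>)"
      using C C0 K0 t q_meas q_le
      by (intro mult_mono prod_mono mult_nonneg_nonneg prod_nonneg)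
        (auto intro!: abs_smoothed_local_time_le)
    also have "(\<Prod>j\<in>J - {j0}. K * t) = (K * t) ^ (card J - 1)"
      using J j0 by simp
    finally show "ennreal \<bar>?F y\<bar> \<le> ennreal (C * (K * t) ^ (card J - 1)) * ennreal \<bar>smoothed_local_time (q j0) t j0 y \<omega>\<bar>"
      using C0 K0 t by (simp add: ennreal_mult[symmetric] ennreal_leI mult.assoc)
  qed
  also have "\<dots> = ennreal (C * (K * t) ^ (card J - 1)) * (\<integral>\<^sup>+y. ennreal \<bar>smoothed_local_time (q j0) t j0 y \<omega>\<bar> \<partial>lborel)"
  proof (rule nn_integral_cmult)
    have "(\<lambda>y. smoothed_local_time (q j0) t j0 y \<omega>) \<in> borel_measurable borel"
      by (rule smoothed_local_time_measurable_omega[OF j0 q_meas[OF j0]]) simp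
    then show "(\<lambda>y. ennreal \<bar>smoothed_local_time (q j0) t j0 y \<omega>\<bar>) \<in> borel_measurable lborel" by measurable
  qed
  also have "\<dots> \<le> ennreal (C * (K * t) ^ (card J - 1)) * ennreal (2 * t)"
    by (intro mult_left_mono nn_integral_smoothed_local_time_le[OF j0 q_meas[OF j0] q_mass[OF j0] t]) auto
  also have "\<dots> = ennreal (C * ((K * t) ^ (card J - 1) * (2 * t)))"
    using C0 K0 t by (simp add: ennreal_mult[symmetric] mult.assoc)
  finally show ?thesis .
qed

text \<open>The moments factor over the independent motions, and Hoelder's inequality reduces them to the
  \<open>L\<^sup>p\<close> norms of the iterated kernels.\<close>

lemma even_moment_le:
  fixes f :: "real ^ 'd \<Rightarrow> real"
  assumes f[measurable]: "f \<in> borel_measurable borel" and C: "\<And>x. \<bar>f x\<bar> \<le> C"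
    and q: "\<And>j. j \<in> J \<Longrightarrow> pair_kernel_bound (q j) K (\<kappa> j) lam c (card J)"
    and qc: "\<And>j. j \<in> J \<Longrightarrow> continuous_on UNIV (q j)" and t: "0 \<le> t"
  shows "(\<integral>\<^sup>+\<omega>. ennreal ((\<integral>y. f y * (\<Prod>j\<in>J. smoothed_local_time (q j) t j y \<omega>) \<partial>lborel) ^ (2 * n)) \<partial>M)
    \<le> ennreal (C ^ (2 * n) * (\<Prod>j\<in>J. fact (2 * n) * ((2 * \<kappa> j * c\<^sup>2) ^ n * exp (lam * t))))"
proof -
  define A where "A = {..<2 * n}"
  have A: "finite A" "card A = 2 * n" by (simp_all add: A_def)
  let ?P = "\<Pi>\<^sub>M i\<in>A. (lborel :: (real ^ 'd) measure)"
  interpret PS: product_sigma_finite "\<lambda>_ :: nat. lborel :: (real ^ 'd) measure" by standard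
  interpret P: sigma_finite_measure ?P using A by (intro sigma_finite_PiM_lborel)
  interpret MP: pair_sigma_finite M ?P ..
  have q_meas: "q j \<in> borel_measurable borel" and q_le: "\<bar>q j x\<bar> \<le> K"
    and q_mass: "(\<integral>\<^sup>+x. ennreal \<bar>q j x\<bar> \<partial>lborel) \<le> 2" if "j \<in> J" for j x
    using q[OF that] by (auto simp: pair_kernel_bound_def)
  have C0: "0 \<le> C" using C[of 0] by linarith
  define F where "F y \<omega> = f y * (\<Prod>j\<in>J. smoothed_local_time (q j) t j y \<omega>)" for y \<omega>
  have F_meas: "(\<lambda>x. F (y x) (w x)) \<in> borel_measurable N"
    if [measurable]: "y \<in> borel_measurable N" "w \<in> measurable N M" for y w and N :: "'n measure"
  proof -
    have [measurable]: "(\<lambda>x. smoothed_local_time (q j) t j (y x) (w x)) \<in> borel_measurable N" if "j \<in> J" for j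
      using that q_meas by (intro smoothed_local_time_measurable) auto
    show ?thesis unfolding F_def by measurable
  qed
  have F_meas\<omega>[measurable]: "(\<lambda>y. F y \<omega>) \<in> borel_measurable borel" for \<omega>
  proof -
    have [measurable]: "(\<lambda>y. smoothed_local_time (q j) t j y \<omega>) \<in> borel_measurable borel" if "j \<in> J" for j
      using that q_meas by (intro smoothed_local_time_measurable_omega) auto
    show ?thesis unfolding F_def by measurable
  qed
  define R where "R = C * ((K * t) ^ (card J - 1) * (2 * t))"
  have F_int: "(\<integral>\<^sup>+y. ennreal \<bar>F y \<omega>\<bar> \<partial>lborel) \<le> ennreal R" for \<omega>
    unfolding F_def R_def by (rule nn_integral_prod_smoothed_local_time_le[OF C q_meas q_le q_mass t])
  have F_integrable: "integrable lborel (\<lambda>y. F y \<omega>)" for \<omega>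
    using F_int[of \<omega>] by (intro integrableI_bounded) (auto intro: le_less_trans)
  have comp: "(\<lambda>y. y i) \<in> borel_measurable ?P" if "i \<in> A" for i
    using measurable_component_singleton[OF that, of "\<lambda>_. lborel"] by simp
  have G_meas[measurable]: "(\<lambda>z. \<Prod>i\<in>A. F (snd z i) (fst z)) \<in> borel_measurable (M \<Otimes>\<^sub>M ?P)"
    by (intro borel_measurable_prod F_meas measurable_compose[OF measurable_snd comp]) auto
  have [measurable]: "(\<lambda>z. \<Prod>i\<in>A. \<bar>F (snd z i) (fst z)\<bar>) \<in> borel_measurable (M \<Otimes>\<^sub>M ?P)"
    using borel_measurable_abs[OF G_meas] by (simp add: abs_prod)
  have G_int: "integrable (M \<Otimes>\<^sub>M ?P) (\<lambda>z. \<Prod>i\<in>A. F (snd z i) (fst z))"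
  proof (rule integrableI_bounded)
    have "(\<integral>\<^sup>+z. ennreal (norm (\<Prod>i\<in>A. F (snd z i) (fst z))) \<partial>(M \<Otimes>\<^sub>M ?P))
      = (\<integral>\<^sup>+\<omega>. \<integral>\<^sup>+y. (\<Prod>i\<in>A. ennreal \<bar>F (y i) \<omega>\<bar>) \<partial>?P \<partial>M)"
      by (subst P.nn_integral_fst[symmetric]) (auto simp: abs_prod prod_ennreal)
    also have "\<dots> = (\<integral>\<^sup>+\<omega>. (\<Prod>i\<in>A. \<integral>\<^sup>+y. ennreal \<bar>F y \<omega>\<bar> \<partial>lborel) \<partial>M)"
      using A by (intro nn_integral_cong PS.product_nn_integral_prod) auto
    also have "\<dots> \<le> (\<integral>\<^sup>+\<omega>. (\<Prod>i\<in>A. ennreal R) \<partial>M)"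
      by (intro nn_integral_mono) (simp add: power_mono F_int)
    also have "\<dots> < \<infinity>" by (simp add: emeasure_space_1 power_less_top_ennreal)
    finally show "(\<integral>\<^sup>+z. ennreal (norm (\<Prod>i\<in>A. F (snd z i) (fst z))) \<partial>(M \<Otimes>\<^sub>M ?P)) < \<infinity>" .
  qed (rule G_meas)
  define X where "X \<omega> = (\<integral>y. F y \<omega> \<partial>lborel)" for \<omega>
  \<comment> \<open>The even power becomes an integral over \<open>2 * n\<close> copies of the space
    variable, so that the expectation can be taken at fixed points.\<close>
  have X_pow: "X \<omega> ^ (2 * n) = (\<integral>y. (\<Prod>i\<in>A. F (y i) \<omega>) \<partial>?P)" for \<omega>
    using PS.product_integral_prod[OF A(1), of "\<lambda>_ y. F y \<omega>"] F_integrable A by (simp add: X_def)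
  have X_int: "integrable M (\<lambda>\<omega>. X \<omega> ^ (2 * n))"
    unfolding X_pow using MP.integrable_fst'[OF G_int] by simp
  define H where "H j y = (\<Sum>l\<in>permutations_of_set A. iter_kernel (q j) l y 0 t)" for j y
  have H_meas: "H j \<in> borel_measurable ?P" if "j \<in> J" for j
    unfolding H_def using q_meas[OF that]
    by (intro borel_measurable_sum borel_measurable_iter_kernel[where I = A])
      (auto dest: permutations_of_setD intro!: measurable_ident_sets sets_PiM_lborel)
  have inner: "expectation (\<lambda>\<omega>. \<Prod>i\<in>A. F (y i) \<omega>) = (\<Prod>i\<in>A. f (y i)) * (\<Prod>j\<in>J. H j y)" for y
  proof -
    have "(\<lambda>\<omega>. \<Prod>i\<in>A. F (y i) \<omega>) = (\<lambda>\<omega>. (\<Prod>i\<in>A. f (y i)) * (\<Prod>j\<in>J. \<Prod>i\<in>A. smoothed_local_time (q j) t j (y i) \<omega>))"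
      by (intro ext) (simp add: F_def prod.distrib prod.swap[of _ A])
    then have "expectation (\<lambda>\<omega>. \<Prod>i\<in>A. F (y i) \<omega>)
       = (\<Prod>i\<in>A. f (y i)) * expectation (\<lambda>\<omega>. \<Prod>j\<in>J. \<Prod>i\<in>A. smoothed_local_time (q j) t j (y i) \<omega>)"
      by simp
    also have "expectation (\<lambda>\<omega>. \<Prod>j\<in>J. \<Prod>i\<in>A. smoothed_local_time (q j) t j (y i) \<omega>)
        = (\<Prod>j\<in>J. expectation (\<lambda>\<omega>. \<Prod>i\<in>A. smoothed_local_time (q j) t j (y i) \<omega>))"
      unfolding smoothed_local_time_def
      using A q_meas q_le t by (intro expectation_prod_path_functional) auto
    also have "\<dots> = (\<Prod>j\<in>J. H j y)"
    proof (intro prod.cong refl)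
      fix j assume j: "j \<in> J"
      show "expectation (\<lambda>\<omega>. \<Prod>i\<in>A. smoothed_local_time (q j) t j (y i) \<omega>) = H j y"
        unfolding smoothed_local_time_def H_def
        by (rule continuous_brownian_motion.expectation_prod_path_integral[OF bm[OF j] A(1) qc[OF j] q_le[OF j] t])
    qed
    finally show ?thesis .
  qed
  have "(\<integral>\<^sup>+\<omega>. ennreal (X \<omega> ^ (2 * n)) \<partial>M) = ennreal (expectation (\<lambda>\<omega>. X \<omega> ^ (2 * n)))"
    using X_int by (intro nn_integral_eq_integral) auto
  also have "expectation (\<lambda>\<omega>. X \<omega> ^ (2 * n)) = (\<integral>y. (\<Prod>i\<in>A. f (y i)) * (\<Prod>j\<in>J. H j y) \<partial>?P)"
    unfolding X_pow using MP.Fubini_integral[of "\<lambda>\<omega> y. \<Prod>i\<in>A. F (y i) \<omega>"] G_int inner by (simp add: case_prod_unfold)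
  \<comment> \<open>Absolute values enter only now, when the expectation has been computed exactly;
    the cancellation in the differences is preserved inside \<open>H\<close>.\<close>
  also have "ennreal \<dots> \<le> ennreal \<bar>\<integral>y. (\<Prod>i\<in>A. f (y i)) * (\<Prod>j\<in>J. H j y) \<partial>?P\<bar>"
    by (intro ennreal_leI) simp
  also have "\<dots> \<le> (\<integral>\<^sup>+y. ennreal \<bar>(\<Prod>i\<in>A. f (y i)) * (\<Prod>j\<in>J. H j y)\<bar> \<partial>?P)"
  proof (rule ennreal_abs_integral_le)
    show "(\<lambda>y. (\<Prod>i\<in>A. f (y i)) * (\<Prod>j\<in>J. H j y)) \<in> borel_measurable ?P"
      by (intro borel_measurable_times borel_measurable_prod H_meas measurable_compose[OF comp f])
  qed
  also have "\<dots> \<le> (\<integral>\<^sup>+y. ennreal (C ^ (2 * n)) * ennreal (\<Prod>j\<in>J. \<bar>H j y\<bar>) \<partial>?P)"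
  proof (intro nn_integral_mono)
    fix y
    have "(\<Prod>i\<in>A. \<bar>f (y i)\<bar>) \<le> (\<Prod>i\<in>A. C)" using C by (intro prod_mono) auto
    then have "(\<Prod>i\<in>A. \<bar>f (y i)\<bar>) * (\<Prod>j\<in>J. \<bar>H j y\<bar>) \<le> C ^ (2 * n) * (\<Prod>j\<in>J. \<bar>H j y\<bar>)"
      using A by (intro mult_right_mono prod_nonneg) auto
    then show "ennreal \<bar>(\<Prod>i\<in>A. f (y i)) * (\<Prod>j\<in>J. H j y)\<bar> \<le> ennreal (C ^ (2 * n)) * ennreal (\<Prod>j\<in>J. \<bar>H j y\<bar>)"
      using C0 by (simp add: abs_mult abs_prod ennreal_mult[symmetric] prod_nonneg ennreal_leI)
  qed
  also have "\<dots> = ennreal (C ^ (2 * n)) * (\<integral>\<^sup>+y. ennreal (\<Prod>j\<in>J. \<bar>H j y\<bar>) \<partial>?P)"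
    by (intro nn_integral_cmult measurable_compose[OF _ measurable_ennreal] borel_measurable_prod
        borel_measurable_abs H_meas)
  also have "\<dots> \<le> ennreal (C ^ (2 * n)) * ennreal (\<Prod>j\<in>J. fact (2 * n) * ((2 * \<kappa> j * c\<^sup>2) ^ n * exp (lam * t)))"
  proof (intro mult_left_mono nn_integral_prod_Hoelder J)
    fix j assume j: "j \<in> J"
    interpret Q: pair_kernel_bound "q j" K "\<kappa> j" lam c "card J" by (rule q[OF j])
    show "0 < fact (2 * n) * ((2 * \<kappa> j * c\<^sup>2) ^ n * exp (lam * t))"
      using Q.kappa Q.c by simp
    show "(\<integral>\<^sup>+y. ennreal (\<bar>H j y\<bar> ^ card J) \<partial>?P) \<le> ennreal ((fact (2 * n) * ((2 * \<kappa> j * c\<^sup>2) ^ n * exp (lam * t))) ^ card J)"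
      unfolding H_def by (rule Q.nn_integral_sum_iter_kernel_power_le[OF A t])
    show "(\<lambda>y. \<bar>H j y\<bar>) \<in> borel_measurable ?P" using H_meas[OF j] by measurable
  qed auto
  also have "\<dots> = ennreal (C ^ (2 * n) * (\<Prod>j\<in>J. fact (2 * n) * ((2 * \<kappa> j * c\<^sup>2) ^ n * exp (lam * t))))"
    using C0 by (intro ennreal_mult'[symmetric]) simp
  finally show ?thesis unfolding X_def F_def .
qed

end

section \<open>Approximation in the smoothing parameter\<close>

text \<open>Independence is a property of the joint law, which does not change under modifications
  on null sets.\<close>

lemma (in prob_space) indep_vars_cong_AE:
  assumes X: "indep_vars N X J" and Y: "\<And>j. j \<in> J \<Longrightarrow> Y j \<in> measurable M (N j)"
    and J: "finite J" and AE: "\<And>j. j \<in> J \<Longrightarrow> AE \<omega> in M. X j \<omega> = Y j \<omega>"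
  shows "indep_vars N Y J"
proof (cases "J = {}")
  case False
  have X_meas: "X j \<in> measurable M (N j)" if "j \<in> J" for j
    using X that by (auto simp: indep_vars_def2)
  have "AE \<omega> in M. \<forall>j\<in>J. X j \<omega> = Y j \<omega>"
    using AE J by (simp add: AE_finite_all)
  then have "AE \<omega> in M. (\<lambda>j\<in>J. Y j \<omega>) = (\<lambda>j\<in>J. X j \<omega>)"
    by eventually_elim (auto intro: restrict_ext)
  then have "distr M (PiM J N) (\<lambda>\<omega>. \<lambda>j\<in>J. Y j \<omega>) = distr M (PiM J N) (\<lambda>\<omega>. \<lambda>j\<in>J. X j \<omega>)"
    by (intro distr_cong_AE refl measurable_restrict Y X_meas)
  also have "\<dots> = PiM J (\<lambda>j. distr M (N j) (X j))"
    using X indep_vars_iff_distr_eq_PiM'[OF False X_meas] by simp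
  also have "\<dots> = PiM J (\<lambda>j. distr M (N j) (Y j))"
    using AE by (intro PiM_cong refl distr_cong_AE X_meas Y)
  finally show ?thesis
    using indep_vars_iff_distr_eq_PiM'[OF False Y] by simp
qed (simp add: indep_vars_def2 indep_sets_def)

lemma independent_continuous_modification:
  fixes W :: "nat \<Rightarrow> real \<Rightarrow> 'w \<Rightarrow> real ^ 'd"
  assumes M: "prob_space M" and p: "p \<ge> 1" and W: "independent_brownian_motions M p W"
  obtains V where "independent_continuous_bm M {1..p} V"
    "AE \<omega> in M. \<forall>j\<in>{1..p}. \<forall>s\<ge>0. V j s \<omega> = W j s \<omega>"
proof -
  interpret prob_space M by (rule M)
  have "\<forall>j\<in>{1..p}. \<exists>V. continuous_brownian_motion M V \<and> (AE \<omega> in M. \<forall>s\<ge>0. V s \<omega> = W j s \<omega>)"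
  proof
    fix j assume "j \<in> {1..p}"
    with W have "standard_brownian_motion M (W j)" by (simp add: independent_brownian_motions_def)
    then obtain V where "continuous_brownian_motion M V" "AE \<omega> in M. \<forall>s\<ge>0. V s \<omega> = W j s \<omega>"
      by (rule continuous_modification)
    then show "\<exists>V. continuous_brownian_motion M V \<and> (AE \<omega> in M. \<forall>s\<ge>0. V s \<omega> = W j s \<omega>)" by blast
  qed
  from bchoice[OF this] obtain V where V: "\<And>j. j \<in> {1..p} \<Longrightarrow> continuous_brownian_motion M (V j)"
    "\<And>j. j \<in> {1..p} \<Longrightarrow> AE \<omega> in M. \<forall>s\<ge>0. V j s \<omega> = W j s \<omega>"
    by blast
  have "indep_vars (\<lambda>_. \<Pi>\<^sub>M s\<in>{0..}. borel) (\<lambda>j \<omega>. \<lambda>s\<in>{0..}. W j s \<omega>) {1..p}"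
    using W by (simp add: independent_brownian_motions_def)
  then have "indep_vars (\<lambda>_. \<Pi>\<^sub>M s\<in>{0..}. borel) (\<lambda>j \<omega>. \<lambda>s\<in>{0..}. V j s \<omega>) {1..p}"
  proof (rule indep_vars_cong_AE)
    fix j assume j: "j \<in> {1..p}"
    show "(\<lambda>\<omega>. \<lambda>s\<in>{0..}. V j s \<omega>) \<in> measurable M (\<Pi>\<^sub>M s\<in>{0..}. borel)"
      using continuous_brownian_motion.V_measurable[OF V(1)[OF j]] by (intro measurable_restrict)
    show "AE \<omega> in M. (\<lambda>s\<in>{0..}. W j s \<omega>) = (\<lambda>s\<in>{0..}. V j s \<omega>)"
      using V(2)[OF j] by eventually_elim (auto intro!: restrict_ext)
  qed simp
  with V(1) p have "independent_continuous_bm M {1..p} V"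
    by (intro independent_continuous_bm.intro prob_space_axioms independent_continuous_bm_axioms.intro) auto
  moreover have "AE \<omega> in M. \<forall>j\<in>{1..p}. \<forall>s\<ge>0. V j s \<omega> = W j s \<omega>"
    using V(2) by (intro AE_ball_countable[THEN iffD2]) auto
  ultimately show thesis by (rule that)
qed

lemma prod_diff_telescope:
  fixes a b :: "nat \<Rightarrow> 'a::comm_ring_1"
  shows "(\<Prod>j\<in>{1..p}. a j) - (\<Prod>j\<in>{1..p}. b j)
    = (\<Sum>i\<in>{1..p}. \<Prod>j\<in>{1..p}. if j < i then a j else if j = i then a j - b j else b j)"
proof (induction p)
  case (Suc p)
  let ?c = "\<lambda>i j. if j < i then a j else if j = i then a j - b j else b j"
  have "(\<Sum>i\<in>{1..Suc p}. \<Prod>j\<in>{1..Suc p}. ?c i j)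
    = (\<Sum>i\<in>{1..p}. \<Prod>j\<in>{1..Suc p}. ?c i j) + (\<Prod>j\<in>{1..Suc p}. ?c (Suc p) j)"
    by simp
  also have "(\<Sum>i\<in>{1..p}. \<Prod>j\<in>{1..Suc p}. ?c i j) = (\<Sum>i\<in>{1..p}. (\<Prod>j\<in>{1..p}. ?c i j) * b (Suc p))"
    by (intro sum.cong refl) simp
  also have "\<dots> = ((\<Prod>j\<in>{1..p}. a j) - (\<Prod>j\<in>{1..p}. b j)) * b (Suc p)"
    unfolding Suc by (simp add: sum_distrib_right)
  also have "(\<Prod>j\<in>{1..Suc p}. ?c (Suc p) j) = (\<Prod>j\<in>{1..p}. a j) * (a (Suc p) - b (Suc p))"
    by simp
  finally show ?case by (simp add: algebra_simps)
qed simp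

text \<open>The value of \<open>\<kappa>\<close> for a difference of heat kernels with parameters at
  most \<open>e\<close>.\<close>

definition diff_rate :: "nat \<Rightarrow> nat \<Rightarrow> real \<Rightarrow> real" where
  "diff_rate d p e = 12 * (real d * e / 8) powr (1 / (4 * real p))"

text \<open>The base of the geometric part of the moment of order 2n. The factor \<open>p\<close>
  squared comes from the \<open>p\<close> telescoped terms and \<open>C\<close> squared from
  \<open>f\<close>. The \<open>p - 1\<close> undifferenced motions give \<open>4 * c\<^sup>2\<close>
  each, as \<open>2 * \<kappa> * c\<^sup>2\<close> with \<open>\<kappa> = 2\<close>, and the
  differenced one gives the last factor.\<close>

definition moment_rate :: "nat \<Rightarrow> nat \<Rightarrow> real \<Rightarrow> real \<Rightarrow> real \<Rightarrow> real" where
  "moment_rate d p C c e = (real p)\<^sup>2 * C\<^sup>2 * ((4 * c\<^sup>2) ^ (p - 1) * (2 * diff_rate d p e * c\<^sup>2))"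

lemma exists_time_weight_bound:
  assumes "p \<ge> 1" "d * (p - 1) < 2 * p" "lam > 0"
  obtains c where "c > 0"
    "(\<integral>\<^sup>+r. ennreal (exp (- lam * r) * time_weight d p r) * indicator {0<..} r \<partial>lborel) \<le> ennreal c"
proof -
  have "(\<integral>\<^sup>+r. ennreal (exp (- lam * r) * time_weight d p r) * indicator {0<..} r \<partial>lborel) < \<infinity>" (is "?I < _")
    by (rule nn_integral_exp_time_weight_finite[OF assms])
  then have "?I = ennreal (enn2real ?I)" by (simp add: less_top)
  also have "\<dots> \<le> ennreal (enn2real ?I + 1)" by (intro ennreal_leI) simp
  finally show thesis by (intro that[of "enn2real ?I + 1"]) (simp_all add: add_nonneg_pos)
qed

context
  fixes p :: nat and lam c K e :: real
  assumes p: "p \<ge> 1" and lam: "lam > 0" and c: "c > 0" and e: "e > 0"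
begin

lemma pair_kernel_bound_heat:
  assumes w: "(\<integral>\<^sup>+r. ennreal (exp (- lam * r) * time_weight CARD('d::finite) p r) * indicator {0<..} r \<partial>lborel) \<le> ennreal c"
    and K: "\<And>x :: real ^ 'd. heat_kernel e x \<le> K"
  shows "pair_kernel_bound (heat_kernel e :: real ^ 'd \<Rightarrow> real) K 2 lam c p"
proof
  show "(\<integral>\<^sup>+y. \<integral>\<^sup>+v. ennreal (\<bar>pair_kernel (heat_kernel e) r r' x y v\<bar> ^ p) \<partial>lborel \<partial>lborel)
      \<le> ennreal ((2 * time_weight CARD('d) p r * time_weight CARD('d) p r') ^ p)"
    if "0 < r" "0 < r'" for r r' and x :: "real ^ 'd"
    by (rule nn_integral_heat_pair_kernel_le[OF that e p])
qed (use p lam c e K w in auto)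

lemma pair_kernel_bound_heat_diff:
  assumes w: "(\<integral>\<^sup>+r. ennreal (exp (- lam * r) * time_weight CARD('d::finite) p r) * indicator {0<..} r \<partial>lborel) \<le> ennreal c"
    and e': "0 < e'" "e' \<le> e"
    and K: "\<And>x :: real ^ 'd. heat_kernel e x \<le> K" "\<And>x :: real ^ 'd. heat_kernel e' x \<le> K"
  shows "pair_kernel_bound (\<lambda>x :: real ^ 'd. heat_kernel e' x - heat_kernel e x) K (diff_rate CARD('d) p e) lam c p"
proof
  show "(\<integral>\<^sup>+y. \<integral>\<^sup>+v. ennreal (\<bar>pair_kernel (\<lambda>x. heat_kernel e' x - heat_kernel e x) r r' x y v\<bar> ^ p) \<partial>lborel \<partial>lborel)
      \<le> ennreal ((diff_rate CARD('d) p e * time_weight CARD('d) p r * time_weight CARD('d) p r') ^ p)"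
    if "0 < r" "0 < r'" for r r' and x :: "real ^ 'd"
    unfolding diff_rate_def by (rule nn_integral_heat_diff_pair_kernel_le[OF that e' p])
  show "\<bar>heat_kernel e' x - heat_kernel e x\<bar> \<le> K" for x :: "real ^ 'd"
    using K[of x] heat_kernel_nonneg[of e x] heat_kernel_nonneg[of e' x] by linarith
  show "(\<integral>\<^sup>+x. ennreal \<bar>heat_kernel e' x - heat_kernel e (x :: real ^ 'd)\<bar> \<partial>lborel) \<le> 2"
    by (rule nn_integral_heat_kernel_diff_le[OF e'(1) e])
  show "diff_rate CARD('d) p e > 0" using e by (simp add: diff_rate_def)
qed (use p lam c w in auto)

end

context independent_continuous_bm
begin

definition smoothed_pairing :: "(real ^ 'd \<Rightarrow> real) \<Rightarrow> real \<Rightarrow> real \<Rightarrow> 'w \<Rightarrow> real" where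
  "smoothed_pairing f t e \<omega> = (\<integral>y. f y * (\<Prod>j\<in>J. smoothed_local_time (heat_kernel e) t j y \<omega>) \<partial>lborel)"

lemma integrable_prod_smoothed_local_time:
  fixes f :: "real ^ 'd \<Rightarrow> real"
  assumes [measurable]: "f \<in> borel_measurable borel" and C: "\<And>x. \<bar>f x\<bar> \<le> C"
    and q_meas: "\<And>j. j \<in> J \<Longrightarrow> q j \<in> borel_measurable borel" and q_le: "\<And>j x. j \<in> J \<Longrightarrow> \<bar>q j x\<bar> \<le> K"
    and q_mass: "\<And>j. j \<in> J \<Longrightarrow> (\<integral>\<^sup>+x. ennreal \<bar>q j x\<bar> \<partial>lborel) \<le> 2" and t: "0 \<le> t"
  shows "integrable lborel (\<lambda>y. f y * (\<Prod>j\<in>J. smoothed_local_time (q j) t j y \<omega>))"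
proof (rule integrableI_bounded)
  have [measurable]: "(\<lambda>y. smoothed_local_time (q j) t j y \<omega>) \<in> borel_measurable borel" if "j \<in> J" for j
    using that q_meas by (intro smoothed_local_time_measurable_omega) auto
  show "(\<lambda>y. f y * (\<Prod>j\<in>J. smoothed_local_time (q j) t j y \<omega>)) \<in> borel_measurable lborel" by measurable
  show "(\<integral>\<^sup>+y. ennreal (norm (f y * (\<Prod>j\<in>J. smoothed_local_time (q j) t j y \<omega>))) \<partial>lborel) < \<infinity>"
    using nn_integral_prod_smoothed_local_time_le[of f C q K t \<omega>, OF C q_meas q_le q_mass t]
    by (auto intro: le_less_trans)
qed

lemma smoothed_pairing_measurable:
  assumes [measurable]: "f \<in> borel_measurable borel"
  shows "smoothed_pairing f t e \<in> borel_measurable M"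
proof -
  have [measurable]: "(\<lambda>z. smoothed_local_time (heat_kernel e) t j (snd z) (fst z)) \<in> borel_measurable (M \<Otimes>\<^sub>M lborel)"
    if "j \<in> J" for j
    using that by (intro smoothed_local_time_measurable) auto
  show ?thesis unfolding smoothed_pairing_def by measurable
qed

end

locale independent_continuous_bm_nat = independent_continuous_bm M "{1..p}" V
  for M :: "'w measure" and p :: nat and V :: "nat \<Rightarrow> real \<Rightarrow> 'w \<Rightarrow> real ^ 'd"
begin

lemma p_ge: "p \<ge> 1"
  using J by simp

lemma smoothed_local_time_diff:
  assumes j: "j \<in> {1..p}" and [measurable]: "a \<in> borel_measurable borel" "b \<in> borel_measurable borel"
    and K: "\<And>x. \<bar>a x\<bar> \<le> K" "\<And>x. \<bar>b x\<bar> \<le> K"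
  shows "smoothed_local_time (\<lambda>x. a x - b x) t j y \<omega> = smoothed_local_time a t j y \<omega> - smoothed_local_time b t j y \<omega>"
proof -
  have [measurable]: "(\<lambda>u. V j u \<omega>) \<in> borel_measurable borel"
    using V_cont[OF j] by (intro borel_measurable_continuous_onI)
  show ?thesis
    unfolding smoothed_local_time_def right_diff_distrib
    using K by (intro Bochner_Integration.integral_diff integrable_bounded_Icc) auto
qed

text \<open>Each of the \<open>p\<close> telescoped terms contains exactly one differenced motion,
  and all of them have the same moment bound. The right-hand side depends on \<open>e\<close> alone,
  which permits the limit in \<open>e'\<close>.\<close>

lemma smoothed_pairing_diff_moment_le:
  fixes f :: "real ^ 'd \<Rightarrow> real"
  assumes f: "f \<in> borel_measurable borel" and C: "\<And>x. \<bar>f x\<bar> \<le> C"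
    and e: "0 < e'" "e' \<le> e" and t: "0 \<le> t" and lam: "lam > 0" and c: "c > 0"
    and w: "(\<integral>\<^sup>+r. ennreal (exp (- lam * r) * time_weight CARD('d) p r) * indicator {0<..} r \<partial>lborel) \<le> ennreal c"
  shows "(\<integral>\<^sup>+\<omega>. ennreal (\<bar>smoothed_pairing f t e' \<omega> - smoothed_pairing f t e \<omega>\<bar> ^ (2 * n)) \<partial>M)
    \<le> ennreal (fact (2 * n) ^ p * exp (real p * lam * t) * moment_rate CARD('d) p C c e ^ n)"
proof (cases "n = 0")
  case True
  have "1 \<le> exp (real p * lam * t)" using lam t by simp
  then show ?thesis using True by (simp add: emeasure_space_1)
next
  case False
  let ?h = "heat_kernel e :: real ^ 'd \<Rightarrow> real" and ?h' = "heat_kernel e' :: real ^ 'd \<Rightarrow> real"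
  have e0: "0 < e" using e by simp
  have C0: "0 \<le> C" using C[of 0] by linarith
  \<comment> \<open>A common bound for both kernels. It explodes as \<open>e'\<close> tends to 0 but
    does not reach the moment bound.\<close>
  define K where "K = (2 * pi * e) powr (- (real CARD('d) / 2)) + (2 * pi * e') powr (- (real CARD('d) / 2))"
  have K: "?h x \<le> K" "?h' x \<le> K" for x
    using heat_kernel_le[OF e0, of x] heat_kernel_le[OF e(1), of x] by (auto simp: K_def add_increasing add_increasing2)
  define q where "q i j = (if j < i then ?h' else if j = i then (\<lambda>x. ?h' x - ?h x) else ?h)" for i j :: nat
  define \<kappa> where "\<kappa> i j = (if j = i then diff_rate CARD('d) p e else 2)" for i j :: nat
  have pkb: "pair_kernel_bound (q i j) K (\<kappa> i j) lam c (card {1..p})" for i j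
    using pair_kernel_bound_heat[OF p_ge lam c e0 w K(1)] pair_kernel_bound_heat[OF p_ge lam c e(1) w K(2)]
      pair_kernel_bound_heat_diff[OF p_ge lam c e0 w e K]
    by (auto simp: q_def \<kappa>_def)
  have qc: "continuous_on UNIV (q i j)" for i j
    using e0 e(1) by (auto simp: q_def intro!: continuous_intros)
  have q_meas: "q i j \<in> borel_measurable borel" and q_le: "\<bar>q i j x\<bar> \<le> K"
    and q_mass: "(\<integral>\<^sup>+x. ennreal \<bar>q i j x\<bar> \<partial>lborel) \<le> 2" for i j x
    using pkb[of i j] by (auto simp: pair_kernel_bound_def)
  define X where "X i \<omega> = (\<integral>y. f y * (\<Prod>j\<in>{1..p}. smoothed_local_time (q i j) t j y \<omega>) \<partial>lborel)" for i \<omega>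
  have int: "integrable lborel (\<lambda>y. f y * (\<Prod>j\<in>{1..p}. smoothed_local_time (q i j) t j y \<omega>))" for i \<omega>
    using q_meas q_le q_mass by (intro integrable_prod_smoothed_local_time[OF f C _ _ _ t, of _ K]) auto
  have int_h: "integrable lborel (\<lambda>y. f y * (\<Prod>j\<in>{1..p}. smoothed_local_time ?h t j y \<omega>))"
    and int_h': "integrable lborel (\<lambda>y. f y * (\<Prod>j\<in>{1..p}. smoothed_local_time ?h' t j y \<omega>))" for \<omega>
    using e e0 K by (intro integrable_prod_smoothed_local_time[OF f C _ _ _ t, of _ K]; simp)+
  have tele: "smoothed_pairing f t e' \<omega> - smoothed_pairing f t e \<omega> = (\<Sum>i\<in>{1..p}. X i \<omega>)" for \<omega>
  proof -
    have "smoothed_pairing f t e' \<omega> - smoothed_pairing f t e \<omega>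
      = (\<integral>y. f y * ((\<Prod>j\<in>{1..p}. smoothed_local_time ?h' t j y \<omega>) - (\<Prod>j\<in>{1..p}. smoothed_local_time ?h t j y \<omega>)) \<partial>lborel)"
      unfolding smoothed_pairing_def right_diff_distrib
      by (rule Bochner_Integration.integral_diff[OF int_h' int_h, symmetric])
    also have "\<dots> = (\<integral>y. (\<Sum>i\<in>{1..p}. f y * (\<Prod>j\<in>{1..p}. smoothed_local_time (q i j) t j y \<omega>)) \<partial>lborel)"
    proof (intro Bochner_Integration.integral_cong refl)
      fix y
      have "(\<Prod>j\<in>{1..p}. smoothed_local_time ?h' t j y \<omega>) - (\<Prod>j\<in>{1..p}. smoothed_local_time ?h t j y \<omega>)
        = (\<Sum>i\<in>{1..p}. \<Prod>j\<in>{1..p}. smoothed_local_time (q i j) t j y \<omega>)"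
        unfolding prod_diff_telescope
      proof (intro sum.cong prod.cong refl)
        fix i j assume "j \<in> {1..p}"
        then show "(if j < i then smoothed_local_time ?h' t j y \<omega>
            else if j = i then smoothed_local_time ?h' t j y \<omega> - smoothed_local_time ?h t j y \<omega>
            else smoothed_local_time ?h t j y \<omega>) = smoothed_local_time (q i j) t j y \<omega>"
          using K by (auto simp: q_def smoothed_local_time_diff[of _ ?h' ?h K])
      qed
      then show "f y * ((\<Prod>j\<in>{1..p}. smoothed_local_time ?h' t j y \<omega>) - (\<Prod>j\<in>{1..p}. smoothed_local_time ?h t j y \<omega>))
        = (\<Sum>i\<in>{1..p}. f y * (\<Prod>j\<in>{1..p}. smoothed_local_time (q i j) t j y \<omega>))"
        by (simp add: sum_distrib_left)
    qed
    also have "\<dots> = (\<Sum>i\<in>{1..p}. X i \<omega>)"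
      unfolding X_def by (rule Bochner_Integration.integral_sum) (rule int)
    finally show ?thesis .
  qed
  have X_meas[measurable]: "X i \<in> borel_measurable M" for i
  proof -
    have [measurable]: "(\<lambda>z. smoothed_local_time (q i j) t j (snd z) (fst z)) \<in> borel_measurable (M \<Otimes>\<^sub>M lborel)"
      if "j \<in> {1..p}" for j
      using that q_meas by (intro smoothed_local_time_measurable) auto
    note f[measurable]
    show ?thesis unfolding X_def by measurable
  qed
  define B where "B = C ^ (2 * n) * (fact (2 * n) ^ p * exp (real p * lam * t) * ((4 * c\<^sup>2) ^ (p - 1) * (2 * diff_rate CARD('d) p e * c\<^sup>2)) ^ n)"
  have dr: "0 \<le> diff_rate CARD('d) p e" by (simp add: diff_rate_def)
  have B0: "0 \<le> B" using C0 dr by (simp add: B_def)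
  have XB: "(\<integral>\<^sup>+\<omega>. ennreal (X i \<omega> ^ (2 * n)) \<partial>M) \<le> ennreal B" if i: "i \<in> {1..p}" for i
  proof -
    have "(\<Prod>j\<in>{1..p}. fact (2 * n) * ((2 * \<kappa> i j * c\<^sup>2) ^ n * exp (lam * t)))
      = fact (2 * n) ^ p * exp (lam * t) ^ p * (\<Prod>j\<in>{1..p}. 2 * \<kappa> i j * c\<^sup>2) ^ n"
      by (simp only: prod.distrib prod_power_distrib[symmetric] prod_constant card_atLeastAtMost diff_Suc_1 mult_ac)
    also have "exp (lam * t) ^ p = exp (real p * lam * t)"
      by (simp add: exp_of_nat_mult[symmetric] mult.assoc)
    also have "(\<Prod>j\<in>{1..p}. 2 * \<kappa> i j * c\<^sup>2) = (2 * \<kappa> i i * c\<^sup>2) * (\<Prod>j\<in>{1..p} - {i}. 2 * \<kappa> i j * c\<^sup>2)"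
      using i by (intro prod.remove) auto
    also have "(\<Prod>j\<in>{1..p} - {i}. 2 * \<kappa> i j * c\<^sup>2) = (\<Prod>j\<in>{1..p} - {i}. 4 * c\<^sup>2)"
      by (intro prod.cong) (auto simp: \<kappa>_def)
    also have "\<dots> = (4 * c\<^sup>2) ^ (p - 1)" using i by simp
    finally have "C ^ (2 * n) * (\<Prod>j\<in>{1..p}. fact (2 * n) * ((2 * \<kappa> i j * c\<^sup>2) ^ n * exp (lam * t))) = B"
      by (simp add: B_def \<kappa>_def mult.commute)
    then show ?thesis
      unfolding X_def using even_moment_le[where q = "q i" and \<kappa> = "\<kappa> i" and n = n, OF f C pkb qc t] by simp
  qed
  have "(\<integral>\<^sup>+\<omega>. ennreal (\<bar>smoothed_pairing f t e' \<omega> - smoothed_pairing f t e \<omega>\<bar> ^ (2 * n)) \<partial>M)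
     \<le> (\<integral>\<^sup>+\<omega>. ennreal (real p ^ (2 * n - 1)) * (\<Sum>i\<in>{1..p}. ennreal (X i \<omega> ^ (2 * n))) \<partial>M)"
  proof (intro nn_integral_mono)
    fix \<omega>
    have "\<bar>smoothed_pairing f t e' \<omega> - smoothed_pairing f t e \<omega>\<bar> ^ (2 * n) \<le> (\<Sum>i\<in>{1..p}. \<bar>X i \<omega>\<bar>) ^ (2 * n)"
      unfolding tele by (intro power_mono sum_abs) auto
    also have "\<dots> \<le> real p ^ (2 * n - 1) * (\<Sum>i\<in>{1..p}. \<bar>X i \<omega>\<bar> ^ (2 * n))"
      using sum_power_le_card_power[of "{1..p}" "2 * n" "\<lambda>i. \<bar>X i \<omega>\<bar>"] False by simp
    also have "\<dots> = real p ^ (2 * n - 1) * (\<Sum>i\<in>{1..p}. X i \<omega> ^ (2 * n))"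
      by (simp add: power_even_abs)
    finally show "ennreal (\<bar>smoothed_pairing f t e' \<omega> - smoothed_pairing f t e \<omega>\<bar> ^ (2 * n))
       \<le> ennreal (real p ^ (2 * n - 1)) * (\<Sum>i\<in>{1..p}. ennreal (X i \<omega> ^ (2 * n)))"
      by (simp add: ennreal_mult[symmetric] sum_nonneg ennreal_leI)
  qed
  also have "\<dots> = ennreal (real p ^ (2 * n - 1)) * (\<Sum>i\<in>{1..p}. \<integral>\<^sup>+\<omega>. ennreal (X i \<omega> ^ (2 * n)) \<partial>M)"
    by (simp add: nn_integral_cmult nn_integral_sum del: sum_ennreal)
  also have "\<dots> \<le> ennreal (real p ^ (2 * n - 1)) * (\<Sum>i\<in>{1..p}. ennreal B)"
    by (intro mult_left_mono sum_mono XB) auto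
  also have "\<dots> = ennreal (real p ^ (2 * n - 1) * (real p * B))"
    using B0 by (simp add: ennreal_of_nat_eq_real_of_nat ennreal_mult)
  also have "real p ^ (2 * n - 1) * (real p * B) = real p ^ (2 * n) * B"
    using False by (cases n) auto
  also have "\<dots> = fact (2 * n) ^ p * exp (real p * lam * t) * moment_rate CARD('d) p C c e ^ n"
    by (simp add: B_def moment_rate_def power_mult_distrib power_mult[symmetric] mult_ac)
  finally show ?thesis .
qed

section \<open>Smoothed intersection measure as a product of smoothed local times\<close>

lemma nn_integral_smoothed_local_time_eq:
  assumes j: "j \<in> {1..p}" and e: "e > 0"
  shows "(\<integral>\<^sup>+u. ennreal (heat_kernel e (V j u \<omega> - y)) * indicator {0..t} u \<partial>lborel)
    = ennreal (smoothed_local_time (heat_kernel e) t j y \<omega>)"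
proof -
  have [measurable]: "(\<lambda>u. V j u \<omega>) \<in> borel_measurable borel"
    using V_cont[OF j] by (intro borel_measurable_continuous_onI)
  have "(\<integral>\<^sup>+u. ennreal (heat_kernel e (V j u \<omega> - y)) * indicator {0..t} u \<partial>lborel)
    = (\<integral>\<^sup>+u. ennreal (indicator {0..t} u * heat_kernel e (V j u \<omega> - y)) \<partial>lborel)"
    by (intro nn_integral_cong) (auto simp: indicator_def)
  also have "\<dots> = ennreal (smoothed_local_time (heat_kernel e) t j y \<omega>)"
    unfolding smoothed_local_time_def using heat_kernel_le[OF e]
    by (intro nn_integral_eq_integral integrable_bounded_Icc AE_I2) auto
  finally show ?thesis .
qed

lemma smoothed_local_time_nonneg: "0 \<le> smoothed_local_time (heat_kernel e) t j y \<omega>"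
  unfolding smoothed_local_time_def by (intro Bochner_Integration.integral_nonneg) simp

definition smoothed_measure :: "real \<Rightarrow> real \<Rightarrow> 'w \<Rightarrow> (real ^ 'd) measure" where
  "smoothed_measure t e \<omega> = density lborel (\<lambda>y. ennreal (\<Prod>j\<in>{1..p}. smoothed_local_time (heat_kernel e) t j y \<omega>))"

lemma smoothed_density_measurable:
  "(\<lambda>y. \<Prod>j\<in>{1..p}. smoothed_local_time (heat_kernel e) t j y \<omega>) \<in> borel_measurable borel"
  by (intro borel_measurable_prod smoothed_local_time_measurable_omega) auto

lemma integral_smoothed_measure:
  assumes f: "f \<in> borel_measurable borel"
  shows "(\<integral>x. f x \<partial>smoothed_measure t e \<omega>) = smoothed_pairing f t e \<omega>"
proof -
  have "(\<integral>x. f x \<partial>smoothed_measure t e \<omega>)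
    = (\<integral>y. (\<Prod>j\<in>{1..p}. smoothed_local_time (heat_kernel e) t j y \<omega>) *\<^sub>R f y \<partial>lborel)"
    unfolding smoothed_measure_def using f smoothed_density_measurable
    by (intro integral_density) (auto intro!: AE_I2 prod_nonneg smoothed_local_time_nonneg)
  then show ?thesis unfolding smoothed_pairing_def real_scaleR_def by (simp only: mult.commute)
qed

text \<open>The integral over the time cube factors by Tonelli's theorem. Elements of the product
  space are extensional, so membership in the cube is a condition on the coordinates alone.\<close>

lemma smoothed_intersection_measure_eq:
  fixes W :: "nat \<Rightarrow> real \<Rightarrow> 'w \<Rightarrow> real ^ 'd"
  assumes e: "e > 0" and eq: "\<And>j s. j \<in> {1..p} \<Longrightarrow> 0 \<le> s \<Longrightarrow> V j s \<omega> = W j s \<omega>"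
  shows "smoothed_intersection_measure p W t e \<omega> = smoothed_measure t e \<omega>"
proof -
  interpret product_sigma_finite "\<lambda>_ :: nat. lborel :: real measure" by standard
  have "(\<integral>\<^sup>+s\<in>(\<Pi>\<^sub>E j\<in>{1..p}. {0..t}). ennreal (\<Prod>j\<in>{1..p}. heat_kernel e (W j (s j) \<omega> - y)) \<partial>(\<Pi>\<^sub>M j\<in>{1..p}. lborel))
    = ennreal (\<Prod>j\<in>{1..p}. smoothed_local_time (heat_kernel e) t j y \<omega>)" for y
  proof -
    have "(\<integral>\<^sup>+s\<in>(\<Pi>\<^sub>E j\<in>{1..p}. {0..t}). ennreal (\<Prod>j\<in>{1..p}. heat_kernel e (W j (s j) \<omega> - y)) \<partial>(\<Pi>\<^sub>M j\<in>{1..p}. lborel))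
      = (\<integral>\<^sup>+s. (\<Prod>j\<in>{1..p}. ennreal (heat_kernel e (V j (s j) \<omega> - y)) * indicator {0..t} (s j)) \<partial>(\<Pi>\<^sub>M j\<in>{1..p}. lborel))"
    proof (intro nn_integral_cong)
      fix s :: "nat \<Rightarrow> real" assume s: "s \<in> space (\<Pi>\<^sub>M j\<in>{1..p}. lborel)"
      show "ennreal (\<Prod>j\<in>{1..p}. heat_kernel e (W j (s j) \<omega> - y)) * indicator (\<Pi>\<^sub>E j\<in>{1..p}. {0..t}) s
        = (\<Prod>j\<in>{1..p}. ennreal (heat_kernel e (V j (s j) \<omega> - y)) * indicator {0..t} (s j))"
      proof (cases "\<forall>j\<in>{1..p}. s j \<in> {0..t}")
        case True
        then have "s \<in> (\<Pi>\<^sub>E j\<in>{1..p}. {0..t})" using s by (auto simp: space_PiM PiE_iff)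
        then show ?thesis using True by (auto simp: prod_ennreal eq intro!: prod.cong)
      next
        case False
        then have "s \<notin> (\<Pi>\<^sub>E j\<in>{1..p}. {0..t})" by auto
        moreover have "(\<Prod>j\<in>{1..p}. ennreal (heat_kernel e (V j (s j) \<omega> - y)) * indicator {0..t} (s j)) = 0"
        proof (rule prod_zero)
          from False obtain j where "j \<in> {1..p}" "s j \<notin> {0..t}" by blast
          then show "\<exists>j\<in>{1..p}. ennreal (heat_kernel e (V j (s j) \<omega> - y)) * indicator {0..t} (s j) = 0"
            by (intro bexI[of _ j]) (auto simp: indicator_def)
        qed simp
        ultimately show ?thesis by simp
      qed
    qed
    also have "\<dots> = (\<Prod>j\<in>{1..p}. \<integral>\<^sup>+u. ennreal (heat_kernel e (V j u \<omega> - y)) * indicator {0..t} u \<partial>lborel)"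
    proof (rule product_nn_integral_prod)
      fix j assume "j \<in> {1..p}"
      then have [measurable]: "(\<lambda>u. V j u \<omega>) \<in> borel_measurable borel"
        using V_cont by (intro borel_measurable_continuous_onI)
      show "(\<lambda>u. ennreal (heat_kernel e (V j u \<omega> - y)) * indicator {0..t} u) \<in> borel_measurable lborel" by measurable
    qed simp
    also have "\<dots> = ennreal (\<Prod>j\<in>{1..p}. smoothed_local_time (heat_kernel e) t j y \<omega>)"
      using e by (simp add: nn_integral_smoothed_local_time_eq prod_ennreal smoothed_local_time_nonneg)
    finally show ?thesis .
  qed
  then show ?thesis by (simp add: smoothed_intersection_measure_def smoothed_measure_def)
qed

lemma integral_smoothed_intersection_measure:
  fixes W :: "nat \<Rightarrow> real \<Rightarrow> 'w \<Rightarrow> real ^ 'd" and f :: "real ^ 'd \<Rightarrow> real"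
  assumes e: "e > 0" and f: "f \<in> borel_measurable borel"
    and eq: "\<And>j s. j \<in> {1..p} \<Longrightarrow> 0 \<le> s \<Longrightarrow> V j s \<omega> = W j s \<omega>"
  shows "(\<integral>x. f x \<partial>smoothed_intersection_measure p W t e \<omega>) = smoothed_pairing f t e \<omega>"
  using smoothed_intersection_measure_eq[OF e, of \<omega> W t] eq integral_smoothed_measure[OF f, of t e \<omega>]
  by simp

end

section \<open>Random measures and approximation by continuous functions\<close>

lemma random_measure_nn_integral_measurable:
  fixes \<kappa> :: "'w \<Rightarrow> 'b::topological_space measure" and f :: "'b \<Rightarrow> ennreal"
  assumes sets: "\<And>\<omega>. \<omega> \<in> space M \<Longrightarrow> sets (\<kappa> \<omega>) = sets borel"
    and meas: "\<And>A. A \<in> sets borel \<Longrightarrow> (\<lambda>\<omega>. emeasure (\<kappa> \<omega>) A) \<in> borel_measurable M"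
    and f: "f \<in> borel_measurable borel"
  shows "(\<lambda>\<omega>. \<integral>\<^sup>+x. f x \<partial>\<kappa> \<omega>) \<in> borel_measurable M"
  using f
proof (induction rule: borel_measurable_induct[case_names cong set mult add sup])
  case (cong f g)
  then have "f = g" by auto
  with cong show ?case by simp
next
  case (set A)
  then have "(\<integral>\<^sup>+x. indicator A x \<partial>\<kappa> \<omega>) = emeasure (\<kappa> \<omega>) A" if "\<omega> \<in> space M" for \<omega>
    using sets[OF that] by (intro nn_integral_indicator) simp
  then show ?case using meas[OF set] by (simp cong: measurable_cong)
next
  case (mult u c)
  have "(\<integral>\<^sup>+x. c * u x \<partial>\<kappa> \<omega>) = c * (\<integral>\<^sup>+x. u x \<partial>\<kappa> \<omega>)" if "\<omega> \<in> space M" for \<omega>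
    using mult(2) sets[OF that] by (intro nn_integral_cmult) (simp cong: measurable_cong_sets)
  then show ?case using mult(4) by (simp cong: measurable_cong)
next
  case (add u v)
  have uv: "u \<in> borel_measurable borel" "v \<in> borel_measurable borel" using add by auto
  have "(\<integral>\<^sup>+x. v x + u x \<partial>\<kappa> \<omega>) = (\<integral>\<^sup>+x. v x \<partial>\<kappa> \<omega>) + (\<integral>\<^sup>+x. u x \<partial>\<kappa> \<omega>)" if "\<omega> \<in> space M" for \<omega>
    using uv sets[OF that] by (intro nn_integral_add) (simp_all cong: measurable_cong_sets)
  then show ?case using add by (simp cong: measurable_cong)
next
  case (sup U)
  have inc_U: "incseq U" using sup by auto
  have "(\<integral>\<^sup>+x. (SUP i. U i) x \<partial>\<kappa> \<omega>) = (SUP i. \<integral>\<^sup>+x. U i x \<partial>\<kappa> \<omega>)" if "\<omega> \<in> space M" for \<omega>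
    unfolding SUP_apply
    using sup(1) inc_U sets[OF that] by (intro nn_integral_monotone_convergence_SUP) (simp_all cong: measurable_cong_sets)
  then show ?case using sup by (simp cong: measurable_cong)
qed

text \<open>The measure whose value on \<open>A\<close> averages the masses of \<open>A\<close> with
  weight \<open>w\<close>. It occurs with a power of a random total mass as weight, and with a
  two-point index space to add two measures.\<close>

lemma mixture_measure_exists:
  fixes \<kappa> :: "'w \<Rightarrow> 'b::topological_space measure"
  assumes sets: "\<And>\<omega>. \<omega> \<in> space M \<Longrightarrow> sets (\<kappa> \<omega>) = sets borel"
    and meas: "\<And>A. A \<in> sets borel \<Longrightarrow> (\<lambda>\<omega>. emeasure (\<kappa> \<omega>) A) \<in> borel_measurable M"
    and w[measurable]: "w \<in> borel_measurable M"
  obtains \<nu> where "sets \<nu> = sets borel"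
    "\<And>f. f \<in> borel_measurable borel \<Longrightarrow> (\<integral>\<^sup>+x. f x \<partial>\<nu>) = (\<integral>\<^sup>+\<omega>. w \<omega> * (\<integral>\<^sup>+x. f x \<partial>\<kappa> \<omega>) \<partial>M)"
proof -
  define \<mu> where "\<mu> A = (\<integral>\<^sup>+\<omega>. w \<omega> * emeasure (\<kappa> \<omega>) A \<partial>M)" for A
  define \<nu> where "\<nu> = measure_of UNIV (sets (borel :: 'b measure)) \<mu>"
  have sets_\<nu>: "sets \<nu> = sets borel"
    unfolding \<nu>_def using sets.sigma_sets_eq[of "borel :: 'b measure"] by (simp add: sets_measure_of_conv)
  have em: "emeasure \<nu> A = \<mu> A" if A: "A \<in> sets borel" for A
    unfolding \<nu>_def
  proof (rule emeasure_measure_of_sigma)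
    show "sigma_algebra UNIV (sets (borel :: 'b measure))"
      using sets.sigma_algebra_axioms[of borel] by simp
    show "positive (sets borel) \<mu>" by (simp add: positive_def \<mu>_def)
    show "countably_additive (sets borel) \<mu>"
    proof (rule countably_additiveI)
      fix A :: "nat \<Rightarrow> 'b set" assume A: "range A \<subseteq> sets borel" "disjoint_family A" "(\<Union>i. A i) \<in> sets borel"
      have "(\<Sum>i. \<mu> (A i)) = (\<integral>\<^sup>+\<omega>. (\<Sum>i. w \<omega> * emeasure (\<kappa> \<omega>) (A i)) \<partial>M)"
        unfolding \<mu>_def using A meas by (intro nn_integral_suminf[symmetric]) auto
      also have "\<dots> = (\<integral>\<^sup>+\<omega>. w \<omega> * emeasure (\<kappa> \<omega>) (\<Union>i. A i) \<partial>M)"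
        using A sets by (intro nn_integral_cong) (simp add: suminf_emeasure)
      finally show "(\<Sum>i. \<mu> (A i)) = \<mu> (\<Union>i. A i)" by (simp add: \<mu>_def)
    qed
  qed (use A in simp)
  have "(\<integral>\<^sup>+x. f x \<partial>\<nu>) = (\<integral>\<^sup>+\<omega>. w \<omega> * (\<integral>\<^sup>+x. f x \<partial>\<kappa> \<omega>) \<partial>M)" if "f \<in> borel_measurable borel" for f
    using that
  proof (induction rule: borel_measurable_induct[case_names cong set mult add sup])
    case (cong f g)
    then have "f = g" by auto
    with cong show ?case by simp
  next
    case (set A)
    have "(\<integral>\<^sup>+x. indicator A x \<partial>\<kappa> \<omega>) = emeasure (\<kappa> \<omega>) A" if "\<omega> \<in> space M" for \<omega>
      using set sets[OF that] by (intro nn_integral_indicator) simp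
    then show ?case
      using set sets_\<nu> by (simp add: em \<mu>_def cong: nn_integral_cong)
  next
    case (mult u c)
    have k: "(\<integral>\<^sup>+x. c * u x \<partial>\<kappa> \<omega>) = c * (\<integral>\<^sup>+x. u x \<partial>\<kappa> \<omega>)" if "\<omega> \<in> space M" for \<omega>
      using mult(2) sets[OF that] by (intro nn_integral_cmult) (simp cong: measurable_cong_sets)
    have m[measurable]: "(\<lambda>\<omega>. \<integral>\<^sup>+x. u x \<partial>\<kappa> \<omega>) \<in> borel_measurable M"
      by (rule random_measure_nn_integral_measurable[OF sets meas mult(2)])
    have "(\<integral>\<^sup>+x. c * u x \<partial>\<nu>) = c * (\<integral>\<^sup>+\<omega>. w \<omega> * (\<integral>\<^sup>+x. u x \<partial>\<kappa> \<omega>) \<partial>M)"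
      using mult sets_\<nu> by (subst nn_integral_cmult) (simp_all cong: measurable_cong_sets)
    also have "\<dots> = (\<integral>\<^sup>+\<omega>. c * (w \<omega> * (\<integral>\<^sup>+x. u x \<partial>\<kappa> \<omega>)) \<partial>M)"
      by (intro nn_integral_cmult[symmetric]) measurable
    also have "\<dots> = (\<integral>\<^sup>+\<omega>. w \<omega> * (\<integral>\<^sup>+x. c * u x \<partial>\<kappa> \<omega>) \<partial>M)"
      by (intro nn_integral_cong) (simp add: k mult_ac)
    finally show ?case .
  next
    case (add u v)
    have uv: "u \<in> borel_measurable borel" "v \<in> borel_measurable borel" using add by auto
    have k: "(\<integral>\<^sup>+x. v x + u x \<partial>\<kappa> \<omega>) = (\<integral>\<^sup>+x. v x \<partial>\<kappa> \<omega>) + (\<integral>\<^sup>+x. u x \<partial>\<kappa> \<omega>)" if "\<omega> \<in> space M" for \<omega>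
      using uv sets[OF that] by (intro nn_integral_add) (simp_all cong: measurable_cong_sets)
    have m[measurable]: "(\<lambda>\<omega>. \<integral>\<^sup>+x. u x \<partial>\<kappa> \<omega>) \<in> borel_measurable M" "(\<lambda>\<omega>. \<integral>\<^sup>+x. v x \<partial>\<kappa> \<omega>) \<in> borel_measurable M"
      using random_measure_nn_integral_measurable[OF sets meas] uv by blast+
    have "(\<integral>\<^sup>+x. v x + u x \<partial>\<nu>) = (\<integral>\<^sup>+\<omega>. w \<omega> * (\<integral>\<^sup>+x. v x \<partial>\<kappa> \<omega>) \<partial>M) + (\<integral>\<^sup>+\<omega>. w \<omega> * (\<integral>\<^sup>+x. u x \<partial>\<kappa> \<omega>) \<partial>M)"
      using add uv sets_\<nu> by (subst nn_integral_add) (simp_all cong: measurable_cong_sets)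
    also have "\<dots> = (\<integral>\<^sup>+\<omega>. w \<omega> * (\<integral>\<^sup>+x. v x \<partial>\<kappa> \<omega>) + w \<omega> * (\<integral>\<^sup>+x. u x \<partial>\<kappa> \<omega>) \<partial>M)"
      by (intro nn_integral_add[symmetric]) measurable
    also have "\<dots> = (\<integral>\<^sup>+\<omega>. w \<omega> * (\<integral>\<^sup>+x. v x + u x \<partial>\<kappa> \<omega>) \<partial>M)"
      by (intro nn_integral_cong) (simp add: k distrib_left)
    finally show ?case .
  next
    case (sup U)
    have inc_U: "incseq U" using sup by auto
    have k: "(\<integral>\<^sup>+x. (SUP i. U i) x \<partial>\<kappa> \<omega>) = (SUP i. \<integral>\<^sup>+x. U i x \<partial>\<kappa> \<omega>)" if "\<omega> \<in> space M" for \<omega>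
      unfolding SUP_apply
      using sup(1) inc_U sets[OF that] by (intro nn_integral_monotone_convergence_SUP) (simp_all cong: measurable_cong_sets)
    have m[measurable]: "(\<lambda>\<omega>. \<integral>\<^sup>+x. U i x \<partial>\<kappa> \<omega>) \<in> borel_measurable M" for i
      by (rule random_measure_nn_integral_measurable[OF sets meas sup(1)])
    have inc: "incseq (\<lambda>i \<omega>. w \<omega> * (\<integral>\<^sup>+x. U i x \<partial>\<kappa> \<omega>))"
      using inc_U by (auto simp: incseq_def le_fun_def intro!: mult_left_mono nn_integral_mono)
    have "(\<integral>\<^sup>+x. (SUP i. U i) x \<partial>\<nu>) = (SUP i. \<integral>\<^sup>+x. U i x \<partial>\<nu>)"
      unfolding SUP_apply using sup(1) inc_U sets_\<nu>
      by (intro nn_integral_monotone_convergence_SUP) (simp_all cong: measurable_cong_sets)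
    also have "\<dots> = (SUP i. \<integral>\<^sup>+\<omega>. w \<omega> * (\<integral>\<^sup>+x. U i x \<partial>\<kappa> \<omega>) \<partial>M)"
      using sup by simp
    also have "\<dots> = (\<integral>\<^sup>+\<omega>. (SUP i. w \<omega> * (\<integral>\<^sup>+x. U i x \<partial>\<kappa> \<omega>)) \<partial>M)"
      by (intro nn_integral_monotone_convergence_SUP[symmetric] inc) measurable
    also have "\<dots> = (\<integral>\<^sup>+\<omega>. w \<omega> * (\<integral>\<^sup>+x. (SUP i. U i) x \<partial>\<kappa> \<omega>) \<partial>M)"
    proof (rule nn_integral_cong)
      fix \<omega> assume "\<omega> \<in> space M"
      then show "(SUP i. w \<omega> * (\<integral>\<^sup>+x. U i x \<partial>\<kappa> \<omega>)) = w \<omega> * (\<integral>\<^sup>+x. (SUP i. U i) x \<partial>\<kappa> \<omega>)"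
        by (subst k) (auto simp only: SUP_mult_left_ennreal)
    qed
    finally show ?case .
  qed
  with sets_\<nu> that show thesis by blast
qed

text \<open>For indicators this is regularity of finite Borel measures together with Urysohn's
  lemma; sums and dominated limits pass it on to integrable functions. A final truncation restores
  the bound \<open>C\<close>.\<close>

lemma continuous_approximation:
  fixes \<nu> :: "'a::euclidean_space measure" and f :: "'a \<Rightarrow> real"
  assumes sets: "sets \<nu> = sets borel" and fin: "emeasure \<nu> UNIV \<noteq> \<infinity>"
    and f: "f \<in> borel_measurable borel" and C: "\<And>x. \<bar>f x\<bar> \<le> C" and \<delta>: "0 < \<delta>"
  obtains g where "continuous_on UNIV g" "\<And>x. \<bar>g x\<bar> \<le> C" "(\<integral>\<^sup>+x. ennreal \<bar>f x - g x\<bar> \<partial>\<nu>) < ennreal \<delta>"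
proof -
  have sp: "space \<nu> = UNIV" using sets_eq_imp_space_eq[OF sets] by simp
  interpret finite_measure \<nu> using fin by (intro finite_measureI) (simp add: sp)
  have meas_eq: "borel_measurable \<nu> = borel_measurable borel"
    using sets by (simp cong: measurable_cong_sets)
  let ?P = "\<lambda>f. \<forall>\<delta>>0. \<exists>g. continuous_on UNIV g \<and> (\<integral>\<^sup>+x. ennreal \<bar>f x - g x\<bar> \<partial>\<nu>) < ennreal \<delta>"
  have "integrable \<nu> f"
    using f C by (intro integrable_const_bound[of _ C]) (auto simp: meas_eq)
  then have "?P f"
  proof induction
    case (base A c)
    show ?case
    proof (intro allI impI)
      fix \<delta> :: real assume \<delta>: "0 < \<delta>"
      \<comment> \<open>The set between the compact and the open approximation has measure at most
        \<open>2 * \<eta>\<close>, so the error is at most \<open>\<delta> / 2\<close>; adding 1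
        covers the case \<open>c = 0\<close>.\<close>
      define \<eta> where "\<eta> = \<delta> / (\<bar>c\<bar> + 1) / 4"
      have \<eta>: "0 < \<eta>" using \<delta> by (simp add: \<eta>_def add_nonneg_pos)
      have A: "A \<in> sets borel" using base sets by simp
      have fin': "emeasure \<nu> (space \<nu>) \<noteq> \<infinity>" using fin sp by simp
      have ne: "emeasure \<nu> A \<noteq> \<top>" by simp
      have "\<exists>K\<in>{K. K \<subseteq> A \<and> compact K}. emeasure \<nu> A < emeasure \<nu> K + ennreal \<eta>"
      proof (rule ccontr)
        assume "\<not> ?thesis"
        then have "\<And>K. K \<subseteq> A \<Longrightarrow> compact K \<Longrightarrow> emeasure \<nu> K + ennreal \<eta> \<le> emeasure \<nu> A"
          by (auto simp: not_less)
        then have "(SUP K\<in>{K. K \<subseteq> A \<and> compact K}. emeasure \<nu> K + ennreal \<eta>) \<le> emeasure \<nu> A"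
          by (intro SUP_least) auto
        also have "(SUP K\<in>{K. K \<subseteq> A \<and> compact K}. emeasure \<nu> K + ennreal \<eta>)
            = (SUP K\<in>{K. K \<subseteq> A \<and> compact K}. emeasure \<nu> K) + ennreal \<eta>"
          by (rule ennreal_SUP_add_left) auto
        also have "(SUP K\<in>{K. K \<subseteq> A \<and> compact K}. emeasure \<nu> K) = emeasure \<nu> A"
          by (rule inner_regular[OF sets fin' A, symmetric])
        finally show False using ne \<eta>
          by (cases "emeasure \<nu> A") (auto simp: ennreal_plus[symmetric] simp del: ennreal_plus)
      qed
      then obtain K where K: "K \<subseteq> A" "compact K" "emeasure \<nu> A < emeasure \<nu> K + ennreal \<eta>" by auto
      have "(INF U\<in>{U. A \<subseteq> U \<and> open U}. emeasure \<nu> U) < emeasure \<nu> A + ennreal \<eta>"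
        using outer_regular[OF sets fin' A] ne \<eta>
        by (cases "emeasure \<nu> A") (auto simp: ennreal_plus[symmetric] ennreal_less_iff simp del: ennreal_plus)
      then obtain U where U: "A \<subseteq> U" "open U" "emeasure \<nu> U < emeasure \<nu> A + ennreal \<eta>"
        by (auto simp: INF_less_iff)
      have KU: "K \<in> sets \<nu>" "U \<in> sets \<nu>" using K U sets by (auto simp: compact_imp_closed)
      have UK: "measure \<nu> (U - K) \<le> 2 * \<eta>"
      proof -
        have "measure \<nu> U < measure \<nu> A + \<eta>"
          using U(3) \<eta> by (simp add: emeasure_eq_measure ennreal_plus[symmetric] ennreal_less_iff del: ennreal_plus)
        moreover have "measure \<nu> A < measure \<nu> K + \<eta>"
          using K(3) \<eta> by (simp add: emeasure_eq_measure ennreal_plus[symmetric] ennreal_less_iff del: ennreal_plus)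
        moreover have "measure \<nu> (U - K) = measure \<nu> U - measure \<nu> K"
          using KU K U by (intro finite_measure_Diff) auto
        ultimately show ?thesis by simp
      qed
      \<comment> \<open>Such an \<open>h\<close> differs from the indicator of \<open>A\<close> only
        on \<open>U - K\<close>.\<close>
      obtain h :: "'a \<Rightarrow> real" where h: "continuous_on UNIV h" "\<And>x. h x \<in> closed_segment 0 1"
        "\<And>x. x \<in> - U \<Longrightarrow> h x = 0" "\<And>x. x \<in> K \<Longrightarrow> h x = 1"
        using Urysohn[of "- U" K 0 1] K U by (auto simp: compact_imp_closed)
      have h01: "0 \<le> h x" "h x \<le> 1" for x using h(2)[of x] by (auto simp: closed_segment_eq_real_ivl)
      show "\<exists>g. continuous_on UNIV g \<and> (\<integral>\<^sup>+x. ennreal \<bar>indicator A x *\<^sub>R c - g x\<bar> \<partial>\<nu>) < ennreal \<delta>"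
      proof (intro exI[of _ "\<lambda>x. h x * c"] conjI)
        show "continuous_on UNIV (\<lambda>x. h x * c)" by (intro continuous_intros h)
        have "(\<integral>\<^sup>+x. ennreal \<bar>indicator A x *\<^sub>R c - h x * c\<bar> \<partial>\<nu>) \<le> (\<integral>\<^sup>+x. ennreal \<bar>c\<bar> * indicator (U - K) x \<partial>\<nu>)"
        proof (intro nn_integral_mono)
          fix x
          have "\<bar>indicator A x * c - h x * c\<bar> = \<bar>indicator A x - h x\<bar> * \<bar>c\<bar>"
            by (simp add: left_diff_distrib[symmetric] abs_mult)
          also have "\<dots> \<le> indicator (U - K) x * \<bar>c\<bar>"
            using h(3,4)[of x] h01[of x] K U by (intro mult_right_mono) (auto simp: indicator_def)
          finally show "ennreal \<bar>indicator A x *\<^sub>R c - h x * c\<bar> \<le> ennreal \<bar>c\<bar> * indicator (U - K) x"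
            by (auto simp: indicator_def intro: ennreal_leI split: if_splits)
        qed
        also have "\<dots> = ennreal (\<bar>c\<bar> * measure \<nu> (U - K))"
          using KU by (simp add: nn_integral_cmult_indicator emeasure_eq_measure ennreal_mult)
        also have "\<dots> < ennreal \<delta>"
        proof (rule ennreal_lessI[OF \<delta>])
          have "\<bar>c\<bar> * measure \<nu> (U - K) \<le> (\<bar>c\<bar> + 1) * (2 * \<eta>)" using UK by (intro mult_mono) auto
          also have "\<dots> = \<delta> / 2" by (simp add: \<eta>_def field_simps add_nonneg_eq_0_iff)
          also have "\<dots> < \<delta>" using \<delta> by simp
          finally show "\<bar>c\<bar> * measure \<nu> (U - K) < \<delta>" .
        qed
        finally show "(\<integral>\<^sup>+x. ennreal \<bar>indicator A x *\<^sub>R c - h x * c\<bar> \<partial>\<nu>) < ennreal \<delta>" .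
      qed
    qed
  next
    case (add f1 f2)
    show ?case
    proof (intro allI impI)
      fix \<delta> :: real assume \<delta>: "0 < \<delta>"
      then have \<delta>2: "0 < \<delta> / 2" by simp
      obtain g1 where g1: "continuous_on UNIV g1" "(\<integral>\<^sup>+x. ennreal \<bar>f1 x - g1 x\<bar> \<partial>\<nu>) < ennreal (\<delta> / 2)"
        using add \<delta>2 by blast
      obtain g2 where g2: "continuous_on UNIV g2" "(\<integral>\<^sup>+x. ennreal \<bar>f2 x - g2 x\<bar> \<partial>\<nu>) < ennreal (\<delta> / 2)"
        using add \<delta>2 by blast
      have m[measurable]: "f1 \<in> borel_measurable \<nu>" "f2 \<in> borel_measurable \<nu>" "g1 \<in> borel_measurable \<nu>" "g2 \<in> borel_measurable \<nu>"
        using add g1 g2 by (auto simp: meas_eq intro: borel_measurable_continuous_onI)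
      show "\<exists>g. continuous_on UNIV g \<and> (\<integral>\<^sup>+x. ennreal \<bar>f1 x + f2 x - g x\<bar> \<partial>\<nu>) < ennreal \<delta>"
      proof (intro exI[of _ "\<lambda>x. g1 x + g2 x"] conjI)
        show "continuous_on UNIV (\<lambda>x. g1 x + g2 x)" by (intro continuous_intros g1 g2)
        have "(\<integral>\<^sup>+x. ennreal \<bar>f1 x + f2 x - (g1 x + g2 x)\<bar> \<partial>\<nu>) \<le> (\<integral>\<^sup>+x. ennreal \<bar>f1 x - g1 x\<bar> + ennreal \<bar>f2 x - g2 x\<bar> \<partial>\<nu>)"
          by (intro nn_integral_mono) (auto simp: ennreal_plus[symmetric] simp del: ennreal_plus intro!: ennreal_leI)
        also have "\<dots> = (\<integral>\<^sup>+x. ennreal \<bar>f1 x - g1 x\<bar> \<partial>\<nu>) + (\<integral>\<^sup>+x. ennreal \<bar>f2 x - g2 x\<bar> \<partial>\<nu>)"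
          by (rule nn_integral_add) measurable
        also have "\<dots> < ennreal (\<delta> / 2) + ennreal (\<delta> / 2)"
          using g1 g2 by (intro add_strict_mono) auto
        also have "\<dots> = ennreal \<delta>" using \<delta> by (simp add: ennreal_plus[symmetric] del: ennreal_plus)
        finally show "(\<integral>\<^sup>+x. ennreal \<bar>f1 x + f2 x - (g1 x + g2 x)\<bar> \<partial>\<nu>) < ennreal \<delta>" .
      qed
    qed
  next
    case (lim f' s)
    show ?case
    proof (intro allI impI)
      fix \<delta> :: real assume \<delta>: "0 < \<delta>"
      then have \<delta>2: "0 < \<delta> / 2" by simp
      have f'_int: "integrable \<nu> f'" using lim by blast
      have m[measurable]: "f' \<in> borel_measurable \<nu>" "\<And>i. s i \<in> borel_measurable \<nu>" using lim by auto
      have "(\<lambda>i. \<integral>\<^sup>+x. norm (f' x - s i x) \<partial>\<nu>) \<longlonglongrightarrow> 0"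
      proof (rule nn_integral_dominated_convergence_norm)
        show "AE x in \<nu>. norm (s i x) \<le> 2 * norm (f' x)" for i using lim by auto
        show "(\<integral>\<^sup>+x. ennreal (2 * norm (f' x)) \<partial>\<nu>) < \<infinity>"
          using f'_int by (auto simp: integrable_iff_bounded ennreal_mult nn_integral_cmult ennreal_mult_less_top)
      qed (use lim in auto)
      then have "eventually (\<lambda>i. (\<integral>\<^sup>+x. norm (f' x - s i x) \<partial>\<nu>) < ennreal (\<delta> / 2)) sequentially"
        using \<delta>2 by (intro order_tendstoD) auto
      then obtain i where i: "(\<integral>\<^sup>+x. norm (f' x - s i x) \<partial>\<nu>) < ennreal (\<delta> / 2)"
        by (auto simp: eventually_sequentially)
      obtain g where g: "continuous_on UNIV g" "(\<integral>\<^sup>+x. ennreal \<bar>s i x - g x\<bar> \<partial>\<nu>) < ennreal (\<delta> / 2)"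
        using lim \<delta>2 by blast
      have [measurable]: "g \<in> borel_measurable \<nu>" using g by (auto simp: meas_eq intro: borel_measurable_continuous_onI)
      have "(\<integral>\<^sup>+x. ennreal \<bar>f' x - g x\<bar> \<partial>\<nu>) \<le> (\<integral>\<^sup>+x. ennreal (norm (f' x - s i x)) + ennreal \<bar>s i x - g x\<bar> \<partial>\<nu>)"
        by (intro nn_integral_mono) (auto simp: ennreal_plus[symmetric] simp del: ennreal_plus intro!: ennreal_leI)
      also have "\<dots> = (\<integral>\<^sup>+x. norm (f' x - s i x) \<partial>\<nu>) + (\<integral>\<^sup>+x. ennreal \<bar>s i x - g x\<bar> \<partial>\<nu>)"
        by (rule nn_integral_add) measurable
      also have "\<dots> < ennreal (\<delta> / 2) + ennreal (\<delta> / 2)" using i g by (intro add_strict_mono) auto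
      also have "\<dots> = ennreal \<delta>" using \<delta> by (simp add: ennreal_plus[symmetric] del: ennreal_plus)
      finally show "\<exists>g. continuous_on UNIV g \<and> (\<integral>\<^sup>+x. ennreal \<bar>f' x - g x\<bar> \<partial>\<nu>) < ennreal \<delta>"
        using g(1) by blast
    qed
  qed
  then obtain g where g: "continuous_on UNIV g" "(\<integral>\<^sup>+x. ennreal \<bar>f x - g x\<bar> \<partial>\<nu>) < ennreal \<delta>"
    using \<delta> by blast
  have C0: "0 \<le> C" using C[of 0] by linarith
  show thesis
  \<comment> \<open>Clipping to the interval in which \<open>f\<close> takes its values brings no
    value of \<open>g\<close> farther from that of \<open>f\<close>.\<close>
  proof (rule that[of "\<lambda>x. max (- C) (min C (g x))"])
    show "continuous_on UNIV (\<lambda>x. max (- C) (min C (g x)))" by (intro continuous_intros g)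
    show "\<bar>max (- C) (min C (g x))\<bar> \<le> C" for x using C0 by auto
    have "(\<integral>\<^sup>+x. ennreal \<bar>f x - max (- C) (min C (g x))\<bar> \<partial>\<nu>) \<le> (\<integral>\<^sup>+x. ennreal \<bar>f x - g x\<bar> \<partial>\<nu>)"
    proof (intro nn_integral_mono ennreal_leI)
      fix x show "\<bar>f x - max (- C) (min C (g x))\<bar> \<le> \<bar>f x - g x\<bar>"
        using C[of x] by (auto simp: max_def min_def abs_if split: if_splits)
    qed
    then show "(\<integral>\<^sup>+x. ennreal \<bar>f x - max (- C) (min C (g x))\<bar> \<partial>\<nu>) < ennreal \<delta>"
      using g(2) by (rule le_less_trans)
  qed
qed

lemma integral_eq_enn2real_diff:
  fixes f :: "'a \<Rightarrow> real"
  assumes "finite_measure N" "f \<in> borel_measurable N" "\<And>x. \<bar>f x\<bar> \<le> C"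
  shows "integrable N f"
    and "(\<integral>x. f x \<partial>N) = enn2real (\<integral>\<^sup>+x. ennreal (f x) \<partial>N) - enn2real (\<integral>\<^sup>+x. ennreal (- f x) \<partial>N)"
proof -
  show "integrable N f"
    using assms by (intro finite_measure.integrable_const_bound[of N _ C]) auto
  then show "(\<integral>x. f x \<partial>N) = enn2real (\<integral>\<^sup>+x. ennreal (f x) \<partial>N) - enn2real (\<integral>\<^sup>+x. ennreal (- f x) \<partial>N)"
    by (rule real_lebesgue_integral_def)
qed

lemma random_finite_borel_measure_integral_measurable:
  fixes f :: "'b::topological_space \<Rightarrow> real"
  assumes L: "random_finite_borel_measure M L" and f: "f \<in> borel_measurable borel" and C: "\<And>x. \<bar>f x\<bar> \<le> C"
  shows "(\<lambda>\<omega>. \<integral>x. f x \<partial>L \<omega>) \<in> borel_measurable M"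
proof -
  have sets: "\<And>\<omega>. \<omega> \<in> space M \<Longrightarrow> sets (L \<omega>) = sets borel"
    and meas: "\<And>A. A \<in> sets borel \<Longrightarrow> (\<lambda>\<omega>. emeasure (L \<omega>) A) \<in> borel_measurable M"
    and fin: "\<And>\<omega>. \<omega> \<in> space M \<Longrightarrow> finite_measure (L \<omega>)"
    using L by (auto simp: random_finite_borel_measure_def)
  note f[measurable]
  have [measurable]: "(\<lambda>\<omega>. \<integral>\<^sup>+x. ennreal (f x) \<partial>L \<omega>) \<in> borel_measurable M" "(\<lambda>\<omega>. \<integral>\<^sup>+x. ennreal (- f x) \<partial>L \<omega>) \<in> borel_measurable M"
    using f by (auto intro!: random_measure_nn_integral_measurable[OF sets meas])
  have "(\<integral>x. f x \<partial>L \<omega>) = enn2real (\<integral>\<^sup>+x. ennreal (f x) \<partial>L \<omega>) - enn2real (\<integral>\<^sup>+x. ennreal (- f x) \<partial>L \<omega>)"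
    if "\<omega> \<in> space M" for \<omega>
    using fin[OF that] sets[OF that] f C by (intro integral_eq_enn2real_diff) (simp_all cong: measurable_cong_sets)
  then show ?thesis by (simp cong: measurable_cong)
qed

text \<open>Weighting by a power of the total mass turns \<open>L\<^sup>1\<close> approximation under a deterministic
  measure into approximation of the moments of a random integral.\<close>

lemma random_integral_power_le:
  fixes L :: "'w \<Rightarrow> 'b::topological_space measure"
  assumes L: "random_finite_borel_measure M L"
    and fin: "(\<integral>\<^sup>+\<omega>. emeasure (L \<omega>) UNIV ^ Suc m \<partial>M) < \<infinity>"
  obtains \<nu> where "sets \<nu> = sets borel" "emeasure \<nu> UNIV \<noteq> \<infinity>"
    "\<And>h B. h \<in> borel_measurable borel \<Longrightarrow> (\<And>x. \<bar>h x\<bar> \<le> B) \<Longrightarrow>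
      (\<integral>\<^sup>+\<omega>. ennreal (\<bar>\<integral>x. h x \<partial>L \<omega>\<bar> ^ Suc m) \<partial>M) \<le> ennreal (B ^ m) * (\<integral>\<^sup>+x. ennreal \<bar>h x\<bar> \<partial>\<nu>)"
proof -
  have sets: "\<And>\<omega>. \<omega> \<in> space M \<Longrightarrow> sets (L \<omega>) = sets borel"
    and meas: "\<And>A. A \<in> sets borel \<Longrightarrow> (\<lambda>\<omega>. emeasure (L \<omega>) A) \<in> borel_measurable M"
    using L by (auto simp: random_finite_borel_measure_def)
  have sp: "space (L \<omega>) = UNIV" if "\<omega> \<in> space M" for \<omega>
    using sets_eq_imp_space_eq[OF sets[OF that]] by simp
  define w where "w \<omega> = emeasure (L \<omega>) UNIV ^ m" for \<omega>
  have w_meas[measurable]: "w \<in> borel_measurable M" unfolding w_def using meas[of UNIV] by measurable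
  obtain \<nu> where \<nu>: "sets \<nu> = sets borel"
    "\<And>f. f \<in> borel_measurable borel \<Longrightarrow> (\<integral>\<^sup>+x. f x \<partial>\<nu>) = (\<integral>\<^sup>+\<omega>. w \<omega> * (\<integral>\<^sup>+x. f x \<partial>L \<omega>) \<partial>M)"
    using mixture_measure_exists[OF sets meas w_meas] by blast
  have sp\<nu>: "space \<nu> = UNIV" using sets_eq_imp_space_eq[OF \<nu>(1)] by simp
  show thesis
  proof (rule that[OF \<nu>(1)])
    have "emeasure \<nu> UNIV = (\<integral>\<^sup>+x. 1 \<partial>\<nu>)" by (simp add: sp\<nu>)
    also have "\<dots> = (\<integral>\<^sup>+\<omega>. w \<omega> * (\<integral>\<^sup>+x. 1 \<partial>L \<omega>) \<partial>M)" by (rule \<nu>(2)) simp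
    also have "\<dots> = (\<integral>\<^sup>+\<omega>. emeasure (L \<omega>) UNIV ^ Suc m \<partial>M)"
      by (intro nn_integral_cong) (simp add: w_def sp mult.commute)
    finally show "emeasure \<nu> UNIV \<noteq> \<infinity>" using fin by simp
  next
    fix h :: "'b \<Rightarrow> real" and B assume h[measurable]: "h \<in> borel_measurable borel" and B: "\<And>x. \<bar>h x\<bar> \<le> B"
    have B0: "0 \<le> B" using B[of undefined] by linarith
    have "(\<integral>\<^sup>+\<omega>. ennreal (\<bar>\<integral>x. h x \<partial>L \<omega>\<bar> ^ Suc m) \<partial>M) \<le> (\<integral>\<^sup>+\<omega>. ennreal (B ^ m) * (w \<omega> * (\<integral>\<^sup>+x. ennreal \<bar>h x\<bar> \<partial>L \<omega>)) \<partial>M)"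
    proof (intro nn_integral_mono)
      fix \<omega> assume \<omega>: "\<omega> \<in> space M"
      have hL: "h \<in> borel_measurable (L \<omega>)" using h sets[OF \<omega>] by (simp cong: measurable_cong_sets)
      have 1: "ennreal \<bar>\<integral>x. h x \<partial>L \<omega>\<bar> \<le> (\<integral>\<^sup>+x. ennreal \<bar>h x\<bar> \<partial>L \<omega>)"
        by (rule ennreal_abs_integral_le[OF hL])
      have "(\<integral>\<^sup>+x. ennreal \<bar>h x\<bar> \<partial>L \<omega>) \<le> (\<integral>\<^sup>+x. ennreal B \<partial>L \<omega>)"
        by (intro nn_integral_mono ennreal_leI B)
      also have "\<dots> = ennreal B * emeasure (L \<omega>) UNIV" by (simp add: sp[OF \<omega>])
      finally have 2: "ennreal \<bar>\<integral>x. h x \<partial>L \<omega>\<bar> \<le> ennreal B * emeasure (L \<omega>) UNIV"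
        using 1 by (rule order_trans[rotated])
      have "ennreal (\<bar>\<integral>x. h x \<partial>L \<omega>\<bar> ^ Suc m) = ennreal \<bar>\<integral>x. h x \<partial>L \<omega>\<bar> ^ m * ennreal \<bar>\<integral>x. h x \<partial>L \<omega>\<bar>"
        by (simp add: ennreal_power ennreal_mult'[symmetric] mult.commute)
      also have "\<dots> \<le> (ennreal B * emeasure (L \<omega>) UNIV) ^ m * (\<integral>\<^sup>+x. ennreal \<bar>h x\<bar> \<partial>L \<omega>)"
        by (intro mult_mono power_mono 1 2) auto
      also have "\<dots> = ennreal (B ^ m) * (w \<omega> * (\<integral>\<^sup>+x. ennreal \<bar>h x\<bar> \<partial>L \<omega>))"
        using B0 by (simp add: w_def power_mult_distrib ennreal_power mult_ac)
      finally show "ennreal (\<bar>\<integral>x. h x \<partial>L \<omega>\<bar> ^ Suc m) \<le> \<dots>" .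
    qed
    also have "\<dots> = ennreal (B ^ m) * (\<integral>\<^sup>+\<omega>. w \<omega> * (\<integral>\<^sup>+x. ennreal \<bar>h x\<bar> \<partial>L \<omega>) \<partial>M)"
    proof (rule nn_integral_cmult)
      have [measurable]: "(\<lambda>\<omega>. \<integral>\<^sup>+x. ennreal \<bar>h x\<bar> \<partial>L \<omega>) \<in> borel_measurable M"
        using h by (auto intro!: random_measure_nn_integral_measurable[OF sets meas])
      show "(\<lambda>\<omega>. w \<omega> * (\<integral>\<^sup>+x. ennreal \<bar>h x\<bar> \<partial>L \<omega>)) \<in> borel_measurable M" by measurable
    qed
    also have "(\<integral>\<^sup>+\<omega>. w \<omega> * (\<integral>\<^sup>+x. ennreal \<bar>h x\<bar> \<partial>L \<omega>) \<partial>M) = (\<integral>\<^sup>+x. ennreal \<bar>h x\<bar> \<partial>\<nu>)"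
      by (rule \<nu>(2)[symmetric]) measurable
    finally show "(\<integral>\<^sup>+\<omega>. ennreal (\<bar>\<integral>x. h x \<partial>L \<omega>\<bar> ^ Suc m) \<partial>M) \<le> ennreal (B ^ m) * (\<integral>\<^sup>+x. ennreal \<bar>h x\<bar> \<partial>\<nu>)" .
  qed
qed

section \<open>From moments to exponential moments of a root\<close>

text \<open>With \<open>z ^ p = \<bar>\<xi>\<bar>\<close> the powers of \<open>z\<close> of order
  \<open>2 * p * n\<close> are the even moments, so the lacunary series with
  \<open>N = 2 * p\<close> applies. The factorials cancel by \<open>fact_power_le_fact_mult\<close>,
  and a geometric series with ratio at most 1/2 remains.\<close>

lemma (in prob_space) exp_root_moment_le:
  fixes \<xi> :: "'a \<Rightarrow> real"
  assumes [measurable]: "\<xi> \<in> borel_measurable M" and p: "p \<ge> 1" and G: "G \<ge> 1"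
    and \<rho>: "0 \<le> \<rho>" "6 ^ (2 * p) * \<rho> \<le> 1 / 2"
    and mom: "\<And>n. n \<ge> 1 \<Longrightarrow> (\<integral>\<^sup>+\<omega>. ennreal (\<bar>\<xi> \<omega>\<bar> ^ (2 * n)) \<partial>M) \<le> ennreal (fact (2 * n) ^ p * G * \<rho> ^ n)"
  shows "(\<integral>\<^sup>+\<omega>. ennreal (exp (\<bar>\<xi> \<omega>\<bar> powr (1 / real p))) \<partial>M) \<le> ennreal (2 * exp (real (2 * p)) * G)"
proof -
  define N where "N = 2 * p"
  define a :: "nat \<Rightarrow> real" where "a n = exp (real N) * (6 ^ N) ^ n / fact (N * n)" for n
  have a0: "0 \<le> a n" for n by (simp add: a_def)
  have pt: "ennreal (exp (\<bar>x\<bar> powr (1 / real p))) \<le> (\<Sum>n. ennreal (a n) * ennreal (\<bar>x\<bar> ^ (2 * n)))" for x :: real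
  proof -
    define z where "z = \<bar>x\<bar> powr (1 / real p)"
    have zp: "z ^ p = \<bar>x\<bar>" using p by (cases "x = 0") (auto simp: z_def powr_power)
    have z0: "0 \<le> z" by (simp add: z_def)
    \<comment> \<open>The dominating index depends on the outcome, so its term is replaced by the
      sum over all indices before integrating.\<close>
    obtain n where n: "exp z \<le> exp (real N) * ((6 * z) ^ (N * n) / fact (N * n))"
      using exp_le_sum_lacunary[OF z0, of N] p by (auto simp: N_def)
    have "(6 * z) ^ (N * n) = (6 ^ N) ^ n * (z ^ p) ^ (2 * n)"
      by (simp add: N_def power_mult_distrib power_mult[symmetric] mult_ac)
    then have "exp z \<le> a n * \<bar>x\<bar> ^ (2 * n)" using n by (simp add: a_def zp)
    then have "ennreal (exp z) \<le> ennreal (a n) * ennreal (\<bar>x\<bar> ^ (2 * n))"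
      using a0 by (simp add: ennreal_mult[symmetric] ennreal_leI)
    also have "\<dots> \<le> (\<Sum>n. ennreal (a n) * ennreal (\<bar>x\<bar> ^ (2 * n)))"
      using sum_le_suminf[of "\<lambda>n. ennreal (a n) * ennreal (\<bar>x\<bar> ^ (2 * n))" "{n}"] by simp
    finally show ?thesis by (simp add: z_def)
  qed
  \<comment> \<open>At order 0 the bound is \<open>G\<close>, which is at least 1.\<close>
  have mom': "(\<integral>\<^sup>+\<omega>. ennreal (\<bar>\<xi> \<omega>\<bar> ^ (2 * n)) \<partial>M) \<le> ennreal (fact (2 * n) ^ p * G * \<rho> ^ n)" for n
    using mom[of n] G by (cases "n = 0") (auto simp: emeasure_space_1)
  have "(\<integral>\<^sup>+\<omega>. ennreal (exp (\<bar>\<xi> \<omega>\<bar> powr (1 / real p))) \<partial>M)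
    \<le> (\<integral>\<^sup>+\<omega>. (\<Sum>n. ennreal (a n) * ennreal (\<bar>\<xi> \<omega>\<bar> ^ (2 * n))) \<partial>M)"
    by (intro nn_integral_mono pt)
  also have "\<dots> = (\<Sum>n. \<integral>\<^sup>+\<omega>. ennreal (a n) * ennreal (\<bar>\<xi> \<omega>\<bar> ^ (2 * n)) \<partial>M)"
    by (rule nn_integral_suminf) measurable
  also have "\<dots> = (\<Sum>n. ennreal (a n) * (\<integral>\<^sup>+\<omega>. ennreal (\<bar>\<xi> \<omega>\<bar> ^ (2 * n)) \<partial>M))"
    by (simp add: nn_integral_cmult)
  also have "\<dots> \<le> (\<Sum>n. ennreal (exp (real N) * G * (1 / 2) ^ n))"
  proof (intro suminf_le summableI)
    fix n
    have "ennreal (a n) * (\<integral>\<^sup>+\<omega>. ennreal (\<bar>\<xi> \<omega>\<bar> ^ (2 * n)) \<partial>M) \<le> ennreal (a n) * ennreal (fact (2 * n) ^ p * G * \<rho> ^ n)"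
      by (intro mult_left_mono mom') auto
    also have "\<dots> = ennreal (a n * (fact (2 * n) ^ p * G * \<rho> ^ n))"
      using a0 by (intro ennreal_mult'[symmetric]) simp
    also have "\<dots> \<le> ennreal (exp (real N) * G * (1 / 2) ^ n)"
    proof (rule ennreal_leI)
      have f: "(fact (2 * n) :: real) ^ p / fact (N * n) \<le> 1"
        using fact_power_le_fact_mult[of "2 * n" p] by (simp add: N_def mult_ac)
      have "a n * (fact (2 * n) ^ p * G * \<rho> ^ n) = exp (real N) * G * (6 ^ N * \<rho>) ^ n * (fact (2 * n) ^ p / fact (N * n))"
        by (simp add: a_def power_mult_distrib)
      also have "\<dots> \<le> exp (real N) * G * (1 / 2) ^ n * 1"
        using f \<rho> G unfolding N_def by (intro mult_mono power_mono) auto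
      finally show "a n * (fact (2 * n) ^ p * G * \<rho> ^ n) \<le> exp (real N) * G * (1 / 2) ^ n" by simp
    qed
    finally show "ennreal (a n) * (\<integral>\<^sup>+\<omega>. ennreal (\<bar>\<xi> \<omega>\<bar> ^ (2 * n)) \<partial>M) \<le> ennreal (exp (real N) * G * (1 / 2) ^ n)" .
  qed
  also have "\<dots> = ennreal (exp (real N) * G * 2)"
  proof -
    have "(\<lambda>n. exp (real N) * G * (1 / 2 :: real) ^ n) sums (exp (real N) * G * 2)"
      using sums_mult[OF geometric_sums[of "1 / 2 :: real"], of "exp (real N) * G"] by simp
    then show ?thesis
      using G by (subst suminf_ennreal_eq) auto
  qed
  finally show ?thesis by (simp add: N_def mult_ac)
qed

context independent_continuous_bm_nat
begin

lemma smoothed_density_joint_measurable [measurable]: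
  "(\<lambda>z. \<Prod>j\<in>{1..p}. smoothed_local_time (heat_kernel e) t j (snd z) (fst z)) \<in> borel_measurable (M \<Otimes>\<^sub>M lborel)"
  by (intro borel_measurable_prod smoothed_local_time_measurable) auto

text \<open>At fixed smoothing and time the mass is bounded by a deterministic constant, so all its
  moments are finite.\<close>

lemma smoothed_measure_mass_le:
  assumes e: "e > 0" and t: "t \<ge> 0"
  obtains R where "R \<ge> 0" "\<And>\<omega>. emeasure (smoothed_measure t e \<omega>) UNIV \<le> ennreal R"
proof -
  define K where "K = (2 * pi * e) powr (- (real CARD('d) / 2))"
  have "(\<integral>\<^sup>+y. ennreal \<bar>1 * (\<Prod>j\<in>{1..p}. smoothed_local_time (heat_kernel e) t j y \<omega>)\<bar> \<partial>lborel)
     \<le> ennreal (1 * ((K * t) ^ (card {1..p} - 1) * (2 * t)))" for \<omega>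
    using e t heat_kernel_le[OF e]
    by (intro nn_integral_prod_smoothed_local_time_le[where f = "\<lambda>_. 1"]) (auto simp: K_def)
  then have "emeasure (smoothed_measure t e \<omega>) UNIV \<le> ennreal ((K * t) ^ (p - 1) * (2 * t))" for \<omega>
    using smoothed_density_measurable[of e t \<omega>]
    by (simp add: smoothed_measure_def emeasure_density abs_of_nonneg prod_nonneg smoothed_local_time_nonneg)
  then show thesis using t by (intro that[of "(K * t) ^ (p - 1) * (2 * t)"]) (auto simp: K_def)
qed

lemma random_finite_borel_measure_smoothed_measure:
  assumes e: "e > 0" and t: "t \<ge> 0"
  shows "random_finite_borel_measure M (smoothed_measure t e)"
  unfolding random_finite_borel_measure_def
proof (intro conjI ballI)
  fix \<omega> show "sets (smoothed_measure t e \<omega>) = sets borel" by (simp add: smoothed_measure_def)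
  obtain R where R: "\<And>\<omega>. emeasure (smoothed_measure t e \<omega>) UNIV \<le> ennreal R"
    using smoothed_measure_mass_le[OF e t] by blast
  have "emeasure (smoothed_measure t e \<omega>) UNIV < \<infinity>"
    using le_less_trans[OF R ennreal_less_top] by simp
  then show "finite_measure (smoothed_measure t e \<omega>)"
    by (intro finite_measureI) (simp add: smoothed_measure_def)
next
  fix A :: "(real ^ 'd) set" assume A[measurable]: "A \<in> sets borel"
  have "(\<lambda>\<omega>. \<integral>\<^sup>+y. ennreal (\<Prod>j\<in>{1..p}. smoothed_local_time (heat_kernel e) t j y \<omega>) * indicator A y \<partial>lborel) \<in> borel_measurable M"
    by measurable
  moreover have "emeasure (smoothed_measure t e \<omega>) A = (\<integral>\<^sup>+y. ennreal (\<Prod>j\<in>{1..p}. smoothed_local_time (heat_kernel e) t j y \<omega>) * indicator A y \<partial>lborel)" for \<omega>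
    unfolding smoothed_measure_def using smoothed_density_measurable[of e t \<omega>] A
    by (intro emeasure_density) auto
  ultimately show "(\<lambda>\<omega>. emeasure (smoothed_measure t e \<omega>) A) \<in> borel_measurable M" by simp
qed

lemma nn_integral_abs_power_add_le:
  assumes [measurable]: "X \<in> borel_measurable M" "Y \<in> borel_measurable M"
  shows "(\<integral>\<^sup>+\<omega>. ennreal (\<bar>X \<omega> + Y \<omega>\<bar> ^ (2 * n)) \<partial>M)
    \<le> ennreal (4 ^ n) * ((\<integral>\<^sup>+\<omega>. ennreal (\<bar>X \<omega>\<bar> ^ (2 * n)) \<partial>M) + (\<integral>\<^sup>+\<omega>. ennreal (\<bar>Y \<omega>\<bar> ^ (2 * n)) \<partial>M))"
proof -
  have "(\<integral>\<^sup>+\<omega>. ennreal (\<bar>X \<omega> + Y \<omega>\<bar> ^ (2 * n)) \<partial>M)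
    \<le> (\<integral>\<^sup>+\<omega>. ennreal (4 ^ n) * (ennreal (\<bar>X \<omega>\<bar> ^ (2 * n)) + ennreal (\<bar>Y \<omega>\<bar> ^ (2 * n))) \<partial>M)"
  proof (intro nn_integral_mono)
    fix \<omega>
    have "\<bar>X \<omega> + Y \<omega>\<bar> ^ (2 * n) \<le> 4 ^ n * (\<bar>X \<omega>\<bar> ^ (2 * n) + \<bar>Y \<omega>\<bar> ^ (2 * n))"
      using power_add_le_two_power[of "X \<omega>" "Y \<omega>" "2 * n"] by (simp add: power_mult)
    then have "ennreal (\<bar>X \<omega> + Y \<omega>\<bar> ^ (2 * n)) \<le> ennreal (4 ^ n * (\<bar>X \<omega>\<bar> ^ (2 * n) + \<bar>Y \<omega>\<bar> ^ (2 * n)))"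
      by (rule ennreal_leI)
    then show "ennreal (\<bar>X \<omega> + Y \<omega>\<bar> ^ (2 * n)) \<le> ennreal (4 ^ n) * (ennreal (\<bar>X \<omega>\<bar> ^ (2 * n)) + ennreal (\<bar>Y \<omega>\<bar> ^ (2 * n)))"
      by (simp add: ennreal_mult)
  qed
  also have "\<dots> = ennreal (4 ^ n) * ((\<integral>\<^sup>+\<omega>. ennreal (\<bar>X \<omega>\<bar> ^ (2 * n)) \<partial>M) + (\<integral>\<^sup>+\<omega>. ennreal (\<bar>Y \<omega>\<bar> ^ (2 * n)) \<partial>M))"
    by (subst nn_integral_cmult) (auto simp: nn_integral_add)
  finally show ?thesis .
qed

end

section \<open>Moments of the error for the intersection measure\<close>

locale intersection_setting = independent_continuous_bm_nat M p V
  for M :: "'w measure" and p :: nat and V :: "nat \<Rightarrow> real \<Rightarrow> 'w \<Rightarrow> real ^ 'd" +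
  fixes W :: "nat \<Rightarrow> real \<Rightarrow> 'w \<Rightarrow> real ^ 'd" and L :: "'w \<Rightarrow> (real ^ 'd) measure" and t lam c :: real
  assumes VW: "AE \<omega> in M. \<forall>j\<in>{1..p}. \<forall>s\<ge>0. V j s \<omega> = W j s \<omega>"
    and L: "is_intersection_measure M p W t L"
    and t: "t > 0" and lam: "lam > 0" and c: "c > 0"
    and weight: "(\<integral>\<^sup>+r. ennreal (exp (- lam * r) * time_weight CARD('d) p r) * indicator {0<..} r \<partial>lborel) \<le> ennreal c"
begin

definition moment_bound :: "nat \<Rightarrow> real \<Rightarrow> real \<Rightarrow> real" where
  "moment_bound n C e = fact (2 * n) ^ p * exp (real p * lam * t) * moment_rate CARD('d) p C c e ^ n"

lemma random_L: "random_finite_borel_measure M L"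
  using L by (simp add: is_intersection_measure_def)

lemma moment_rate_pos: "C > 0 \<Longrightarrow> e > 0 \<Longrightarrow> 0 < moment_rate CARD('d) p C c e"
  using p_ge c by (simp add: moment_rate_def diff_rate_def)

lemma moment_bound_pos: "C > 0 \<Longrightarrow> e > 0 \<Longrightarrow> 0 < moment_bound n C e"
  unfolding moment_bound_def using moment_rate_pos by (intro mult_pos_pos zero_less_power) auto

lemma L_integral_measurable:
  fixes f :: "real ^ 'd \<Rightarrow> real"
  assumes "f \<in> borel_measurable borel" "\<And>x. \<bar>f x\<bar> \<le> C"
  shows "(\<lambda>\<omega>. \<integral>x. f x \<partial>L \<omega>) \<in> borel_measurable M"
  by (rule random_finite_borel_measure_integral_measurable[OF random_L assms])

text \<open>The pairing with parameter \<open>e'\<close> is inserted between the two terms. As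
  \<open>e'\<close> tends to 0, its distance to the intersection measure vanishes in the norm of
  order 2n by definition, while its distance to the pairing at \<open>e\<close> is bounded
  uniformly. The factor \<open>4 ^ n\<close> comes from splitting the power.\<close>

lemma continuous_moment_le:
  assumes f: "continuous_on UNIV f" and C: "\<And>x. \<bar>f x\<bar> \<le> C" and e: "e > 0" and n: "n \<ge> 1"
  shows "(\<integral>\<^sup>+\<omega>. ennreal (\<bar>(\<integral>x. f x \<partial>L \<omega>) - smoothed_pairing f t e \<omega>\<bar> ^ (2 * n)) \<partial>M)
    \<le> ennreal (4 ^ n * moment_bound n C e)"
proof -
  have f_meas: "f \<in> borel_measurable borel" using f by (rule borel_measurable_continuous_onI)
  have C0: "0 \<le> C" using C[of 0] by linarith
  have B0: "0 \<le> moment_bound n C e"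
    using C0 by (simp add: moment_bound_def moment_rate_def diff_rate_def)
  define h where "h e' = (\<integral>\<^sup>+\<omega>. ennreal (\<bar>pairing_diff f (smoothed_intersection_measure p W t e' \<omega>) (L \<omega>)\<bar> powr real (2 * n)) \<partial>M)" for e'
  have "bounded (range f)" using C by (auto simp: bounded_iff)
  then have h: "(h \<longlongrightarrow> 0) (at_right 0)"
    unfolding h_def using L f n by (auto simp: is_intersection_measure_def)
  have le: "(\<integral>\<^sup>+\<omega>. ennreal (\<bar>(\<integral>x. f x \<partial>L \<omega>) - smoothed_pairing f t e \<omega>\<bar> ^ (2 * n)) \<partial>M)
    \<le> ennreal (4 ^ n) * (h e' + ennreal (moment_bound n C e))" if e': "0 < e'" "e' \<le> e" for e'
  proof -
    let ?X = "\<lambda>\<omega>. (\<integral>x. f x \<partial>L \<omega>) - smoothed_pairing f t e' \<omega>"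
    let ?Y = "\<lambda>\<omega>. smoothed_pairing f t e' \<omega> - smoothed_pairing f t e \<omega>"
    have [measurable]: "?X \<in> borel_measurable M" "?Y \<in> borel_measurable M"
      using L_integral_measurable[OF f_meas C] smoothed_pairing_measurable[OF f_meas] by measurable
    have hX: "h e' = (\<integral>\<^sup>+\<omega>. ennreal (\<bar>?X \<omega>\<bar> ^ (2 * n)) \<partial>M)"
      unfolding h_def
    proof (rule nn_integral_cong_AE)
      show "AE \<omega> in M. ennreal (\<bar>pairing_diff f (smoothed_intersection_measure p W t e' \<omega>) (L \<omega>)\<bar> powr real (2 * n))
        = ennreal (\<bar>?X \<omega>\<bar> ^ (2 * n))"
        using VW
      proof eventually_elim
        case (elim \<omega>)
        then have "(\<integral>x. f x \<partial>smoothed_intersection_measure p W t e' \<omega>) = smoothed_pairing f t e' \<omega>"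
          by (intro integral_smoothed_intersection_measure e' f_meas) auto
        then have "\<bar>pairing_diff f (smoothed_intersection_measure p W t e' \<omega>) (L \<omega>)\<bar> = \<bar>?X \<omega>\<bar>"
          by (simp add: pairing_diff_def abs_minus_commute)
        \<comment> \<open>At 0 both powers vanish, the right one because \<open>n\<close> is
          positive.\<close>
        moreover have "\<bar>?X \<omega>\<bar> powr real (2 * n) = \<bar>?X \<omega>\<bar> ^ (2 * n)"
          using n by (cases "?X \<omega> = 0") (simp_all add: powr_realpow del: of_nat_mult)
        ultimately show ?case by simp
      qed
    qed
    have "(\<integral>\<^sup>+\<omega>. ennreal (\<bar>(\<integral>x. f x \<partial>L \<omega>) - smoothed_pairing f t e \<omega>\<bar> ^ (2 * n)) \<partial>M)
      = (\<integral>\<^sup>+\<omega>. ennreal (\<bar>?X \<omega> + ?Y \<omega>\<bar> ^ (2 * n)) \<partial>M)" by simp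
    also have "\<dots> \<le> ennreal (4 ^ n) * ((\<integral>\<^sup>+\<omega>. ennreal (\<bar>?X \<omega>\<bar> ^ (2 * n)) \<partial>M) + (\<integral>\<^sup>+\<omega>. ennreal (\<bar>?Y \<omega>\<bar> ^ (2 * n)) \<partial>M))"
      by (rule nn_integral_abs_power_add_le) measurable
    also have "\<dots> \<le> ennreal (4 ^ n) * (h e' + ennreal (moment_bound n C e))"
      unfolding hX moment_bound_def using t
      by (intro mult_left_mono add_left_mono smoothed_pairing_diff_moment_le[OF f_meas C e' _ lam c weight]) auto
    finally show ?thesis .
  qed
  have "((\<lambda>e'. ennreal (4 ^ n) * (h e' + ennreal (moment_bound n C e))) \<longlongrightarrow> ennreal (4 ^ n) * (0 + ennreal (moment_bound n C e))) (at_right 0)"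
    by (intro ennreal_tendsto_cmult tendsto_add h tendsto_const) simp
  moreover have "\<forall>\<^sub>F e' in at_right 0. (\<integral>\<^sup>+\<omega>. ennreal (\<bar>(\<integral>x. f x \<partial>L \<omega>) - smoothed_pairing f t e \<omega>\<bar> ^ (2 * n)) \<partial>M)
      \<le> ennreal (4 ^ n) * (h e' + ennreal (moment_bound n C e))"
    unfolding eventually_at_right[OF e] using e le by (intro exI[of _ e]) auto
  ultimately have "(\<integral>\<^sup>+\<omega>. ennreal (\<bar>(\<integral>x. f x \<partial>L \<omega>) - smoothed_pairing f t e \<omega>\<bar> ^ (2 * n)) \<partial>M)
      \<le> ennreal (4 ^ n) * (0 + ennreal (moment_bound n C e))"
    by (rule tendsto_lowerbound) simp
  then show ?thesis using B0 by (simp add: ennreal_mult)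
qed

text \<open>The total mass is the pairing with the constant 1. It differs from the deterministically
  bounded smoothed mass at parameter 1 by a variable with finite moments.\<close>

lemma L_mass_moment_finite:
  assumes n: "n \<ge> 1"
  shows "(\<integral>\<^sup>+\<omega>. emeasure (L \<omega>) UNIV ^ (2 * n) \<partial>M) < \<infinity>"
proof -
  obtain R where R: "R \<ge> 0" "\<And>\<omega>. emeasure (smoothed_measure t 1 \<omega>) UNIV \<le> ennreal R"
    using smoothed_measure_mass_le[of 1 t] t by auto
  have S_le: "\<bar>smoothed_pairing (\<lambda>_. 1) t 1 \<omega>\<bar> \<le> R" for \<omega>
  proof -
    have "smoothed_pairing (\<lambda>_. 1) t 1 \<omega> = measure (smoothed_measure t 1 \<omega>) UNIV"
      using integral_smoothed_measure[of "\<lambda>_. 1" t 1 \<omega>] by (simp add: smoothed_measure_def)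
    moreover have "measure (smoothed_measure t 1 \<omega>) UNIV \<le> R"
      using R by (metis enn2real_leI measure_def)
    ultimately show ?thesis by simp
  qed
  have L1: "ennreal (\<bar>\<integral>x. 1 \<partial>L \<omega>\<bar> ^ (2 * n)) = emeasure (L \<omega>) UNIV ^ (2 * n)" if \<omega>: "\<omega> \<in> space M" for \<omega>
  proof -
    have "finite_measure (L \<omega>)" "space (L \<omega>) = UNIV"
      using random_L \<omega> sets_eq_imp_space_eq[of "L \<omega>" borel] by (auto simp: random_finite_borel_measure_def)
    then show ?thesis by (simp add: finite_measure.emeasure_eq_measure ennreal_power)
  qed
  have m1: "(\<lambda>\<omega>. \<integral>x. 1 \<partial>L \<omega> :: real) \<in> borel_measurable M"
    by (rule L_integral_measurable[where C = 1]) auto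
  have [measurable]: "(\<lambda>\<omega>. (\<integral>x. 1 \<partial>L \<omega>) - smoothed_pairing (\<lambda>_. 1) t 1 \<omega>) \<in> borel_measurable M"
    "smoothed_pairing (\<lambda>_. 1) t 1 \<in> borel_measurable M"
    using m1 smoothed_pairing_measurable[of "\<lambda>_. 1" t 1] by measurable
  have "(\<integral>\<^sup>+\<omega>. emeasure (L \<omega>) UNIV ^ (2 * n) \<partial>M)
    = (\<integral>\<^sup>+\<omega>. ennreal (\<bar>((\<integral>x. 1 \<partial>L \<omega>) - smoothed_pairing (\<lambda>_. 1) t 1 \<omega>) + smoothed_pairing (\<lambda>_. 1) t 1 \<omega>\<bar> ^ (2 * n)) \<partial>M)"
    by (intro nn_integral_cong) (simp only: L1[symmetric] diff_add_cancel)
  also have "\<dots> \<le> ennreal (4 ^ n) * ((\<integral>\<^sup>+\<omega>. ennreal (\<bar>(\<integral>x. 1 \<partial>L \<omega>) - smoothed_pairing (\<lambda>_. 1) t 1 \<omega>\<bar> ^ (2 * n)) \<partial>M)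
      + (\<integral>\<^sup>+\<omega>. ennreal (\<bar>smoothed_pairing (\<lambda>_. 1) t 1 \<omega>\<bar> ^ (2 * n)) \<partial>M))"
    by (rule nn_integral_abs_power_add_le) measurable
  also have "\<dots> \<le> ennreal (4 ^ n) * (ennreal (4 ^ n * moment_bound n 1 1) + (\<integral>\<^sup>+\<omega>. ennreal (R ^ (2 * n)) \<partial>M))"
    using S_le n by (intro mult_left_mono add_mono continuous_moment_le nn_integral_mono ennreal_leI power_mono) auto
  also have "\<dots> < \<infinity>"
    by (simp add: emeasure_space_1 ennreal_mult_less_top)
  finally show ?thesis .
qed

text \<open>Convergence to the intersection measure is known for continuous test functions only.
  Here \<open>f\<close> is replaced by a continuous \<open>g\<close> that is close to it for a
  deterministic measure controlling both random measures. This \<open>g\<close> depends on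
  \<open>n\<close>, \<open>t\<close> and \<open>e\<close>, but the bound of the continuous case sees
  it only through \<open>C\<close>, so nothing is lost.\<close>

lemma bounded_moment_le:
  assumes f: "f \<in> borel_measurable borel" and C: "\<And>x. \<bar>f x\<bar> \<le> C" and C0: "C > 0" and e: "e > 0" and n: "n \<ge> 1"
  shows "(\<integral>\<^sup>+\<omega>. ennreal (\<bar>(\<integral>x. f x \<partial>L \<omega>) - smoothed_pairing f t e \<omega>\<bar> ^ (2 * n)) \<partial>M)
    \<le> ennreal (32 ^ n * moment_bound n C e)"
proof -
  define m where "m = 2 * n - 1"
  have Sm: "Suc m = 2 * n" using n by (simp add: m_def)
  define B where "B = moment_bound n C e"
  have B: "0 < B" unfolding B_def using C0 e by (rule moment_bound_pos)
  have t0: "t \<ge> 0" using t by simp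
  have rS: "random_finite_borel_measure M (smoothed_measure t e)"
    by (rule random_finite_borel_measure_smoothed_measure[OF e t0])
  obtain R where R: "R \<ge> 0" "\<And>\<omega>. emeasure (smoothed_measure t e \<omega>) UNIV \<le> ennreal R"
    using smoothed_measure_mass_le[OF e t0] by auto
  have finL: "(\<integral>\<^sup>+\<omega>. emeasure (L \<omega>) UNIV ^ Suc m \<partial>M) < \<infinity>"
    unfolding Sm by (rule L_mass_moment_finite[OF n])
  have "(\<integral>\<^sup>+\<omega>. emeasure (smoothed_measure t e \<omega>) UNIV ^ Suc m \<partial>M) \<le> (\<integral>\<^sup>+\<omega>. ennreal R ^ Suc m \<partial>M)"
    by (intro nn_integral_mono power_mono R) auto
  also have "\<dots> < \<infinity>" by (simp add: emeasure_space_1 ennreal_mult_less_top power_less_top_ennreal)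
  finally have finS: "(\<integral>\<^sup>+\<omega>. emeasure (smoothed_measure t e \<omega>) UNIV ^ Suc m \<partial>M) < \<infinity>" .
  obtain \<nu>1 where \<nu>1: "sets \<nu>1 = sets borel" "emeasure \<nu>1 UNIV \<noteq> \<infinity>"
    "\<And>h B. h \<in> borel_measurable borel \<Longrightarrow> (\<And>x. \<bar>h x\<bar> \<le> B) \<Longrightarrow>
      (\<integral>\<^sup>+\<omega>. ennreal (\<bar>\<integral>x. h x \<partial>L \<omega>\<bar> ^ Suc m) \<partial>M) \<le> ennreal (B ^ m) * (\<integral>\<^sup>+x. ennreal \<bar>h x\<bar> \<partial>\<nu>1)"
    using random_integral_power_le[OF random_L finL] by blast
  obtain \<nu>2 where \<nu>2: "sets \<nu>2 = sets borel" "emeasure \<nu>2 UNIV \<noteq> \<infinity>"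
    "\<And>h B. h \<in> borel_measurable borel \<Longrightarrow> (\<And>x. \<bar>h x\<bar> \<le> B) \<Longrightarrow>
      (\<integral>\<^sup>+\<omega>. ennreal (\<bar>\<integral>x. h x \<partial>smoothed_measure t e \<omega>\<bar> ^ Suc m) \<partial>M) \<le> ennreal (B ^ m) * (\<integral>\<^sup>+x. ennreal \<bar>h x\<bar> \<partial>\<nu>2)"
    using random_integral_power_le[OF rS finS] by blast
  \<comment> \<open>The mixture over two indices is the sum of both measures; a single
    \<open>g\<close> has to serve both pairings.\<close>
  obtain \<nu> where \<nu>: "sets \<nu> = sets borel"
    "\<And>f. f \<in> borel_measurable borel \<Longrightarrow> (\<integral>\<^sup>+x. f x \<partial>\<nu>)
      = (\<integral>\<^sup>+b. 1 * (\<integral>\<^sup>+x. f x \<partial>(if b then \<nu>1 else \<nu>2)) \<partial>count_space (UNIV :: bool set))"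
    by (rule mixture_measure_exists[of "count_space (UNIV :: bool set)" "\<lambda>b. if b then \<nu>1 else \<nu>2" "\<lambda>_. 1"])
      (auto simp: \<nu>1 \<nu>2)
  have \<nu>_sum: "(\<integral>\<^sup>+x. f x \<partial>\<nu>) = (\<integral>\<^sup>+x. f x \<partial>\<nu>1) + (\<integral>\<^sup>+x. f x \<partial>\<nu>2)" if "f \<in> borel_measurable borel" for f
    using \<nu>(2)[OF that] by (simp add: nn_integral_count_space_finite UNIV_bool add.commute)
  have fin\<nu>: "emeasure \<nu> UNIV \<noteq> \<infinity>"
    using \<nu>_sum[of "\<lambda>_. 1"] \<nu>1(2) \<nu>2(2) sets_eq_imp_space_eq[OF \<nu>(1)] sets_eq_imp_space_eq[OF \<nu>1(1)] sets_eq_imp_space_eq[OF \<nu>2(1)]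
    by simp
  define A where "A = (2 * C) ^ m"
  have A: "0 < A" using C0 by (simp add: A_def)
  \<comment> \<open>The factor \<open>A\<close> bounds \<open>2 * n - 1\<close> powers of
    \<open>f - g\<close>, so this precision makes the two error moments add up to at most
    \<open>B\<close>.\<close>
  define \<delta> where "\<delta> = B / A"
  have \<delta>: "0 < \<delta>" using A B by (simp add: \<delta>_def)
  obtain g where g: "continuous_on UNIV g" "\<And>x. \<bar>g x\<bar> \<le> C" "(\<integral>\<^sup>+x. ennreal \<bar>f x - g x\<bar> \<partial>\<nu>) < ennreal \<delta>"
    using continuous_approximation[OF \<nu>(1) fin\<nu> f C \<delta>] by blast
  have g_meas: "g \<in> borel_measurable borel" using g(1) by (rule borel_measurable_continuous_onI)
  define h where "h x = f x - g x" for x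
  have h_meas: "h \<in> borel_measurable borel" unfolding h_def using f g_meas by measurable
  have hC: "\<bar>h x\<bar> \<le> 2 * C" for x unfolding h_def using C[of x] g(2)[of x] by linarith
  let ?Lf = "\<lambda>f \<omega>. \<integral>x. f x \<partial>L \<omega>" and ?S = "\<lambda>f. smoothed_pairing f t e"
  have [measurable]: "?Lf h \<in> borel_measurable M" "?Lf g \<in> borel_measurable M" "?S h \<in> borel_measurable M" "?S g \<in> borel_measurable M"
    using L_integral_measurable[OF h_meas hC] L_integral_measurable[OF g_meas g(2)]
      smoothed_pairing_measurable[OF h_meas] smoothed_pairing_measurable[OF g_meas] by auto
  have int: "integrable N f'" if "finite_measure N" "sets N = sets borel" "f' \<in> borel_measurable borel" "\<And>x. \<bar>f' x\<bar> \<le> C'"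
    for N and f' :: "real ^ 'd \<Rightarrow> real" and C'
    using that by (intro integral_eq_enn2real_diff(1)[of N f' C']) (simp_all cong: measurable_cong_sets)
  have split: "?Lf f \<omega> - ?S f \<omega> = (?Lf h \<omega> + - ?S h \<omega>) + (?Lf g \<omega> - ?S g \<omega>)" if \<omega>: "\<omega> \<in> space M" for \<omega>
  proof -
    have "?Lf h \<omega> = ?Lf f \<omega> - ?Lf g \<omega>"
      unfolding h_def using random_L \<omega> f g_meas C g(2)
      by (intro Bochner_Integration.integral_diff int) (auto simp: random_finite_borel_measure_def)
    moreover have "?S h \<omega> = ?S f \<omega> - ?S g \<omega>"
      unfolding integral_smoothed_measure[OF h_meas, symmetric] integral_smoothed_measure[OF f, symmetric]
        integral_smoothed_measure[OF g_meas, symmetric]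
      unfolding h_def using rS \<omega> f g_meas C g(2)
      by (intro Bochner_Integration.integral_diff int) (auto simp: random_finite_borel_measure_def)
    ultimately show ?thesis by simp
  qed
  have hpart: "(\<integral>\<^sup>+\<omega>. ennreal (\<bar>?Lf h \<omega>\<bar> ^ (2 * n)) \<partial>M) + (\<integral>\<^sup>+\<omega>. ennreal (\<bar>- ?S h \<omega>\<bar> ^ (2 * n)) \<partial>M) \<le> ennreal B"
  proof -
    have "(\<integral>\<^sup>+\<omega>. ennreal (\<bar>?Lf h \<omega>\<bar> ^ (2 * n)) \<partial>M) + (\<integral>\<^sup>+\<omega>. ennreal (\<bar>- ?S h \<omega>\<bar> ^ (2 * n)) \<partial>M)
       \<le> ennreal A * (\<integral>\<^sup>+x. ennreal \<bar>h x\<bar> \<partial>\<nu>1) + ennreal A * (\<integral>\<^sup>+x. ennreal \<bar>h x\<bar> \<partial>\<nu>2)"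
      unfolding A_def Sm[symmetric] abs_minus_cancel integral_smoothed_measure[OF h_meas, symmetric]
      by (intro add_mono \<nu>1(3) \<nu>2(3) h_meas hC)
    also have "\<dots> = ennreal A * (\<integral>\<^sup>+x. ennreal \<bar>h x\<bar> \<partial>\<nu>)"
      using h_meas by (subst \<nu>_sum) (auto simp: distrib_left)
    also have "\<dots> \<le> ennreal A * ennreal \<delta>"
      unfolding h_def by (rule mult_left_mono[OF less_imp_le[OF g(3)]]) simp
    also have "\<dots> = ennreal B" using A B by (simp add: \<delta>_def ennreal_mult[symmetric])
    finally show ?thesis .
  qed
  have "(\<integral>\<^sup>+\<omega>. ennreal (\<bar>?Lf f \<omega> - ?S f \<omega>\<bar> ^ (2 * n)) \<partial>M)
    = (\<integral>\<^sup>+\<omega>. ennreal (\<bar>(?Lf h \<omega> + - ?S h \<omega>) + (?Lf g \<omega> - ?S g \<omega>)\<bar> ^ (2 * n)) \<partial>M)"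
    by (intro nn_integral_cong) (simp only: split)
  also have "\<dots> \<le> ennreal (4 ^ n) * ((\<integral>\<^sup>+\<omega>. ennreal (\<bar>?Lf h \<omega> + - ?S h \<omega>\<bar> ^ (2 * n)) \<partial>M) + (\<integral>\<^sup>+\<omega>. ennreal (\<bar>?Lf g \<omega> - ?S g \<omega>\<bar> ^ (2 * n)) \<partial>M))"
    by (rule nn_integral_abs_power_add_le) measurable
  also have "\<dots> \<le> ennreal (4 ^ n) * (ennreal (4 ^ n) * ennreal B + ennreal (4 ^ n * B))"
  proof (intro mult_left_mono add_mono)
    have "(\<integral>\<^sup>+\<omega>. ennreal (\<bar>?Lf h \<omega> + - ?S h \<omega>\<bar> ^ (2 * n)) \<partial>M)
      \<le> ennreal (4 ^ n) * ((\<integral>\<^sup>+\<omega>. ennreal (\<bar>?Lf h \<omega>\<bar> ^ (2 * n)) \<partial>M) + (\<integral>\<^sup>+\<omega>. ennreal (\<bar>- ?S h \<omega>\<bar> ^ (2 * n)) \<partial>M))"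
      by (rule nn_integral_abs_power_add_le) measurable
    also have "\<dots> \<le> ennreal (4 ^ n) * ennreal B" by (intro mult_left_mono hpart) auto
    finally show "(\<integral>\<^sup>+\<omega>. ennreal (\<bar>?Lf h \<omega> + - ?S h \<omega>\<bar> ^ (2 * n)) \<partial>M) \<le> ennreal (4 ^ n) * ennreal B" .
    show "(\<integral>\<^sup>+\<omega>. ennreal (\<bar>?Lf g \<omega> - ?S g \<omega>\<bar> ^ (2 * n)) \<partial>M) \<le> ennreal (4 ^ n * B)"
      unfolding B_def by (rule continuous_moment_le[OF g(1,2) e n])
  qed auto
  also have "\<dots> = ennreal (4 ^ n * (4 ^ n * B + 4 ^ n * B))"
    using B by (simp add: ennreal_mult[symmetric] ennreal_plus[symmetric] del: ennreal_plus)
  also have "\<dots> \<le> ennreal (32 ^ n * B)"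
  proof (rule ennreal_leI)
    \<comment> \<open>Two splittings give \<open>4 ^ n * (4 ^ n + 4 ^ n)\<close>, and the remaining
      2 is absorbed into a power, whence 32.\<close>
    have "(2::real) \<le> 2 ^ n" using n self_le_power[of "2::real" n] by simp
    then have "(4::real) ^ n * 4 ^ n * 2 \<le> 4 ^ n * 4 ^ n * 2 ^ n" by (intro mult_left_mono) auto
    also have "\<dots> = 32 ^ n" by (simp add: power_mult_distrib[symmetric])
    finally have "(4::real) ^ n * 4 ^ n * 2 * B \<le> 32 ^ n * B" using B by (intro mult_right_mono) auto
    then show "4 ^ n * (4 ^ n * B + 4 ^ n * B) \<le> 32 ^ n * B" by (simp add: algebra_simps)
  qed
  finally show ?thesis by (simp add: B_def)
qed

text \<open>The smallness condition makes the geometric ratio at most 1/2. It involves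
  \<open>e\<close> and \<open>c\<close> but not \<open>t\<close>, which enters only through the
  exponential prefactor.\<close>

lemma exp_pairing_le:
  assumes f: "f \<in> borel_measurable borel" and C: "\<And>x. \<bar>f x\<bar> \<le> C" and C0: "C > 0" and e: "e > 0"
    and small: "6 ^ (2 * p) * (32 * moment_rate CARD('d) p C c e) \<le> 1 / 2"
  shows "(\<integral>\<^sup>+\<omega>. ennreal (exp (\<bar>pairing_diff f (L \<omega>) (smoothed_intersection_measure p W t e \<omega>)\<bar> powr (1 / real p))) \<partial>M)
    \<le> ennreal (2 * exp (real (2 * p)) * exp (real p * lam * t))"
proof -
  let ?\<xi> = "\<lambda>\<omega>. (\<integral>x. f x \<partial>L \<omega>) - smoothed_pairing f t e \<omega>"
  have "(\<integral>\<^sup>+\<omega>. ennreal (exp (\<bar>pairing_diff f (L \<omega>) (smoothed_intersection_measure p W t e \<omega>)\<bar> powr (1 / real p))) \<partial>M)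
    = (\<integral>\<^sup>+\<omega>. ennreal (exp (\<bar>?\<xi> \<omega>\<bar> powr (1 / real p))) \<partial>M)"
  proof (rule nn_integral_cong_AE)
    show "AE \<omega> in M. ennreal (exp (\<bar>pairing_diff f (L \<omega>) (smoothed_intersection_measure p W t e \<omega>)\<bar> powr (1 / real p)))
      = ennreal (exp (\<bar>?\<xi> \<omega>\<bar> powr (1 / real p)))"
      using VW
    proof eventually_elim
      case (elim \<omega>)
      then have "(\<integral>x. f x \<partial>smoothed_intersection_measure p W t e \<omega>) = smoothed_pairing f t e \<omega>"
        by (intro integral_smoothed_intersection_measure e f) auto
      then show ?case by (simp add: pairing_diff_def)
    qed
  qed
  also have "\<dots> \<le> ennreal (2 * exp (real (2 * p)) * exp (real p * lam * t))"
  proof (rule exp_root_moment_le[OF _ p_ge])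
    show "?\<xi> \<in> borel_measurable M"
      using L_integral_measurable[OF f C] smoothed_pairing_measurable[OF f] by measurable
    show "1 \<le> exp (real p * lam * t)" using lam t by simp
    show "0 \<le> 32 * moment_rate CARD('d) p C c e" using moment_rate_pos[OF C0 e] by simp
    show "(\<integral>\<^sup>+\<omega>. ennreal (\<bar>?\<xi> \<omega>\<bar> ^ (2 * n)) \<partial>M)
      \<le> ennreal (fact (2 * n) ^ p * exp (real p * lam * t) * (32 * moment_rate CARD('d) p C c e) ^ n)" if "1 \<le> n" for n
      using bounded_moment_le[OF f C C0 e that] by (simp add: moment_bound_def power_mult_distrib mult_ac)
  qed (rule small)
  finally show ?thesis .
qed

end

section \<open>Exponential growth rate\<close>

lemma moment_rate_tendsto_0:
  assumes "p \<ge> 1"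
  shows "((\<lambda>e. moment_rate d p C c e) \<longlongrightarrow> 0) (at_right 0)"
proof -
  have "((\<lambda>e. real d * e / 8) \<longlongrightarrow> real d * 0 / 8) (at_right 0)" by (intro tendsto_intros) auto
  then have "((\<lambda>e. (real d * e / 8) powr (1 / (4 * real p))) \<longlongrightarrow> 0) (at_right 0)"
    using assms
    by (intro tendsto_zero_powrI[where b = "1 / (4 * real p)"]) 
      (auto intro: eventually_mono[OF eventually_at_right_less[of 0]])
  then have "((\<lambda>e. moment_rate d p C c e) \<longlongrightarrow> (real p)\<^sup>2 * C\<^sup>2 * ((4 * c\<^sup>2) ^ (p - 1) * (2 * (12 * 0) * c\<^sup>2))) (at_right 0)"
    unfolding moment_rate_def diff_rate_def by (intro tendsto_intros)
  then show ?thesis by simp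
qed

lemma ereal_ln_nonneg: "1 \<le> x \<Longrightarrow> 0 \<le> ereal_ln x"
  by (cases x) (auto simp: ereal_ln_def)

lemma ereal_ln_le:
  assumes "1 \<le> x" "x \<le> ennreal r"
  shows "ereal_ln x \<le> ereal (ln r)"
proof -
  from assms obtain y where y: "x = ennreal y" "0 \<le> y" by (cases x) (auto simp: top_unique)
  have "1 \<le> y" using assms y by simp
  moreover have "y \<le> r" using assms y \<open>1 \<le> y\<close> by (cases "0 \<le> r") (auto simp: ennreal_neg)
  ultimately show ?thesis using y by (auto simp: ereal_ln_def)
qed

theorem proposition1p11:
  fixes M :: "'w measure"
    and p :: nat
    and W :: "nat \<Rightarrow> real \<Rightarrow> 'w \<Rightarrow> real ^ 'd"
    and L :: "real \<Rightarrow> 'w \<Rightarrow> (real ^ 'd) measure"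
    and f :: "real ^ 'd \<Rightarrow> real"
  assumes "prob_space M"
    and "p \<ge> 2"
    and "CARD('d) * (p - 1) < 2 * p"
    and "independent_brownian_motions M p W"
    and "\<And>t. t > 0 \<Longrightarrow> is_intersection_measure M p W t (L t)"
    and "f \<in> borel_measurable borel"
    and "bounded (range f)"
  shows "Limsup (at_right 0) (\<lambda>\<epsilon>::real. Limsup at_top (\<lambda>t::real.
           ereal (1 / t) * ereal_ln (\<integral>\<^sup>+\<omega>. ennreal (exp
             (\<bar>pairing_diff f (L t \<omega>) (smoothed_intersection_measure p W t \<epsilon> \<omega>)\<bar>
                powr (1 / real p))) \<partial>M))) = 0"
proof -
  interpret prob_space M by fact
  have p1: "p \<ge> 1" using assms(2) by simp
  define Z where "Z t e = (\<integral>\<^sup>+\<omega>. ennreal (exp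
    (\<bar>pairing_diff f (L t \<omega>) (smoothed_intersection_measure p W t e \<omega>)\<bar> powr (1 / real p))) \<partial>M)" for t e
  have Z1: "1 \<le> Z t e" for t e
  proof -
    have "(1::ennreal) = (\<integral>\<^sup>+\<omega>. 1 \<partial>M)" by (simp add: emeasure_space_1)
    also have "\<dots> \<le> Z t e" unfolding Z_def by (intro nn_integral_mono) simp
    finally show ?thesis .
  qed
  obtain C' where C': "\<And>x. \<bar>f x\<bar> \<le> C'" using assms(7) by (auto simp: bounded_iff)
  \<comment> \<open>Shifted by 1 to be positive even for \<open>f = 0\<close>.\<close>
  define C where "C = \<bar>C'\<bar> + 1"
  have C: "\<bar>f x\<bar> \<le> C" for x using C'[of x] by (simp add: C_def)
  have C0: "C > 0" by (simp add: C_def add_nonneg_pos)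
  obtain V where V: "independent_continuous_bm M {1..p} V" "AE \<omega> in M. \<forall>j\<in>{1..p}. \<forall>s\<ge>0. V j s \<omega> = W j s \<omega>"
    by (rule independent_continuous_modification[OF assms(1) p1 assms(4)])
  \<comment> \<open>Both \<open>c\<close> and the threshold for \<open>e\<close> depend on
    \<open>lam\<close> but not on \<open>t\<close>, so a fixed \<open>e\<close> works for all
    times.\<close>
  have upper: "\<forall>\<^sub>F e in at_right 0. Limsup at_top (\<lambda>t. ereal (1 / t) * ereal_ln (Z t e)) \<le> ereal (real p * lam)"
    if lam: "lam > 0" for lam
  proof -
    obtain c where c: "c > 0"
      "(\<integral>\<^sup>+r. ennreal (exp (- lam * r) * time_weight CARD('d) p r) * indicator {0<..} r \<partial>lborel) \<le> ennreal c"
      using exists_time_weight_bound[OF p1 assms(3) lam] by blast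
    have "((\<lambda>e. 6 ^ (2 * p) * (32 * moment_rate CARD('d) p C c e)) \<longlongrightarrow> 6 ^ (2 * p) * (32 * 0)) (at_right 0)"
      by (intro tendsto_intros moment_rate_tendsto_0[OF p1])
    then have "\<forall>\<^sub>F e in at_right 0. 6 ^ (2 * p) * (32 * moment_rate CARD('d) p C c e) < 1 / 2"
      by (rule order_tendstoD) simp
    moreover have "\<forall>\<^sub>F e in at_right (0::real). 0 < e" by (rule eventually_at_right_less)
    ultimately show ?thesis
    proof eventually_elim
      case (elim e)
      have Zle: "Z t e \<le> ennreal (2 * exp (real (2 * p)) * exp (real p * lam * t))" if t: "t > 0" for t
      proof -
        interpret intersection_setting M p V W "L t" t lam c
          using V assms(5)[OF t] t lam c
          by (intro intersection_setting.intro intersection_setting_axioms.intro independent_continuous_bm_nat.intro)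
        show ?thesis
          unfolding Z_def using elim by (intro exp_pairing_le[OF assms(6) C C0]) auto
      qed
      \<comment> \<open>The constant prefactor disappears after division by \<open>t\<close>; only
        the exponential in \<open>t\<close> contributes to the rate.\<close>
      let ?b = "\<lambda>t. ln (2 * exp (real (2 * p))) / t + real p * lam"
      have le: "ereal (1 / t) * ereal_ln (Z t e) \<le> ereal (?b t)" if t: "t > 0" for t
      proof -
        have "ereal_ln (Z t e) \<le> ereal (ln (2 * exp (real (2 * p)) * exp (real p * lam * t)))"
          by (rule ereal_ln_le[OF Z1 Zle[OF t]])
        also have "ln (2 * exp (real (2 * p)) * exp (real p * lam * t)) = ln (2 * exp (real (2 * p))) + real p * lam * t"
          by (subst ln_mult) auto
        finally have "ereal (1 / t) * ereal_ln (Z t e) \<le> ereal (1 / t) * ereal (ln (2 * exp (real (2 * p))) + real p * lam * t)"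
          using t by (intro ereal_mult_left_mono) auto
        also have "\<dots> = ereal (?b t)" using t by (simp add: field_simps)
        finally show ?thesis .
      qed
      have "((\<lambda>t. ln (2 * exp (real (2 * p))) / t) \<longlongrightarrow> 0) at_top"
        by (rule tendsto_divide_0[OF tendsto_const filterlim_at_top_imp_at_infinity[OF filterlim_ident]])
      then have "(?b \<longlongrightarrow> 0 + real p * lam) at_top"
        by (intro tendsto_add tendsto_const)
      then have "((\<lambda>t. ereal (?b t)) \<longlongrightarrow> ereal (real p * lam)) at_top"
        by (intro tendsto_ereal) simp
      then have "Limsup at_top (\<lambda>t. ereal (?b t)) = ereal (real p * lam)"
        by (intro lim_imp_Limsup) auto
      moreover have "Limsup at_top (\<lambda>t. ereal (1 / t) * ereal_ln (Z t e)) \<le> Limsup at_top (\<lambda>t. ereal (?b t))"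
        using le by (intro Limsup_mono eventually_mono[OF eventually_gt_at_top[of 0]]) auto
      ultimately show ?case by simp
    qed
  qed
  have "Limsup (at_right 0) (\<lambda>e. Limsup at_top (\<lambda>t. ereal (1 / t) * ereal_ln (Z t e))) \<le> 0"
  proof (rule ereal_le_epsilon2)
    fix \<eta> :: real assume "0 < \<eta>"
    \<comment> \<open>With \<open>lam\<close> equal to this quotient the \<open>p\<close> motions
      together contribute the rate \<open>\<eta>\<close>.\<close>
    then have "\<eta> / real p > 0" using p1 by simp
    from upper[OF this] p1
    have "\<forall>\<^sub>F e in at_right 0. Limsup at_top (\<lambda>t. ereal (1 / t) * ereal_ln (Z t e)) \<le> ereal \<eta>" by simp
    then show "Limsup (at_right 0) (\<lambda>e. Limsup at_top (\<lambda>t. ereal (1 / t) * ereal_ln (Z t e))) \<le> 0 + ereal \<eta>"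
      by (simp add: Limsup_bounded)
  qed
  \<comment> \<open>The integrand is at least 1, so by \<open>Z1\<close> the logarithm is
    nonnegative for every \<open>e\<close> and \<open>t\<close>.\<close>
  moreover have "0 \<le> Limsup (at_right 0) (\<lambda>e. Limsup at_top (\<lambda>t. ereal (1 / t) * ereal_ln (Z t e)))"
  proof -
    have "0 \<le> Limsup at_top (\<lambda>t. ereal (1 / t) * ereal_ln (Z t e))" for e
    proof (rule le_Limsup)
      show "\<forall>\<^sub>F t in at_top. 0 \<le> ereal (1 / t) * ereal_ln (Z t e)"
        using eventually_gt_at_top[of 0] by eventually_elim (auto intro!: ereal_0_le_mult ereal_ln_nonneg Z1)
    qed simp
    then show ?thesis by (intro le_Limsup) auto
  qed
  ultimately show ?thesis unfolding Z_def by (rule antisym)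
qed

end
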